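(* (i) Let $n \in \mathbb{N}$, let $\mathcal{A}$ be an irreducible $\mathbb{R}$-algebra of matrices in $M_n(\mathbb{R})$, and let $r \in \mathbb{N}$ be the smallest nonzero rank present in $\mathcal{A}$. Then the integer $r$, which divides $n$, is $1$, $2$, or $4$, and $\mathcal{A} = M_n(\mathbb{R})$, or $\mathcal{A} \sim M_{n/2}(\mathbb{C})$, or $\mathcal{A} \sim M_{n/4}(\mathbb{H})$, depending on whether $r = 1$, $r = 2$, or $r = 4$, respectively. In particular, $\mathcal{A} = M_n(\mathbb{R})$ iff $r = 1$. (ii) Let $n \in \mathbb{N}$, let $\mathcal{A}$ be an irreducible $\mathbb{R}$-algebra of matrices in $M_n(\mathbb{C})$, and let $r \in \mathbb{N}$ be the smallest nonzero rank present in $\mathcal{A}$. Then the integer $r$, which divides $n$, is $1$ or $2$, and $\mathcal{A} = M_n(\mathbb{C})$ or $\mathcal{A} \sim M_n(\mathbb{R})$ if $r = 1$, or $\mathcal{A} \sim M_{n/2}(\mathbb{H})$ if $r = 2$. (iii) Let $n \in \mathbb{N}$, let $\mathcal{A}$ be an irreducible $\mathbb{R}$-algebra of matrices in $M_n(\mathbb{H})$, and let $r \in \mathbb{N}$ be the smallest nonzero rank present in $\mathcal{A}$. Then $r = 1$ and $\mathcal{A} = M_n(\mathbb{H})$, $\mathcal{A} \sim M_n(\mathbb{C})$, or $\mathcal{A} \sim M_n(\mathbb{R})$.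
   Context: $\mathbb{H}$ denotes the division ring of real quaternions. Let $D$ be $\mathbb{R}$, $\mathbb{C}$ or $\mathbb{H}$. $M_n(D)$ is the ring of all $n \times n$ matrices over $D$; its members are viewed as linear transformations acting on the left of $D^n$, the right vector space over $D$ of $n \times 1$ column vectors, and ranks of matrices in $M_n(D)$ are taken over $D$. An $\mathbb{R}$-algebra in $M_n(D)$ is a subring of $M_n(D)$ that is closed under scalar multiplication by real numbers. A family $\mathcal{F} \subseteq M_n(D)$ is irreducible if the orbit of any nonzero $x \in D^n$ under the multiplicative semigroup generated by $\mathcal{F}$ spans $D^n$ over $D$ (when $n > 1$, this is equivalent to the members of $\mathcal{F}$ having no common invariant subspace other than $\{0\}$ and $D^n$). For $\mathcal{A}, \mathcal{B} \subseteq M_n(D)$, $\mathcal{A} \sim \mathcal{B}$ (similarity) means that there is an invertible $P \in M_n(D)$ with $\mathcal{A} = P^{-1}\mathcal{B}P = \{P^{-1}BP : B \in \mathcal{B}\}$; in parts (i), (ii), (iii) this is taken with $D = \mathbb{R}, \mathbb{C}, \mathbb{H}$, respectively. In (ii) and (iii), $M_n(\mathbb{R})$ and $M_n(\mathbb{C})$ are viewed as subsets of $M_n(\mathbb{C})$ or $M_n(\mathbb{H})$ via $\mathbb{R} \subset \mathbb{C} \subset \mathbb{H}$. In (i), $M_{n/2}(\mathbb{C})$ is viewed as a subset of $M_n(\mathbb{R})$ by replacing each complex entry $a + bi$ by the block $\begin{bmatrix} a & -b \\ b & a \end{bmatrix}$, and $M_{n/4}(\mathbb{H})$ is viewed as a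 subset of $M_n(\mathbb{R})$ by replacing each quaternion entry $a + bi + cj + dk$ by the block $\begin{bmatrix} a & -b & c & -d \\ b & a & d & c \\ -c & -d & a & b \\ d & -c & -b & a \end{bmatrix}$. In (ii), $M_{n/2}(\mathbb{H})$ is viewed as a subset of $M_n(\mathbb{C})$ by replacing each quaternion entry $z + wj$ ($z, w \in \mathbb{C}$) by the block $\begin{bmatrix} z & w \\ -\overline{w} & \overline{z} \end{bmatrix}$. *)

theory Defs
  imports "HOL-Analysis.Analysis" "Jordan_Normal_Form.Matrix"
begin

section \<open>The division ring of real quaternions\<close>

datatype quat = Quat (qRe: real) (qI: real) (qJ: real) (qK: real)

lemma quat_eq_iff: "x = y \<longleftrightarrow> qRe x = qRe y \<and> qI x = qI y \<and> qJ x = qJ y \<and> qK x = qK y"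
  by (cases x; cases y) simp

instantiation quat :: real_div_algebra
begin

definition zero_quat :: quat where "0 = Quat 0 0 0 0"

definition one_quat :: quat where "1 = Quat 1 0 0 0"

definition plus_quat :: "quat \<Rightarrow> quat \<Rightarrow> quat" where
  "x + y = Quat (qRe x + qRe y) (qI x + qI y) (qJ x + qJ y) (qK x + qK y)"

definition uminus_quat :: "quat \<Rightarrow> quat" where
  "- x = Quat (- qRe x) (- qI x) (- qJ x) (- qK x)"

definition minus_quat :: "quat \<Rightarrow> quat \<Rightarrow> quat" where
  "x - y = Quat (qRe x - qRe y) (qI x - qI y) (qJ x - qJ y) (qK x - qK y)"

definition scaleR_quat :: "real \<Rightarrow> quat \<Rightarrow> quat" where
  "r *\<^sub>R x = Quat (r * qRe x) (r * qI x) (r * qJ x) (r * qK x)"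

(* Hamilton's convention: i^2 = j^2 = k^2 = -1, ij = k = -ji *)
definition times_quat :: "quat \<Rightarrow> quat \<Rightarrow> quat" where
  "x * y = Quat
     (qRe x * qRe y - qI x * qI y - qJ x * qJ y - qK x * qK y)
     (qRe x * qI y + qI x * qRe y + qJ x * qK y - qK x * qJ y)
     (qRe x * qJ y - qI x * qK y + qJ x * qRe y + qK x * qI y)
     (qRe x * qK y + qI x * qJ y - qJ x * qI y + qK x * qRe y)"

(* conjugate divided by squared norm *)
definition inverse_quat :: "quat \<Rightarrow> quat" where
  "inverse x = (1 / ((qRe x)\<^sup>2 + (qI x)\<^sup>2 + (qJ x)\<^sup>2 + (qK x)\<^sup>2)) *\<^sub>R
     Quat (qRe x) (- qI x) (- qJ x) (- qK x)"

definition divide_quat :: "quat \<Rightarrow> quat \<Rightarrow> quat" where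
  "x div y = x * inverse (y :: quat)"

lemmas quat_arith_defs = zero_quat_def one_quat_def plus_quat_def uminus_quat_def
  minus_quat_def scaleR_quat_def times_quat_def inverse_quat_def divide_quat_def

lemma quat_norm_pos:
  assumes "x \<noteq> (0 :: quat)"
  shows "(qRe x)\<^sup>2 + (qI x)\<^sup>2 + (qJ x)\<^sup>2 + (qK x)\<^sup>2 > 0"
proof -
  have "qRe x \<noteq> 0 \<or> qI x \<noteq> 0 \<or> qJ x \<noteq> 0 \<or> qK x \<noteq> 0"
    using assms by (auto simp: quat_eq_iff zero_quat_def)
  thus ?thesis
    by (elim disjE) (simp_all add: add_pos_nonneg add_nonneg_pos)
qed

instance
proof
  fix x y z :: quat and r s :: real
  show "inverse x * x = 1" if "x \<noteq> 0"
    using quat_norm_pos[OF that]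
    by (simp add: quat_arith_defs power2_eq_square mult.commute
        add_divide_distrib[symmetric] diff_divide_distrib[symmetric])
  show "x * inverse x = 1" if "x \<noteq> 0"
    using quat_norm_pos[OF that]
    by (simp add: quat_arith_defs power2_eq_square mult.commute
        add_divide_distrib[symmetric] diff_divide_distrib[symmetric])
  show "inverse (0 :: quat) = 0"
    by (simp add: quat_arith_defs)
qed (auto simp: quat_arith_defs quat_eq_iff algebra_simps)

end

definition quat_of_complex :: "complex \<Rightarrow> quat" where
  "quat_of_complex z = Quat (Re z) (Im z) 0 0"

section \<open>Right linear algebra in column vectors over a division ring\<close>

(* Scalars of D^n act on the right: the coefficients stand to the right of the entries. *)
definition right_lincomb :: "nat \<Rightarrow> ('a :: division_ring vec \<Rightarrow> 'a) \<Rightarrow> 'a vec set \<Rightarrow> 'a vec" where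
  "right_lincomb n c B = vec n (\<lambda>i. \<Sum>v\<in>B. v $ i * c v)"

definition right_span :: "nat \<Rightarrow> 'a :: division_ring vec set \<Rightarrow> 'a vec set" where
  "right_span n S = {right_lincomb n c B | c B. finite B \<and> B \<subseteq> S}"

definition right_basis :: "nat \<Rightarrow> 'a :: division_ring vec set \<Rightarrow> 'a vec set \<Rightarrow> bool" where
  "right_basis n V B \<longleftrightarrow>
     finite B \<and> B \<subseteq> carrier_vec n \<and>
     (\<forall>c. right_lincomb n c B = 0\<^sub>v n \<longrightarrow> (\<forall>v\<in>B. c v = 0)) \<and>
     right_span n B = V"

definition right_dim :: "nat \<Rightarrow> 'a :: division_ring vec set \<Rightarrow> nat" where
  "right_dim n V = card (SOME B. right_basis n V B)"

(* The ranks of the library are only available over fields, hence not over the quaternions. *)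
definition mat_rank :: "'a :: division_ring mat \<Rightarrow> nat" where
  "mat_rank A = right_dim (dim_row A) {A *\<^sub>v x | x. x \<in> carrier_vec (dim_col A)}"

section \<open>Irreducible algebras of matrices\<close>

(* Subrings are not required to contain the identity matrix. *)
definition real_matrix_algebra :: "nat \<Rightarrow> 'a :: real_div_algebra mat set \<Rightarrow> bool" where
  "real_matrix_algebra n \<A> \<longleftrightarrow>
     \<A> \<subseteq> carrier_mat n n \<and> 0\<^sub>m n n \<in> \<A> \<and>
     (\<forall>A\<in>\<A>. \<forall>B\<in>\<A>. A + B \<in> \<A>) \<and>
     (\<forall>A\<in>\<A>. - A \<in> \<A>) \<and>
     (\<forall>A\<in>\<A>. \<forall>B\<in>\<A>. A * B \<in> \<A>) \<and>
     (\<forall>t. \<forall>A\<in>\<A>. map_mat ((*\<^sub>R) t) A \<in> \<A>)"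

inductive_set mult_semigroup :: "'a :: division_ring mat set \<Rightarrow> 'a mat set"
  for \<F> where
  gen: "A \<in> \<F> \<Longrightarrow> A \<in> mult_semigroup \<F>"
| mult: "A \<in> mult_semigroup \<F> \<Longrightarrow> B \<in> mult_semigroup \<F> \<Longrightarrow> A * B \<in> mult_semigroup \<F>"

definition irreducible_family :: "nat \<Rightarrow> 'a :: division_ring mat set \<Rightarrow> bool" where
  "irreducible_family n \<F> \<longleftrightarrow>
     (\<forall>x \<in> carrier_vec n. x \<noteq> 0\<^sub>v n \<longrightarrow>
        right_span n {S *\<^sub>v x | S. S \<in> mult_semigroup \<F>} = carrier_vec n)"

definition min_nonzero_rank :: "'a :: division_ring mat set \<Rightarrow> nat" where
  "min_nonzero_rank \<A> = (LEAST k. k \<noteq> 0 \<and> (\<exists>A\<in>\<A>. mat_rank A = k))"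

definition similar_families :: "nat \<Rightarrow> 'a :: division_ring mat set \<Rightarrow> 'a mat set \<Rightarrow> bool" where
  "similar_families n \<A> \<B> \<longleftrightarrow>
     \<A> \<subseteq> carrier_mat n n \<and> \<B> \<subseteq> carrier_mat n n \<and>
     (\<exists>P \<in> carrier_mat n n. \<exists>Q \<in> carrier_mat n n.
        inverts_mat P Q \<and> inverts_mat Q P \<and> \<A> = (\<lambda>B. Q * B * P) ` \<B>)"

section \<open>Replacing entries by blocks\<close>

definition block_subst :: "nat \<Rightarrow> ('a \<Rightarrow> 'b mat) \<Rightarrow> 'a mat \<Rightarrow> 'b mat" where
  "block_subst k \<beta> A = mat (k * dim_row A) (k * dim_col A)
     (\<lambda>(i, j). \<beta> (A $$ (i div k, j div k)) $$ (i mod k, j mod k))"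

definition complex_block :: "complex \<Rightarrow> real mat" where
  "complex_block z = (let a = Re z; b = Im z in
     mat_of_rows_list 2
       [[a, - b],
        [b,   a]])"

definition quat_real_block :: "quat \<Rightarrow> real mat" where
  "quat_real_block q = (let a = qRe q; b = qI q; c = qJ q; d = qK q in
     mat_of_rows_list 4
       [[  a, - b,   c, - d],
        [  b,   a,   d,   c],
        [- c, - d,   a,   b],
        [  d, - c, - b,   a]])"

(* a + bi + cj + dk = z + wj with z = a + bi and w = c + di *)
definition quat_complex_block :: "quat \<Rightarrow> complex mat" where
  "quat_complex_block q = (let z = Complex (qRe q) (qI q); w = Complex (qJ q) (qK q) in
     mat_of_rows_list 2
       [[      z,     w],
        [- cnj w, cnj z]])"

end

theory Submission
  imports Defs "Jordan_Normal_Form.Spectral_Radius"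
begin

text \<open>
  Let \<open>A\<close> be irreducible and let \<open>T = B * C\<close> be a full-rank factorization of a member of smallest
  nonzero rank \<open>r\<close>.  The corner \<open>C A B\<close> is a real algebra of \<open>r\<close> by \<open>r\<close> matrices which inherits
  irreducibility, and it has no singular members except zero: if \<open>C a B\<close> is singular, then
  \<open>T a T = B (C a B) C\<close> has rank below \<open>r\<close>, so it vanishes and so does \<open>C a B\<close>
  (\<open>corner_division\<close>).

  Every matrix \<open>b\<close> over \<open>\<real>\<close>, \<open>\<complex>\<close> or the quaternions satisfies a real quadratic equation on some
  nonzero vector, because as a real operator it has a complex eigenvalue
  (\<open>real_quadratic_vector\<close>).  In the corner an equation that holds on one nonzero vector holds outright.
  Hence the corner is a domain in which every element is a root of a real quadratic, and
  Frobenius's argument (\<open>quadratic_domain_cases\<close>) shows that it consists of the real scalars, or is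
  spanned by \<open>1\<close> and a \<open>u\<close> with \<open>u * u = - 1\<close>, or by \<open>1\<close>, \<open>u\<close>, \<open>v\<close> and \<open>u * v\<close> subject to the quaternion
  relations.  Irreducibility makes any nonzero vector \<open>x\<close> a generator of the space on which the
  corner acts.  A choice of \<open>x\<close> that is adapted to \<open>u\<close> and \<open>v\<close> therefore gives a basis in which the corner
  becomes one of the block algebras of the theorem, and it reveals the value of \<open>r\<close>
  (\<open>real_division_matrix_algebra\<close> and its complex and quaternionic analogues).

  It remains to recover \<open>A\<close> from its corner.  Irreducibility supplies members \<open>f i\<close> of \<open>A B\<close>
  and \<open>g i\<close> of \<open>C A\<close> such that \<open>g i * f j\<close> is the Kronecker delta and the sum of the \<open>f i * g i\<close> is the
  identity (\<open>complete_dual_system\<close>).  The matrix with the block columns \<open>f i\<close> is then invertible,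
  and conjugation by it takes \<open>a\<close> to the block matrix with the entries \<open>g i * a * f j\<close>.  These
  entries range freely over the corner, so \<open>A\<close> is similar to the algebra of all matrices over the corner
  (\<open>similar_block_subst\<close>).
\<close>

unbundle no vec_syntax

section \<open>Linear systems over a division ring\<close>

text \<open>Gaussian elimination, as an induction on the set of equations: a pivot removes one equation and
  one unknown.  Coefficients stand to the left of the unknowns throughout, which is what makes
  elimination work over a noncommutative ring.\<close>

lemma homogeneous_system_nontrivial:
  fixes f :: "'i \<Rightarrow> 'j \<Rightarrow> 'a :: division_ring"
  assumes "finite I" "finite J" "card I < card J"
  shows "\<exists>y. (\<exists>j\<in>J. y j \<noteq> 0) \<and> (\<forall>i\<in>I. (\<Sum>j\<in>J. f i j * y j) = 0)"
  using assms
proof (induction I arbitrary: J f rule: finite_induct)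
  case empty
  then obtain j where "j \<in> J" by fastforce
  then show ?case by (intro exI[of _ "\<lambda>_. 1"]) auto
next
  case (insert i0 I)
  show ?case
  proof (cases "\<forall>j\<in>J. f i0 j = 0")
    case True
    obtain y where "\<exists>j\<in>J. y j \<noteq> 0" "\<forall>i\<in>I. (\<Sum>j\<in>J. f i j * y j) = 0"
      using insert.IH[of J f] insert.hyps insert.prems by (metis Suc_lessD card_insert_disjoint)
    with True show ?thesis by (intro exI[of _ y]) auto
  next
    case False
    then obtain j0 where j0: "j0 \<in> J" "f i0 j0 \<noteq> 0" by blast
    define g where "g i j = f i j - f i j0 * (inverse (f i0 j0) * f i0 j)" for i j
    have "card I < card (J - {j0})" using insert j0 by simp
    then obtain y where y: "\<exists>j\<in>J - {j0}. y j \<noteq> 0"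
      "\<And>i. i \<in> I \<Longrightarrow> (\<Sum>j\<in>J - {j0}. g i j * y j) = 0"
      using insert.IH[of "J - {j0}" g] insert.prems by auto
    define s where "s i = (\<Sum>j\<in>J - {j0}. f i j * y j)" for i
    define z where "z = y(j0 := - (inverse (f i0 j0) * s i0))"
    have split: "(\<Sum>j\<in>J. f i j * z j) = s i - f i j0 * (inverse (f i0 j0) * s i0)" for i
    proof -
      have "(\<Sum>j\<in>J. f i j * z j) = f i j0 * z j0 + (\<Sum>j\<in>J - {j0}. f i j * z j)"
        using insert.prems j0 by (simp add: sum.remove)
      also have "(\<Sum>j\<in>J - {j0}. f i j * z j) = s i"
        unfolding s_def by (intro sum.cong) (auto simp: z_def)
      finally show ?thesis by (simp add: z_def)
    qed
    have "s i - f i j0 * (inverse (f i0 j0) * s i0) = (\<Sum>j\<in>J - {j0}. g i j * y j)" for i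
      by (simp add: s_def g_def algebra_simps sum_subtractf sum_distrib_left)
    then have "(\<Sum>j\<in>J. f i j * z j) = 0" if "i \<in> I" for i
      using split y(2) that by simp
    moreover have "(\<Sum>j\<in>J. f i0 j * z j) = 0"
      unfolding split using j0 by (simp add: mult.assoc[symmetric])
    moreover have "\<exists>j\<in>J. z j \<noteq> 0" using y(1) by (auto simp: z_def)
    ultimately show ?thesis by blast
  qed
qed

lemma wide_matrix_kernel:
  fixes M :: "'a :: division_ring mat"
  assumes M: "M \<in> carrier_mat n m" and "n < m"
  obtains y where "y \<in> carrier_vec m" "y \<noteq> 0\<^sub>v m" "M *\<^sub>v y = 0\<^sub>v n"
proof -
  obtain y where y: "\<exists>j\<in>{0..<m}. y j \<noteq> 0" "\<forall>i\<in>{0..<n}. (\<Sum>j\<in>{0..<m}. M $$ (i, j) * y j) = 0"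
    using homogeneous_system_nontrivial[of "{0..<n}" "{0..<m}" "\<lambda>i j. M $$ (i, j)"] \<open>n < m\<close> by auto
  have "M *\<^sub>v vec m y = 0\<^sub>v n"
    using y(2) M by (intro eq_vecI) (auto simp: scalar_prod_def)
  moreover have "vec m y \<noteq> 0\<^sub>v m" using y(1) by (auto simp: vec_eq_iff)
  ultimately show ?thesis using that[of "vec m y"] by simp
qed

text \<open>A matrix acts from the left and scalars from the right, so this is right linear independence
  of the columns.\<close>

definition inj_mat :: "'a :: semiring_0 mat \<Rightarrow> bool" where
  "inj_mat M \<longleftrightarrow> (\<forall>y \<in> carrier_vec (dim_col M). M *\<^sub>v y = 0\<^sub>v (dim_row M) \<longrightarrow> y = 0\<^sub>v (dim_col M))"

lemma inj_matD:
  assumes "inj_mat M" "M \<in> carrier_mat n m" "y \<in> carrier_vec m" "M *\<^sub>v y = 0\<^sub>v n"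
  shows "y = 0\<^sub>v m"
  using assms by (auto simp: inj_mat_def)

lemma inj_mat_cols_le_rows:
  fixes M :: "'a :: division_ring mat"
  assumes "inj_mat M" "M \<in> carrier_mat n m"
  shows "m \<le> n"
proof (rule ccontr)
  assume "\<not> m \<le> n"
  then obtain y where "y \<in> carrier_vec m" "y \<noteq> 0\<^sub>v m" "M *\<^sub>v y = 0\<^sub>v n"
    using wide_matrix_kernel[OF assms(2)] by auto
  then show False using inj_matD[OF assms] by blast
qed

lemma inj_mat_cancel_zero:
  assumes "inj_mat M" "M \<in> carrier_mat n m" "N \<in> carrier_mat m k" "M * N = 0\<^sub>m n k"
  shows "N = 0\<^sub>m m k"
proof -
  have "col N j = 0\<^sub>v m" if "j < k" for j
  proof (rule inj_matD[OF assms(1,2)])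
    have "M *\<^sub>v col N j = col (M * N) j" using assms(2,3) that by (intro eq_vecI) auto
    then show "M *\<^sub>v col N j = 0\<^sub>v n" using assms(4) that by simp
  qed (use assms that in auto)
  then have "N $$ (i, j) = 0" if "i < m" "j < k" for i j
    using assms that by (metis index_col index_zero_vec(1) carrier_matD)
  then show ?thesis using assms by (intro eq_matI) auto
qed

lemma inj_mat_cancel:
  fixes M :: "'a :: ring mat"
  assumes "inj_mat M" "M \<in> carrier_mat n m" "N \<in> carrier_mat m k" "N' \<in> carrier_mat m k"
    and eq: "M * N = M * N'"
  shows "N = N'"
proof -
  have "M * (N - N') = M * N - M * N'"
    using assms by (intro mult_minus_distrib_mat) auto
  also have "\<dots> = 0\<^sub>m n k" using assms by (auto intro!: eq_matI)
  finally have z: "N - N' = 0\<^sub>m m k"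
    using inj_mat_cancel_zero[OF assms(1,2), of "N - N'" k] minus_carrier_mat[OF assms(4)] by simp
  show ?thesis
  proof (rule eq_matI)
    fix i j assume "i < dim_row N'" "j < dim_col N'"
    then have "(N - N') $$ (i, j) = 0" using z assms by auto
    then show "N $$ (i, j) = N' $$ (i, j)" using assms \<open>i < _\<close> \<open>j < _\<close> by auto
  qed (use assms in auto)
qed

lemma inj_mat_left_inverse:
  fixes M :: "'a :: semiring_1 mat"
  assumes "L * M = 1\<^sub>m m" "L \<in> carrier_mat m n" "M \<in> carrier_mat n m"
  shows "inj_mat M"
  unfolding inj_mat_def
proof (intro ballI impI)
  fix y assume y: "y \<in> carrier_vec (dim_col M)" "M *\<^sub>v y = 0\<^sub>v (dim_row M)"
  have "y = (L * M) *\<^sub>v y" using assms y by simp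
  also have "\<dots> = L *\<^sub>v (M *\<^sub>v y)" using assms y by (intro assoc_mult_mat_vec) auto
  also have "\<dots> = 0\<^sub>v m" using assms y by (auto simp: scalar_prod_def)
  finally show "y = 0\<^sub>v (dim_col M)" using assms by auto
qed

lemma mult_mat_right_inverse_surj:
  fixes M :: "'a :: division_ring mat"
  assumes "M \<in> carrier_mat n m"
    and surj: "\<And>y. y \<in> carrier_vec n \<Longrightarrow> \<exists>c \<in> carrier_vec m. y = M *\<^sub>v c"
  obtains R where "R \<in> carrier_mat m n" "M * R = 1\<^sub>m n"
proof -
  have "\<exists>c \<in> carrier_vec m. unit_vec n j = M *\<^sub>v c" for j using surj by simp
  then obtain c where c: "\<And>j. c j \<in> carrier_vec m" "\<And>j. unit_vec n j = M *\<^sub>v c j" by metis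
  define R where "R = mat m n (\<lambda>(i, j). c j $ i)"
  have colR: "col R j = c j" if "j < n" for j
    using that c(1)[of j] by (auto simp: R_def)
  have "M * R = 1\<^sub>m n"
  proof (rule eq_matI)
    fix i j assume "i < dim_row (1\<^sub>m n :: 'a mat)" "j < dim_col (1\<^sub>m n :: 'a mat)"
    then have ij: "i < n" "j < n" by auto
    then have "(M * R) $$ (i, j) = row M i \<bullet> col R j" using assms(1) by (simp add: R_def)
    also have "\<dots> = (M *\<^sub>v c j) $ i" using assms(1) ij colR by simp
    also have "\<dots> = unit_vec n j $ i" by (simp flip: c(2))
    finally show "(M * R) $$ (i, j) = 1\<^sub>m n $$ (i, j)" using ij by auto
  qed (use assms(1) in \<open>auto simp: R_def\<close>)
  then show ?thesis using that[of R] by (auto simp: R_def)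
qed

section \<open>Bases of the range and rank\<close>

lemma right_lincomb_mat_of_cols:
  assumes "distinct vs" "set vs \<subseteq> carrier_vec n"
  shows "right_lincomb n c (set vs) = mat_of_cols n vs *\<^sub>v vec (length vs) (\<lambda>j. c (vs ! j))"
proof (rule eq_vecI)
  fix i assume "i < dim_vec (mat_of_cols n vs *\<^sub>v vec (length vs) (\<lambda>j. c (vs ! j)))"
  then have i: "i < n" by simp
  have "(\<Sum>v\<in>set vs. v $ i * c v) = (\<Sum>j<length vs. vs ! j $ i * c (vs ! j))"
    using assms(1) by (simp add: sum.distinct_set_conv_list sum_list_sum_nth lessThan_atLeast0)
  then show "right_lincomb n c (set vs) $ i = (mat_of_cols n vs *\<^sub>v vec (length vs) (\<lambda>j. c (vs ! j))) $ i"
    using i by (simp add: right_lincomb_def scalar_prod_def lessThan_atLeast0 mat_of_cols_index)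
qed (simp add: right_lincomb_def)

text \<open>Coefficients of a linear combination are indexed by the vectors themselves, so a coordinate
  vector can be turned into coefficients only if the columns are distinct.\<close>

lemma right_lincomb_mat_of_cols':
  assumes "distinct vs" "set vs \<subseteq> carrier_vec n" "y \<in> carrier_vec (length vs)"
  obtains c where "\<And>j. j < length vs \<Longrightarrow> c (vs ! j) = y $ j"
    "mat_of_cols n vs *\<^sub>v y = right_lincomb n c (set vs)"
proof -
  define c where "c v = y $ (THE j. j < length vs \<and> vs ! j = v)" for v
  have c: "c (vs ! j) = y $ j" if "j < length vs" for j
  proof -
    have "(THE k. k < length vs \<and> vs ! k = vs ! j) = j"
      using assms(1) that by (intro the_equality) (auto simp: nth_eq_iff_index_eq)
    then show ?thesis by (simp add: c_def)
  qed
  have "vec (length vs) (\<lambda>j. c (vs ! j)) = y" using c assms(3) by (intro eq_vecI) auto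
  then show ?thesis using that[of c] c right_lincomb_mat_of_cols[OF assms(1,2), of c] by simp
qed

definition right_independent :: "nat \<Rightarrow> 'a :: division_ring vec set \<Rightarrow> bool" where
  "right_independent n B \<longleftrightarrow> (\<forall>c. right_lincomb n c B = 0\<^sub>v n \<longrightarrow> (\<forall>v\<in>B. c v = 0))"

lemma right_independent_iff_inj_mat:
  assumes vs: "distinct vs" "set vs \<subseteq> carrier_vec n"
  shows "right_independent n (set vs) \<longleftrightarrow> inj_mat (mat_of_cols n vs)" (is "?L \<longleftrightarrow> ?R")
  unfolding right_independent_def
proof
  assume L: "\<forall>c. right_lincomb n c (set vs) = 0\<^sub>v n \<longrightarrow> (\<forall>v\<in>set vs. c v = 0)"
  show ?R unfolding inj_mat_def
  proof (intro ballI impI)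
    fix y assume y: "y \<in> carrier_vec (dim_col (mat_of_cols n vs))"
      "mat_of_cols n vs *\<^sub>v y = 0\<^sub>v (dim_row (mat_of_cols n vs))"
    then obtain c where "\<And>j. j < length vs \<Longrightarrow> c (vs ! j) = y $ j"
      "right_lincomb n c (set vs) = 0\<^sub>v n"
      using right_lincomb_mat_of_cols'[OF vs, of y] by (metis mat_of_cols_carrier(2,3))
    with L have "y $ j = 0" if "j < length vs" for j using that by (metis nth_mem)
    then show "y = 0\<^sub>v (dim_col (mat_of_cols n vs))" using y by (intro eq_vecI) auto
  qed
next
  assume R: ?R
  show "\<forall>c. right_lincomb n c (set vs) = 0\<^sub>v n \<longrightarrow> (\<forall>v\<in>set vs. c v = 0)"
  proof (intro allI impI ballI)
    fix c v assume "right_lincomb n c (set vs) = 0\<^sub>v n" "v \<in> set vs"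
    then obtain j where j: "j < length vs" "v = vs ! j" by (auto simp: in_set_conv_nth)
    have "vec (length vs) (\<lambda>j. c (vs ! j)) = 0\<^sub>v (length vs)"
      using \<open>right_lincomb n c (set vs) = 0\<^sub>v n\<close>
      unfolding right_lincomb_mat_of_cols[OF vs] by (rule inj_matD[OF R mat_of_cols_carrier(1) vec_carrier])
    then have "vec (length vs) (\<lambda>j. c (vs ! j)) $ j = 0" using j by simp
    then show "c v = 0" using j by simp
  qed
qed

lemma right_independent_card_le:
  assumes "finite B" "B \<subseteq> carrier_vec n" "right_independent n B"
  shows "card B \<le> n"
proof -
  obtain vs where vs: "set vs = B" "distinct vs" using finite_distinct_list[OF assms(1)] by blast
  then have "inj_mat (mat_of_cols n vs)"
    using right_independent_iff_inj_mat[of vs n] assms by auto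
  then show ?thesis
    using inj_mat_cols_le_rows[of "mat_of_cols n vs" n "length vs"] vs distinct_card by fastforce
qed

lemma right_lincomb_subset:
  assumes "finite B" "B' \<subseteq> B"
  shows "right_lincomb n c B' = right_lincomb n (\<lambda>v. if v \<in> B' then c v else 0) B"
  unfolding right_lincomb_def
proof (intro eq_vecI; simp)
  fix i
  have "(\<Sum>v\<in>B. v $ i * (if v \<in> B' then c v else 0)) = (\<Sum>v\<in>B'. v $ i * (if v \<in> B' then c v else 0))"
    using assms by (intro sum.mono_neutral_right) auto
  then show "(\<Sum>v\<in>B'. v $ i * c v) = (\<Sum>v\<in>B. v $ i * (if v \<in> B' then c v else 0))" by simp
qed

text \<open>A maximal independent subset of the range spans it; maximal ones exist because independent
  sets have at most as many members as there are coordinates.\<close>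

lemma right_basis_of_range_exists:
  fixes A :: "'a :: division_ring mat"
  assumes A: "A \<in> carrier_mat n m"
  shows "\<exists>B. right_basis n {A *\<^sub>v x | x. x \<in> carrier_vec m} B"
proof -
  let ?V = "{A *\<^sub>v x | x. x \<in> carrier_vec m}"
  define good where "good k \<longleftrightarrow> (\<exists>B. finite B \<and> B \<subseteq> ?V \<and> right_independent n B \<and> card B = k)" for k
  have VC: "?V \<subseteq> carrier_vec n" using A by auto
  have "good 0" unfolding good_def by (intro exI[of _ "{}"]) (auto simp: right_independent_def)
  moreover have bd: "\<forall>k. good k \<longrightarrow> k \<le> n"
    unfolding good_def using right_independent_card_le VC by (metis (no_types, lifting) order_trans)
  ultimately have "good (GREATEST k. good k)" "\<And>j. good j \<Longrightarrow> j \<le> (GREATEST k. good k)"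
    using GreatestI_nat[of good 0 n] Greatest_le_nat[of good _ n] by auto
  then obtain k where k: "good k" "\<And>j. good j \<Longrightarrow> j \<le> k" by blast
  then obtain B where B: "finite B" "B \<subseteq> ?V" "right_independent n B" "card B = k"
    unfolding good_def by blast
  have sub: "right_span n B \<subseteq> ?V"
  proof
    fix v assume "v \<in> right_span n B"
    then obtain c B' where B': "v = right_lincomb n c B'" "finite B'" "B' \<subseteq> B"
      unfolding right_span_def by blast
    have "\<forall>w\<in>B'. \<exists>x. x \<in> carrier_vec m \<and> w = A *\<^sub>v x" using B'(3) B(2) by blast
    then obtain x where x: "\<forall>w\<in>B'. x w \<in> carrier_vec m \<and> w = A *\<^sub>v x w" by metis
    have "v = A *\<^sub>v vec m (\<lambda>i. \<Sum>w\<in>B'. x w $ i * c w)"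
    proof (rule eq_vecI)
      fix i assume "i < dim_vec (A *\<^sub>v vec m (\<lambda>i. \<Sum>w\<in>B'. x w $ i * c w))"
      then have i: "i < n" using A by simp
      have "w $ i = (\<Sum>j<m. A $$ (i, j) * x w $ j)" if "w \<in> B'" for w
      proof -
        have "w $ i = (A *\<^sub>v x w) $ i" using x that by metis
        also have "\<dots> = (\<Sum>j<m. A $$ (i, j) * x w $ j)"
          using conjunct1[OF bspec[OF x that]] i A by (simp add: scalar_prod_def lessThan_atLeast0)
        finally show ?thesis .
      qed
      then have "v $ i = (\<Sum>w\<in>B'. (\<Sum>j<m. A $$ (i, j) * x w $ j) * c w)"
        using i by (simp add: B'(1) right_lincomb_def)
      also have "\<dots> = (\<Sum>j<m. A $$ (i, j) * (\<Sum>w\<in>B'. x w $ j * c w))"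
        unfolding sum_distrib_left sum_distrib_right mult.assoc by (rule sum.swap)
      finally show "v $ i = (A *\<^sub>v vec m (\<lambda>i. \<Sum>w\<in>B'. x w $ i * c w)) $ i"
        using i A by (simp add: scalar_prod_def lessThan_atLeast0)
    qed (use A B'(1) in \<open>simp add: right_lincomb_def\<close>)
    then show "v \<in> ?V" by auto
  qed
  moreover have "v \<in> right_span n B" if v: "v \<in> ?V" and vn: "v \<in> carrier_vec n" for v
  proof (cases "v \<in> B")
    case True
    have "v = right_lincomb n (\<lambda>_. 1) {v}"
      using vn by (intro eq_vecI) (auto simp: right_lincomb_def)
    with True show ?thesis unfolding right_span_def by blast
  next
    case False
    have "\<not> right_independent n (insert v B)"
    proof
      assume "right_independent n (insert v B)"
      then have "good (Suc k)" unfolding good_def using B v False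
        by (intro exI[of _ "insert v B"]) auto
      then show False using k(2) by fastforce
    qed
    then obtain c w where c: "right_lincomb n c (insert v B) = 0\<^sub>v n" "w \<in> insert v B" "c w \<noteq> 0"
      unfolding right_independent_def by blast
    have split: "v $ i * c v + (\<Sum>u\<in>B. u $ i * c u) = 0" if "i < n" for i
    proof -
      have "right_lincomb n c (insert v B) $ i = 0" using c(1) that by simp
      then show ?thesis using that B(1) False by (simp add: right_lincomb_def)
    qed
    have "c v \<noteq> 0"
    proof
      assume "c v = 0"
      then have "right_lincomb n c B = 0\<^sub>v n"
        using split by (intro eq_vecI) (auto simp: right_lincomb_def)
      then show False using B(3) c \<open>c v = 0\<close> unfolding right_independent_def by auto
    qed
    have "v = right_lincomb n (\<lambda>u. - (c u * inverse (c v))) B"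
    proof (rule eq_vecI)
      fix i assume "i < dim_vec (right_lincomb n (\<lambda>u. - (c u * inverse (c v))) B)"
      then have i: "i < n" by (simp add: right_lincomb_def)
      have "v $ i = (v $ i * c v) * inverse (c v)"
        using \<open>c v \<noteq> 0\<close> by (simp add: mult.assoc)
      also have "v $ i * c v = - (\<Sum>u\<in>B. u $ i * c u)"
        using split[OF i] by (simp add: eq_neg_iff_add_eq_0)
      finally show "v $ i = right_lincomb n (\<lambda>u. - (c u * inverse (c v))) B $ i"
        using i by (simp add: right_lincomb_def sum_distrib_right mult.assoc sum_negf)
    qed (use vn in \<open>auto simp: right_lincomb_def\<close>)
    then show ?thesis unfolding right_span_def using B(1) by blast
  qed
  ultimately have "right_span n B = ?V" using VC by blast
  then show ?thesis
    using B VC by (intro exI[of _ B]) (auto simp: right_basis_def right_independent_def)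
qed

text \<open>The columns of \<open>B\<close> are a basis of the range of \<open>A\<close>.  They lie in the range, which gives \<open>R\<close>, and
  cancelling \<open>B\<close> in \<open>B * (C * R) = A * R = B\<close> shows that \<open>R\<close> is a right inverse of \<open>C\<close>.\<close>

lemma rank_factorization:
  fixes A :: "'a :: division_ring mat"
  assumes A: "A \<in> carrier_mat n m"
  obtains B C R where "B \<in> carrier_mat n (mat_rank A)" "C \<in> carrier_mat (mat_rank A) m"
    "R \<in> carrier_mat m (mat_rank A)" "A = B * C" "B = A * R" "inj_mat B" "C * R = 1\<^sub>m (mat_rank A)"
proof -
  let ?V = "{A *\<^sub>v x | x. x \<in> carrier_vec m}"
  define S where "S = (SOME B. right_basis n ?V B)"
  define r where "r = mat_rank A"
  have S: "right_basis n ?V S"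
    unfolding S_def using right_basis_of_range_exists[OF A] by (rule someI_ex)
  have r: "r = card S" using A by (simp add: r_def mat_rank_def right_dim_def S_def)
  have fin: "finite S" and SC: "S \<subseteq> carrier_vec n" and span: "right_span n S = ?V"
    using S by (auto simp: right_basis_def)
  obtain vs where vs: "set vs = S" "distinct vs" using finite_distinct_list[OF fin] by blast
  have len: "length vs = r" using vs r distinct_card by fastforce
  define B where "B = mat_of_cols n vs"
  have B: "B \<in> carrier_mat n r" using mat_of_cols_carrier(1)[of n vs] by (simp add: B_def len)
  have "inj_mat B"
    using right_independent_iff_inj_mat[of vs n] S vs SC
    by (auto simp: right_basis_def right_independent_def B_def)
  have "\<exists>y \<in> carrier_vec r. col A j = B *\<^sub>v y" if "j < m" for j
  proof -
    have "col A j = A *\<^sub>v unit_vec m j"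
      using A that by (intro eq_vecI) (auto simp: scalar_prod_right_unit)
    then have "col A j \<in> right_span n S" unfolding span using that by auto
    then obtain c B' where B': "col A j = right_lincomb n c B'" "B' \<subseteq> S"
      unfolding right_span_def by blast
    then have "col A j = right_lincomb n (\<lambda>v. if v \<in> B' then c v else 0) (set vs)"
      using right_lincomb_subset[OF fin] vs by metis
    then show ?thesis
      using right_lincomb_mat_of_cols[of vs n] vs SC len by (auto simp: B_def)
  qed
  then obtain y where y: "\<And>j. j < m \<Longrightarrow> y j \<in> carrier_vec r" "\<And>j. j < m \<Longrightarrow> col A j = B *\<^sub>v y j"
    by metis
  define C where "C = mat r m (\<lambda>(i, j). y j $ i)"
  have C: "C \<in> carrier_mat r m" by (simp add: C_def)
  have "A = B * C"
  proof (rule eq_matI)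
    fix i j assume "i < dim_row (B * C)" "j < dim_col (B * C)"
    then have ij: "i < n" "j < m" using B C by auto
    then have "col C j = y j" using y(1)[of j] by (intro eq_vecI) (auto simp: C_def)
    then have "(B * C) $$ (i, j) = (B *\<^sub>v y j) $ i" using ij B C by simp
    also have "\<dots> = col A j $ i" using y(2) ij by simp
    finally show "A $$ (i, j) = (B * C) $$ (i, j)" using ij A by simp
  qed (use A B C in auto)
  have "\<exists>x \<in> carrier_vec m. vs ! j = A *\<^sub>v x" if "j < r" for j
  proof -
    have v: "vs ! j \<in> S" using vs len that by auto
    have "vs ! j = right_lincomb n (\<lambda>_. 1) {vs ! j}"
      using v SC by (intro eq_vecI) (auto simp: right_lincomb_def)
    with v have "vs ! j \<in> right_span n S" unfolding right_span_def by blast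
    then show ?thesis unfolding span by blast
  qed
  then obtain x where x: "\<And>j. j < r \<Longrightarrow> x j \<in> carrier_vec m" "\<And>j. j < r \<Longrightarrow> vs ! j = A *\<^sub>v x j"
    by metis
  define R where "R = mat m r (\<lambda>(i, j). x j $ i)"
  have R: "R \<in> carrier_mat m r" by (simp add: R_def)
  have "B = A * R"
  proof (rule eq_matI)
    fix i j assume "i < dim_row (A * R)" "j < dim_col (A * R)"
    then have ij: "i < n" "j < r" using A R by auto
    then have "col R j = x j" using x(1)[of j] by (intro eq_vecI) (auto simp: R_def)
    then have "(A * R) $$ (i, j) = (A *\<^sub>v x j) $ i" using ij A R by simp
    also have "\<dots> = vs ! j $ i" using x(2) ij by simp
    finally show "B $$ (i, j) = (A * R) $$ (i, j)" using ij len by (simp add: B_def mat_of_cols_index)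
  qed (use A B R in auto)
  have "B * (C * R) = B * 1\<^sub>m r"
    using \<open>B = A * R\<close> \<open>A = B * C\<close> B C R by (metis assoc_mult_mat right_mult_one_mat)
  then have "C * R = 1\<^sub>m r"
    using inj_mat_cancel[OF \<open>inj_mat B\<close> B, of "C * R" r] C R by auto
  with that B C R \<open>A = B * C\<close> \<open>B = A * R\<close> \<open>inj_mat B\<close> show ?thesis unfolding r_def by blast
qed

text \<open>If \<open>B = G * M * R\<close> has its columns independent, then so has \<open>M * R\<close>, which has only \<open>s\<close> rows.\<close>

lemma mat_rank_product_le:
  fixes G :: "'a :: division_ring mat"
  assumes G: "G \<in> carrier_mat n s" and M: "M \<in> carrier_mat s m"
  shows "mat_rank (G * M) \<le> s"
proof -
  define r where "r = mat_rank (G * M)"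
  obtain B R where B: "B \<in> carrier_mat n r" "R \<in> carrier_mat m r" "B = G * M * R" "inj_mat B"
    using rank_factorization[of "G * M" n m] G M unfolding r_def by (metis mult_carrier_mat)
  have "inj_mat (M * R)" unfolding inj_mat_def
  proof (intro ballI impI)
    fix y assume y: "y \<in> carrier_vec (dim_col (M * R))" "M * R *\<^sub>v y = 0\<^sub>v (dim_row (M * R))"
    have yr: "y \<in> carrier_vec r" using y(1) B by simp
    have "B *\<^sub>v y = G *\<^sub>v (M * R *\<^sub>v y)"
      using G M B(2) yr by (simp only: B(3) assoc_mult_mat[OF G M B(2)] assoc_mult_mat_vec[of _ n s _ r] mult_carrier_mat)
    also have "\<dots> = 0\<^sub>v n" unfolding y(2) using G M by (auto simp: scalar_prod_def)
    finally show "y = 0\<^sub>v (dim_col (M * R))" using inj_matD[OF B(4,1)] yr B by simp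
  qed
  then show ?thesis using inj_mat_cols_le_rows[of "M * R" s r] M B by (auto simp: r_def)
qed

text \<open>A nonzero vector \<open>w\<close> killed by \<open>G\<close> can be adjoined to \<open>M * R\<close> as one more column without losing
  independence, since \<open>G * M * R\<close> is injective.  This leaves room for fewer than \<open>s\<close> columns in \<open>M * R\<close>.\<close>

lemma mat_rank_product_less:
  fixes G :: "'a :: division_ring mat"
  assumes G: "G \<in> carrier_mat n s" and M: "M \<in> carrier_mat s m" and "\<not> inj_mat G"
  shows "mat_rank (G * M) < s"
proof -
  obtain w where w: "w \<in> carrier_vec s" "G *\<^sub>v w = 0\<^sub>v n" "w \<noteq> 0\<^sub>v s"
    using \<open>\<not> inj_mat G\<close> G unfolding inj_mat_def by auto
  define r where "r = mat_rank (G * M)"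
  obtain B R where B: "B \<in> carrier_mat n r" "R \<in> carrier_mat m r" "B = G * M * R" "inj_mat B"
    using rank_factorization[of "G * M" n m] G M unfolding r_def by (metis mult_carrier_mat)
  define N where "N = M * R"
  have N: "N \<in> carrier_mat s r" using M B by (auto simp: N_def)
  have BN: "B = G * N" using B G M by (simp add: N_def)
  define N' where "N' = mat s (Suc r) (\<lambda>(i, j). if j < r then N $$ (i, j) else w $ i)"
  have N'y: "N' *\<^sub>v y = N *\<^sub>v vec r (\<lambda>j. y $ j) + vec s (\<lambda>i. w $ i * y $ r)"
    if "y \<in> carrier_vec (Suc r)" for y
    using that N by (intro eq_vecI) (auto simp: N'_def scalar_prod_def)
  have "inj_mat N'" unfolding inj_mat_def
  proof (intro ballI impI)
    fix y assume "y \<in> carrier_vec (dim_col N')" and y0: "N' *\<^sub>v y = 0\<^sub>v (dim_row N')"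
    then have y: "y \<in> carrier_vec (Suc r)" by (simp add: N'_def)
    define z where "z = vec r (\<lambda>j. y $ j)"
    have z: "z \<in> carrier_vec r" by (simp add: z_def)
    have Gw: "G *\<^sub>v vec s (\<lambda>i. w $ i * y $ r) = 0\<^sub>v n"
    proof (rule eq_vecI)
      fix i assume i: "i < dim_vec (0\<^sub>v n :: 'a vec)"
      have "(\<Sum>j = 0..<s. G $$ (i, j) * (w $ j * y $ r)) = (G *\<^sub>v w) $ i * y $ r"
        using G w(1) i by (simp add: scalar_prod_def sum_distrib_right mult.assoc)
      then show "(G *\<^sub>v vec s (\<lambda>i. w $ i * y $ r)) $ i = 0\<^sub>v n $ i"
        using w(2) G i by (simp add: scalar_prod_def)
    qed (use G in auto)
    have "0\<^sub>v n = G *\<^sub>v (N *\<^sub>v z + vec s (\<lambda>i. w $ i * y $ r))"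
      using N'y[OF y] y0 G by (auto simp: z_def N'_def scalar_prod_def)
    also have "\<dots> = B *\<^sub>v z + 0\<^sub>v n"
      using G N z by (simp add: mult_add_distrib_mat_vec[OF G] Gw BN)
    finally have "B *\<^sub>v z = 0\<^sub>v n" using B z by auto
    then have z0: "z = 0\<^sub>v r" using inj_matD[OF B(4,1)] z by simp
    have "N *\<^sub>v z = 0\<^sub>v s" unfolding z0 using N by (auto simp: scalar_prod_def)
    then have "vec s (\<lambda>i. w $ i * y $ r) = 0\<^sub>v s"
      using N'y[OF y] y0 by (simp add: z_def N'_def)
    moreover obtain i where "i < s" "w $ i \<noteq> 0" using w(1,3) by (metis carrier_vecD eq_vecI index_zero_vec)
    ultimately have "w $ i * y $ r = 0" by (auto simp: vec_eq_iff)
    with \<open>w $ i \<noteq> 0\<close> have "y $ r = 0" by simp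
    then have "y $ j = 0" if "j < Suc r" for j
      using z0 that by (cases "j = r") (auto simp: z_def vec_eq_iff)
    then show "y = 0\<^sub>v (dim_col N')" using y by (auto simp: N'_def)
  qed
  then show ?thesis
    using inj_mat_cols_le_rows[of N' s "Suc r"] by (auto simp: N'_def r_def)
qed

lemma mat_rank_eq_0_iff:
  fixes A :: "'a :: division_ring mat"
  assumes A: "A \<in> carrier_mat n m"
  shows "mat_rank A = 0 \<longleftrightarrow> A = 0\<^sub>m n m"
proof
  assume "mat_rank A = 0"
  then obtain B C where "B \<in> carrier_mat n 0" "C \<in> carrier_mat 0 m" "A = B * C"
    using rank_factorization[OF A] by metis
  then show "A = 0\<^sub>m n m" by (intro eq_matI) (auto simp: scalar_prod_def)
next
  assume "A = 0\<^sub>m n m"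
  then have "A = (0\<^sub>m n 0 :: 'a mat) * 0\<^sub>m 0 m" by (intro eq_matI) (auto simp: scalar_prod_def)
  then show "mat_rank A = 0"
    using mat_rank_product_le[of "0\<^sub>m n 0 :: 'a mat" n 0 "0\<^sub>m 0 m" m] by simp
qed

section \<open>Quadratic real algebras without zero divisors\<close>

text \<open>Frobenius's theorem, in a form that does not speak of dimension.  Completing the square turns any
  nonscalar element into a square root of \<open>- 1\<close>; let \<open>u\<close> be one of these.  The
  elements commuting with \<open>u\<close> are \<open>a + b u\<close> only, because another root \<open>w\<close> of \<open>- 1\<close> that commutes
  with \<open>u\<close> satisfies \<open>(w - u) (w + u) = 0\<close>.  Every element is the sum of one that commutes with \<open>u\<close>
  and one that anticommutes with it.  If a nonzero anticommuting element exists, it can be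
  scaled to a root \<open>v\<close> of \<open>- 1\<close>, and multiplication by \<open>v\<close> carries anticommuting elements to commuting
  ones, which makes \<open>1\<close>, \<open>u\<close>, \<open>v\<close>, \<open>u v\<close> a spanning set.\<close>

lemma quadratic_domain_cases:
  fixes K :: "'r :: real_algebra_1 set"
  assumes add: "\<And>a b. a \<in> K \<Longrightarrow> b \<in> K \<Longrightarrow> a + b \<in> K"
    and mult: "\<And>a b. a \<in> K \<Longrightarrow> b \<in> K \<Longrightarrow> a * b \<in> K"
    and scale: "\<And>t a. a \<in> K \<Longrightarrow> t *\<^sub>R a \<in> K"
    and one: "1 \<in> K"
    and domain: "\<And>a b. a \<in> K \<Longrightarrow> b \<in> K \<Longrightarrow> a * b = 0 \<Longrightarrow> a = 0 \<or> b = 0"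
    and quadratic: "\<And>a. a \<in> K \<Longrightarrow> \<exists>p q. a * a = p *\<^sub>R a + q *\<^sub>R 1"
  obtains
    (real) "K = range (\<lambda>a. a *\<^sub>R 1)"
  | (complex) u where "u \<in> K" "u * u = - 1" "K = {a *\<^sub>R 1 + b *\<^sub>R u | a b. True}"
  | (quat) u v where "u \<in> K" "v \<in> K" "u * u = - 1" "v * v = - 1" "v * u = - (u * v)"
      "K = {a *\<^sub>R 1 + b *\<^sub>R u + c *\<^sub>R v + d *\<^sub>R (u * v) | a b c d. True}"
proof -
  have uminus: "- a \<in> K" if "a \<in> K" for a using scale[OF that, of "-1"] by simp
  have diff: "a - b \<in> K" if "a \<in> K" "b \<in> K" for a b
    using add[OF that(1) uminus[OF that(2)]] by simp
  let ?R = "range (\<lambda>a. a *\<^sub>R (1 :: 'r))"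
  have scalar: "t *\<^sub>R 1 \<in> K" for t using scale[OF one] .
  have neg_square: "s < 0" if c: "c \<in> K" "c * c = s *\<^sub>R 1" "c \<notin> ?R" for c s
  proof (rule ccontr)
    assume "\<not> s < 0"
    then have "(c - sqrt s *\<^sub>R 1) * (c + sqrt s *\<^sub>R 1) = 0"
      using c by (simp add: algebra_simps)
    then have "c - sqrt s *\<^sub>R 1 = 0 \<or> c + sqrt s *\<^sub>R 1 = 0"
      using c add diff scalar by (intro domain) auto
    then have "c = sqrt s *\<^sub>R 1 \<or> c = (- sqrt s) *\<^sub>R 1" by (auto simp: eq_neg_iff_add_eq_0)
    then show False using c(3) by blast
  qed
  have normalise: "\<exists>u\<in>K. u * u = - 1 \<and> c = t *\<^sub>R u" if c: "c \<in> K" "c * c = s *\<^sub>R 1" "s < 0" "t = sqrt (- s)"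
    for c s t
  proof (intro bexI conjI)
    have t: "t > 0" "t * t = - s" using c by auto
    show "((1 / t) *\<^sub>R c) * ((1 / t) *\<^sub>R c) = - 1" using t c(2,3) by (simp add: field_simps)
    show "c = t *\<^sub>R ((1 / t) *\<^sub>R c)" using t by simp
    show "(1 / t) *\<^sub>R c \<in> K" using c scale by blast
  qed
  have imaginary_unit: "\<exists>u\<in>K. u * u = - 1 \<and> (\<exists>a b. c = a *\<^sub>R 1 + b *\<^sub>R u \<and> b \<noteq> 0)"
    if c: "c \<in> K" "c \<notin> ?R" for c
  proof -
    obtain p q where pq: "c * c = p *\<^sub>R c + q *\<^sub>R 1" using quadratic[OF c(1)] by blast
    let ?c = "c - (p / 2) *\<^sub>R 1" and ?s = "q + p * p / 4"
    have sq: "?c * ?c = ?s *\<^sub>R 1"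
    proof -
      have "?c * ?c = c * c - p *\<^sub>R c + (p * p / 4) *\<^sub>R 1"
        by (simp add: algebra_simps flip: scaleR_add_left)
      then show ?thesis unfolding pq by (simp add: algebra_simps)
    qed
    have K: "?c \<in> K" using c diff scalar by blast
    have "?c \<notin> ?R"
    proof
      assume "?c \<in> ?R"
      then obtain a where "?c = a *\<^sub>R 1" by blast
      then have "c = (a + p / 2) *\<^sub>R 1" by (simp add: algebra_simps)
      then show False using c(2) by blast
    qed
    then have s: "?s < 0" using neg_square K sq by blast
    then obtain u where "u \<in> K" "u * u = - 1" "?c = sqrt (- ?s) *\<^sub>R u"
      using normalise[OF K sq s refl] by blast
    moreover from this have "c = (p / 2) *\<^sub>R 1 + sqrt (- ?s) *\<^sub>R u" by (simp add: algebra_simps)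
    moreover have "sqrt (- ?s) \<noteq> 0" using s by simp
    ultimately show ?thesis by blast
  qed
  have centralizer: "\<exists>a b. c = a *\<^sub>R 1 + b *\<^sub>R u"
    if c: "c \<in> K" and u: "u \<in> K" "u * u = - 1" and comm: "c * u = u * c" for c u
  proof (cases "c \<in> ?R")
    case True
    then obtain a where "c = a *\<^sub>R 1 + 0 *\<^sub>R u" by auto
    then show ?thesis by blast
  next
    case False
    then obtain w a b where w: "w \<in> K" "w * w = - 1" "c = a *\<^sub>R 1 + b *\<^sub>R w" "b \<noteq> 0"
      using imaginary_unit[OF c] by blast
    have "b *\<^sub>R (w * u) = b *\<^sub>R (u * w)" using comm unfolding w(3) by (simp add: algebra_simps)
    then have "w * u = u * w" using w(4) by simp
    then have "(w - u) * (w + u) = 0" using w(2) u(2) by (simp add: algebra_simps)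
    then have "w - u = 0 \<or> w + u = 0" using w u add diff by (intro domain) auto
    then have "w = u \<or> w = - u" by (auto simp: eq_neg_iff_add_eq_0)
    then have "c = a *\<^sub>R 1 + b *\<^sub>R u \<or> c = a *\<^sub>R 1 + (- b) *\<^sub>R u" using w(3) by auto
    then show ?thesis by blast
  qed
  show thesis
  proof (cases "K \<subseteq> ?R")
    case True
    then show ?thesis using scalar by (intro real) auto
  next
    case False
    then obtain u where u: "u \<in> K" "u * u = - 1" using imaginary_unit by blast
    have uu: "u * (u * x) = - x" for x using u(2) by (simp flip: mult.assoc)
    define plus where "plus z = (1/2) *\<^sub>R (z - u * z * u)" for z
    define minus where "minus z = (1/2) *\<^sub>R (z + u * z * u)" for z
    have parts: "z = plus z + minus z" for z
      by (simp add: plus_def minus_def algebra_simps flip: scaleR_add_left)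
    have parts_K: "plus z \<in> K" "minus z \<in> K" if "z \<in> K" for z
      using that u by (auto simp: plus_def minus_def intro!: scale add diff mult)
    have plus_comm: "plus z * u = u * plus z" for z
      by (simp add: plus_def algebra_simps uu u(2))
    have minus_anti: "minus z * u = - (u * minus z)" for z
      by (simp add: minus_def algebra_simps uu u(2))
    show ?thesis
    proof (cases "\<forall>z\<in>K. minus z = 0")
      case True
      have "K = {a *\<^sub>R 1 + b *\<^sub>R u | a b. True}"
      proof (intro equalityI subsetI)
        fix z assume z: "z \<in> K"
        then have "z = plus z" using parts[of z] True by simp
        then have "z * u = u * z" using plus_comm[of z] by metis
        then show "z \<in> {a *\<^sub>R 1 + b *\<^sub>R u | a b. True}" using centralizer[OF z u] by blast
      qed (use u add scale one in blast)
      then show ?thesis using u by (intro complex)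
    next
      case False
      then obtain w where w: "w \<in> K" "w \<noteq> 0" "w * u = - (u * w)"
        using parts_K(2) minus_anti by blast
      obtain p q where pq: "w * w = p *\<^sub>R w + q *\<^sub>R 1" using quadratic[OF w(1)] by blast
      \<comment> \<open>Conjugation by \<open>u\<close> fixes \<open>w * w\<close> and negates \<open>w\<close>, so the linear term vanishes.\<close>
      have "u * (w * w) = w * w * u"
      proof -
        have "w * w * u = w * (w * u)" by (simp add: mult.assoc)
        also have "\<dots> = - (w * u * w)" by (subst w(3)) (simp add: mult.assoc)
        also have "\<dots> = u * (w * w)" by (subst w(3)) (simp add: mult.assoc)
        finally show ?thesis by simp
      qed
      then have "p *\<^sub>R (u * w) + q *\<^sub>R u = p *\<^sub>R (w * u) + q *\<^sub>R u"
        unfolding pq by (simp add: distrib_left distrib_right)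
      then have "p *\<^sub>R (u * w) = - (p *\<^sub>R (u * w))" by (simp add: w(3))
      then have "(2 * p) *\<^sub>R (u * w) = 0"
        by (metis add.right_inverse mult_2 scaleR_add_left)
      then have "p = 0 \<or> u * w = 0" by simp
      moreover have "u * w \<noteq> 0" using domain[OF u(1) w(1)] w(2) u(2) by auto
      ultimately have "p = 0" by simp
      then have sq: "w * w = q *\<^sub>R 1" using pq by simp
      have "w \<notin> ?R"
      proof
        assume "w \<in> ?R"
        then obtain a where "w = a *\<^sub>R 1" by blast
        then have "w * u = u * w" by simp
        then have "2 *\<^sub>R (u * w) = 0" using w(3) by (metis add.right_inverse scaleR_2)
        with \<open>u * w \<noteq> 0\<close> show False by simp
      qed
      then have "q < 0" using neg_square[OF w(1) sq] by blast
      then obtain v where v: "v \<in> K" "v * v = - 1" "w = sqrt (- q) *\<^sub>R v"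
        using normalise[OF w(1) sq] by blast
      have "sqrt (- q) *\<^sub>R (v * u) = sqrt (- q) *\<^sub>R (- (u * v))"
        using w(3) unfolding v(3) by simp
      then have anti: "v * u = - (u * v)" using \<open>q < 0\<close> by (simp flip: scaleR_minus_right)
      have "K = {a *\<^sub>R 1 + b *\<^sub>R u + c *\<^sub>R v + d *\<^sub>R (u * v) | a b c d. True}"
      proof (intro equalityI subsetI)
        fix z assume z: "z \<in> K"
        obtain a b where ab: "plus z = a *\<^sub>R 1 + b *\<^sub>R u"
          using centralizer[OF parts_K(1)[OF z] u plus_comm] by blast
        have "minus z * v * u = u * (minus z * v)"
          by (simp add: mult.assoc anti) (simp add: minus_anti flip: mult.assoc)
        then obtain c d where cd: "minus z * v = c *\<^sub>R 1 + d *\<^sub>R u"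
          using centralizer[OF mult[OF parts_K(2)[OF z] v(1)] u] by blast
        have "minus z = - (minus z * v * v)" by (simp add: mult.assoc v(2))
        also have "\<dots> = (- c) *\<^sub>R v + (- d) *\<^sub>R (u * v)" unfolding cd by (simp add: algebra_simps)
        finally have "plus z + minus z = a *\<^sub>R 1 + b *\<^sub>R u + (- c) *\<^sub>R v + (- d) *\<^sub>R (u * v)"
          by (simp only: ab add.assoc)
        then have "z = a *\<^sub>R 1 + b *\<^sub>R u + (- c) *\<^sub>R v + (- d) *\<^sub>R (u * v)"
          unfolding parts[of z, symmetric] .
        then show "z \<in> {a *\<^sub>R 1 + b *\<^sub>R u + c *\<^sub>R v + d *\<^sub>R (u * v) | a b c d. True}" by blast
      next
        fix z assume "z \<in> {a *\<^sub>R 1 + b *\<^sub>R u + c *\<^sub>R v + d *\<^sub>R (u * v) | a b c d. True}"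
        then show "z \<in> K" using u v by (auto intro!: add scale mult one)
      qed
      with u v anti show ?thesis by (intro quat[of u v])
    qed
  qed
qed

lemma quadratic_domain_inverse:
  fixes K :: "'r :: real_algebra_1 set"
  assumes add: "\<And>a b. a \<in> K \<Longrightarrow> b \<in> K \<Longrightarrow> a + b \<in> K"
    and scale: "\<And>t a. a \<in> K \<Longrightarrow> t *\<^sub>R a \<in> K"
    and one: "1 \<in> K"
    and domain: "\<And>a b. a \<in> K \<Longrightarrow> b \<in> K \<Longrightarrow> a * b = 0 \<Longrightarrow> a = 0 \<or> b = 0"
    and quadratic: "\<And>a. a \<in> K \<Longrightarrow> \<exists>p q. a * a = p *\<^sub>R a + q *\<^sub>R 1"
    and a: "a \<in> K" "a \<noteq> 0"
  shows "\<exists>b\<in>K. b * a = 1"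
proof -
  obtain p q where pq: "a * a = p *\<^sub>R a + q *\<^sub>R 1" using quadratic[OF a(1)] by blast
  show ?thesis
  proof (cases "q = 0")
    case True
    have "(a + (- p) *\<^sub>R 1) * a = 0" using pq True by (simp add: algebra_simps)
    then have "a + (- p) *\<^sub>R 1 = 0" using domain[OF add[OF a(1) scale[OF one]] a(1)] a(2) by blast
    then have ap: "a = p *\<^sub>R 1" by simp
    then have "((1 / p) *\<^sub>R 1) * a = 1" using a(2) by auto
    then show ?thesis using scale[OF one] by blast
  next
    case False
    have "((1 / q) *\<^sub>R (a + (- p) *\<^sub>R 1)) * a = (1 / q) *\<^sub>R (a * a - p *\<^sub>R a)"
      by (simp add: algebra_simps)
    also have "\<dots> = 1" unfolding pq using False by simp
    finally show ?thesis using scale[OF add[OF a(1) scale[OF one]]] by blast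
  qed
qed

section \<open>A ring containing all square matrices of a given size\<close>

text \<open>Square matrices of a size that is only a variable do not form a type, whereas the argument above
  is about a ring type.  Real-linear operators on sequences do form one, and it
  contains the matrices of every positive size.\<close>

typedef (overloaded) 'a seq_op =
  "{f :: (nat \<Rightarrow> 'a :: real_vector) \<Rightarrow> nat \<Rightarrow> 'a.
     (\<forall>x y. f (\<lambda>i. x i + y i) = (\<lambda>i. f x i + f y i)) \<and> (\<forall>t x. f (\<lambda>i. t *\<^sub>R x i) = (\<lambda>i. t *\<^sub>R f x i))}"
  by (rule exI[of _ "\<lambda>x. x"]) auto

setup_lifting type_definition_seq_op

instantiation seq_op :: (real_div_algebra) real_algebra_1
begin

lift_definition zero_seq_op :: "'a seq_op" is "\<lambda>x i. 0" by auto
lift_definition one_seq_op :: "'a seq_op" is "\<lambda>x. x" by auto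
lift_definition plus_seq_op :: "'a seq_op \<Rightarrow> 'a seq_op \<Rightarrow> 'a seq_op" is "\<lambda>f g x i. f x i + g x i"
  by (auto simp: algebra_simps fun_eq_iff)
lift_definition minus_seq_op :: "'a seq_op \<Rightarrow> 'a seq_op \<Rightarrow> 'a seq_op" is "\<lambda>f g x i. f x i - g x i"
  by (auto simp: algebra_simps fun_eq_iff)
lift_definition uminus_seq_op :: "'a seq_op \<Rightarrow> 'a seq_op" is "\<lambda>f x i. - f x i"
  by (auto simp: algebra_simps fun_eq_iff)
lift_definition times_seq_op :: "'a seq_op \<Rightarrow> 'a seq_op \<Rightarrow> 'a seq_op" is "\<lambda>f g x. f (g x)"
  by auto
lift_definition scaleR_seq_op :: "real \<Rightarrow> 'a seq_op \<Rightarrow> 'a seq_op" is "\<lambda>t f x i. t *\<^sub>R f x i"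
  by (auto simp: algebra_simps fun_eq_iff)

instance
proof
  fix a b c :: "'a seq_op" and s t :: real
  show "a * (b + c) = a * b + a * c" by transfer (auto simp: fun_eq_iff)
  show "(0 :: 'a seq_op) \<noteq> 1"
  proof
    assume "(0 :: 'a seq_op) = 1"
    then have "(\<lambda>i :: nat. 0 :: 'a) = (\<lambda>i. 1)" by transfer metis
    then show False by (auto simp: fun_eq_iff)
  qed
  show "a * t *\<^sub>R b = t *\<^sub>R (a * b)" by transfer auto
qed (transfer; auto simp: algebra_simps fun_eq_iff)+

end

text \<open>A matrix acts on each block of \<open>r\<close> consecutive entries.  Repeating the block along the whole sequence,
  rather than acting on the first one only, sends the identity matrix to \<open>1\<close>.\<close>

lift_definition mat_op :: "nat \<Rightarrow> 'a :: real_div_algebra mat \<Rightarrow> 'a seq_op" is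
  "\<lambda>r M x i. \<Sum>j<r. M $$ (i mod r, j) * x (i div r * r + j)"
  by (auto simp: fun_eq_iff algebra_simps sum.distrib scaleR_sum_right)

lemma mat_op_add:
  assumes "r > 0" "A \<in> carrier_mat r r" "B \<in> carrier_mat r r"
  shows "mat_op r (A + B) = mat_op r A + mat_op r B"
  using assms by transfer (auto simp: fun_eq_iff algebra_simps sum.distrib)

lemma mat_op_scaleR:
  assumes "r > 0" "A \<in> carrier_mat r r"
  shows "mat_op r (map_mat ((*\<^sub>R) t) A) = t *\<^sub>R mat_op r A"
  using assms by transfer (auto simp: fun_eq_iff scaleR_sum_right)

lemma mat_op_uminus:
  assumes "r > 0" "A \<in> carrier_mat r r"
  shows "mat_op r (- A) = - mat_op r A"
  using assms by transfer (auto simp: fun_eq_iff sum_negf)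

lemma mat_op_one: "r > 0 \<Longrightarrow> mat_op r (1\<^sub>m r) = 1"
  by transfer (auto simp: fun_eq_iff if_distrib if_distribR sum.delta cong: if_cong)

lemma mat_op_zero: "r > 0 \<Longrightarrow> mat_op r (0\<^sub>m r r) = 0"
  by transfer (auto simp: fun_eq_iff)

lemma mat_op_mult:
  assumes "r > 0" "A \<in> carrier_mat r r" "B \<in> carrier_mat r r"
  shows "mat_op r (A * B) = mat_op r A * mat_op r B"
  using assms
proof transfer
  fix r :: nat and A B :: "'a mat"
  assume r: "r > 0" "A \<in> carrier_mat r r" "B \<in> carrier_mat r r"
  have "(\<Sum>j<r. (A * B) $$ (i mod r, j) * x (i div r * r + j)) =
    (\<Sum>l<r. A $$ (i mod r, l) *
       (\<Sum>j<r. B $$ ((i div r * r + l) mod r, j) * x ((i div r * r + l) div r * r + j)))" for x i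
  proof -
    have "(\<Sum>j<r. (A * B) $$ (i mod r, j) * x (i div r * r + j)) =
      (\<Sum>j<r. (\<Sum>l<r. A $$ (i mod r, l) * B $$ (l, j)) * x (i div r * r + j))"
      using r by (intro sum.cong) (auto simp: scalar_prod_def lessThan_atLeast0)
    also have "\<dots> = (\<Sum>l<r. A $$ (i mod r, l) * (\<Sum>j<r. B $$ (l, j) * x (i div r * r + j)))"
      unfolding sum_distrib_left sum_distrib_right mult.assoc by (rule sum.swap)
    finally show ?thesis using r by simp
  qed
  then show "(\<lambda>x i. \<Sum>j<r. (A * B) $$ (i mod r, j) * x (i div r * r + j)) =
    (\<lambda>x. (\<lambda>x i. \<Sum>j<r. A $$ (i mod r, j) * x (i div r * r + j))
      ((\<lambda>x i. \<Sum>j<r. B $$ (i mod r, j) * x (i div r * r + j)) x))"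
    by (auto simp: fun_eq_iff)
qed

lemma mat_op_inject:
  assumes "r > 0" "A \<in> carrier_mat r r" "B \<in> carrier_mat r r" "mat_op r A = mat_op r B"
  shows "A = B"
proof -
  note r = assms(1-3)
  have eq: "(\<lambda>x i. \<Sum>j<r. A $$ (i mod r, j) * x (i div r * r + j)) =
      (\<lambda>x i. \<Sum>j<r. B $$ (i mod r, j) * x (i div r * r + j))"
    using arg_cong[OF assms(4), of Rep_seq_op] unfolding mat_op.rep_eq .
  have val: "(\<Sum>l<r. M $$ (i mod r, l) * (if i div r * r + l = j then 1 else 0)) = M $$ (i, j)"
    if "i < r" "j < r" for i j and M :: "'a mat"
    using that by (simp add: if_distrib sum.delta' cong: if_cong)
  show "A = B"
  proof (rule eq_matI)
    fix i j assume "i < dim_row B" "j < dim_col B"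
    then have ij: "i < r" "j < r" using r by auto
    show "A $$ (i, j) = B $$ (i, j)"
      using fun_cong[OF fun_cong[OF eq, of "\<lambda>l. if l = j then 1 else 0"], of i]
      unfolding val[OF ij] .
  qed (use r in auto)
qed

section \<open>Vectors annihilated by a real quadratic polynomial\<close>

lemma sum_blocks:
  fixes f :: "nat \<Rightarrow> 'a :: comm_monoid_add"
  shows "(\<Sum>c<r * d. f c) = (\<Sum>j<r. \<Sum>t<d. f (j * d + t))"
proof -
  have "(\<Sum>c = j * d..<j * d + d. f c) = (\<Sum>t<d. f (j * d + t))" for j
    using sum.shift_bounds_nat_ivl[of f 0 "j * d" d] by (simp add: lessThan_atLeast0 add.commute)
  then show ?thesis by (simp flip: sum.nat_group)
qed

lemma block_index_less: "(i :: nat) < r \<Longrightarrow> s < d \<Longrightarrow> i * d + s < r * d"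
proof -
  assume "i < r" "s < d"
  then have "i * d + s < Suc i * d" by simp
  also have "\<dots> \<le> r * d" using \<open>i < r\<close> by (intro mult_le_mono1) simp
  finally show ?thesis .
qed

definition real_basis :: "nat \<Rightarrow> (nat \<Rightarrow> 'a :: real_vector) \<Rightarrow> bool" where
  "real_basis d \<epsilon> \<longleftrightarrow>
     (\<forall>q. \<exists>c. q = (\<Sum>t<d. c t *\<^sub>R \<epsilon> t)) \<and>
     (\<forall>c. (\<Sum>t<d. c t *\<^sub>R \<epsilon> t) = 0 \<longrightarrow> (\<forall>t<d. c t = 0))"

lemma mult_mat_vec_real_lincomb:
  fixes b :: "'a :: real_div_algebra mat"
  assumes "b \<in> carrier_mat n m" "u \<in> carrier_vec m" "v \<in> carrier_vec m" "w \<in> carrier_vec m"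
    and "\<And>j. j < m \<Longrightarrow> w $ j = s *\<^sub>R u $ j + t *\<^sub>R v $ j" and "i < n"
  shows "(b *\<^sub>v w) $ i = s *\<^sub>R (b *\<^sub>v u) $ i + t *\<^sub>R (b *\<^sub>v v) $ i"
  using assms by (simp add: scalar_prod_def sum.distrib scaleR_sum_right algebra_simps)

text \<open>In coordinates with respect to \<open>\<epsilon>\<close>, the operator \<open>b\<close> is a real matrix \<open>g\<close> of size \<open>r * d\<close>, which
  has a complex eigenvalue \<open>l\<close>.  The real and imaginary parts \<open>X\<close>, \<open>Y\<close> of an eigenvector satisfy
  \<open>b X = Re l X - Im l Y\<close> and \<open>b Y = Im l X + Re l Y\<close>, so both are annihilated by the polynomial
  \<open>(t - Re l)\<^sup>2 + (Im l)\<^sup>2\<close>, and at least one of them is nonzero.\<close>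

lemma real_quadratic_vector:
  fixes b :: "'a :: real_div_algebra mat"
  assumes basis: "real_basis d (\<epsilon> :: nat \<Rightarrow> 'a)"
    and b: "b \<in> carrier_mat r r" and "r > 0"
  obtains w p q where "w \<in> carrier_vec r" "w \<noteq> 0\<^sub>v r"
    "\<And>i. i < r \<Longrightarrow> (b *\<^sub>v (b *\<^sub>v w)) $ i = p *\<^sub>R (b *\<^sub>v w) $ i + q *\<^sub>R w $ i"
proof -
  obtain \<kappa> where \<kappa>: "\<And>q. q = (\<Sum>t<d. \<kappa> q t *\<^sub>R \<epsilon> t)"
    using basis unfolding real_basis_def by metis
  have indep: "c t = 0" if "(\<Sum>t<d. c t *\<^sub>R \<epsilon> t) = 0" "t < d" for c t
    using basis that unfolding real_basis_def by blast
  have "d > 0" using \<kappa>[of 1] by (cases d) auto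
  define g where "g a c = \<kappa> (b $$ (a div d, c div d) * \<epsilon> (c mod d)) (a mod d)" for a c
  define \<psi> where "\<psi> x = vec r (\<lambda>i. \<Sum>s<d. x (i * d + s) *\<^sub>R \<epsilon> s)" for x
  have \<psi>C: "\<psi> x \<in> carrier_vec r" for x by (simp add: \<psi>_def)
  have act: "(b *\<^sub>v \<psi> x) $ i = (\<Sum>s<d. (\<Sum>c<r * d. g (i * d + s) c * x c) *\<^sub>R \<epsilon> s)"
    if i: "i < r" for x i
  proof -
    have "(b *\<^sub>v \<psi> x) $ i = (\<Sum>j<r. b $$ (i, j) * (\<Sum>t<d. x (j * d + t) *\<^sub>R \<epsilon> t))"
      using b i by (simp add: \<psi>_def scalar_prod_def lessThan_atLeast0)
    also have "\<dots> = (\<Sum>j<r. \<Sum>t<d. x (j * d + t) *\<^sub>R (b $$ (i, j) * \<epsilon> t))"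
      by (simp add: sum_distrib_left)
    also have "\<dots> = (\<Sum>j<r. \<Sum>t<d. \<Sum>s<d. (g (i * d + s) (j * d + t) * x (j * d + t)) *\<^sub>R \<epsilon> s)"
    proof (intro sum.cong refl)
      fix j t assume "t \<in> {..<d}"
      then have "g (i * d + s) (j * d + t) = \<kappa> (b $$ (i, j) * \<epsilon> t) s" if "s < d" for s
        using that \<open>d > 0\<close> by (simp add: g_def)
      moreover have "x (j * d + t) *\<^sub>R (b $$ (i, j) * \<epsilon> t) =
          (\<Sum>s<d. (\<kappa> (b $$ (i, j) * \<epsilon> t) s * x (j * d + t)) *\<^sub>R \<epsilon> s)"
        by (subst \<kappa>[of "b $$ (i, j) * \<epsilon> t"]) (simp add: scaleR_sum_right mult.commute)
      ultimately show "x (j * d + t) *\<^sub>R (b $$ (i, j) * \<epsilon> t) =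
          (\<Sum>s<d. (g (i * d + s) (j * d + t) * x (j * d + t)) *\<^sub>R \<epsilon> s)" by simp
    qed
    also have "\<dots> = (\<Sum>c<r * d. \<Sum>s<d. (g (i * d + s) c * x c) *\<^sub>R \<epsilon> s)"
      by (rule sum_blocks[symmetric])
    also have "\<dots> = (\<Sum>s<d. (\<Sum>c<r * d. g (i * d + s) c * x c) *\<^sub>R \<epsilon> s)"
      by (simp add: scaleR_sum_left) (rule sum.swap)
    finally show ?thesis .
  qed
  define M where "M = mat (r * d) (r * d) (\<lambda>(a, c). complex_of_real (g a c))"
  have M: "M \<in> carrier_mat (r * d) (r * d)" by (simp add: M_def)
  then obtain l where "eigenvalue M l"
    using spectrum_non_empty[OF M] \<open>d > 0\<close> \<open>r > 0\<close> by (auto simp: spectrum_def)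
  then obtain z where z: "z \<in> carrier_vec (r * d)" "z \<noteq> 0\<^sub>v (r * d)" "M *\<^sub>v z = l \<cdot>\<^sub>v z"
    using M by (auto simp: eigenvalue_def eigenvector_def)
  define x y where "x c = Re (z $ c)" and "y c = Im (z $ c)" for c
  have "(\<Sum>c<r * d. complex_of_real (g a c) * z $ c) = l * z $ a" if "a < r * d" for a
  proof -
    have "(M *\<^sub>v z) $ a = l * z $ a" using z that by simp
    then show ?thesis using that z(1) by (simp add: M_def scalar_prod_def lessThan_atLeast0)
  qed
  from arg_cong[OF this, where f = Re] arg_cong[OF this, where f = Im]
  have xy: "(\<Sum>c<r * d. g a c * x c) = Re l * x a - Im l * y a"
      "(\<Sum>c<r * d. g a c * y c) = Im l * x a + Re l * y a" if "a < r * d" for a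
    using that by (simp_all add: x_def y_def)
  define X Y where "X = \<psi> x" and "Y = \<psi> y"
  have XY: "X \<in> carrier_vec r" "Y \<in> carrier_vec r" by (simp_all add: X_def Y_def \<psi>C)
  have bX: "(b *\<^sub>v X) $ i = Re l *\<^sub>R X $ i + (- Im l) *\<^sub>R Y $ i"
    and bY: "(b *\<^sub>v Y) $ i = Im l *\<^sub>R X $ i + Re l *\<^sub>R Y $ i" if i: "i < r" for i
  proof -
    have "(b *\<^sub>v X) $ i = (\<Sum>s<d. (Re l * x (i * d + s) - Im l * y (i * d + s)) *\<^sub>R \<epsilon> s)"
      unfolding X_def act[OF i] using i by (intro sum.cong refl) (simp add: xy block_index_less)
    then show "(b *\<^sub>v X) $ i = Re l *\<^sub>R X $ i + (- Im l) *\<^sub>R Y $ i"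
      using i by (simp add: X_def Y_def \<psi>_def scaleR_sum_right scaleR_left_diff_distrib sum_subtractf sum_negf)
    have "(b *\<^sub>v Y) $ i = (\<Sum>s<d. (Im l * x (i * d + s) + Re l * y (i * d + s)) *\<^sub>R \<epsilon> s)"
      unfolding Y_def act[OF i] using i by (intro sum.cong refl) (simp add: xy block_index_less)
    then show "(b *\<^sub>v Y) $ i = Im l *\<^sub>R X $ i + Re l *\<^sub>R Y $ i"
      using i by (simp add: X_def Y_def \<psi>_def scaleR_sum_right scaleR_left_distrib sum.distrib)
  qed
  have bb: "(b *\<^sub>v (b *\<^sub>v X)) $ i = Re l *\<^sub>R (b *\<^sub>v X) $ i + (- Im l) *\<^sub>R (b *\<^sub>v Y) $ i"
    "(b *\<^sub>v (b *\<^sub>v Y)) $ i = Im l *\<^sub>R (b *\<^sub>v X) $ i + Re l *\<^sub>R (b *\<^sub>v Y) $ i" if i: "i < r" for i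
    using mult_mat_vec_real_lincomb[OF b XY mult_mat_vec_carrier[OF b XY(1)] bX i]
      mult_mat_vec_real_lincomb[OF b XY mult_mat_vec_carrier[OF b XY(2)] bY i] by blast+
  let ?p = "2 * Re l" and ?q = "- (Re l * Re l + Im l * Im l)"
  have "(b *\<^sub>v (b *\<^sub>v X)) $ i = ?p *\<^sub>R (b *\<^sub>v X) $ i + ?q *\<^sub>R X $ i"
    "(b *\<^sub>v (b *\<^sub>v Y)) $ i = ?p *\<^sub>R (b *\<^sub>v Y) $ i + ?q *\<^sub>R Y $ i" if i: "i < r" for i
  proof -
    have twice: "?p *\<^sub>R Z = Re l *\<^sub>R Z + Re l *\<^sub>R Z" for Z :: 'a
      by (simp flip: scaleR_left_distrib)
    show "(b *\<^sub>v (b *\<^sub>v X)) $ i = ?p *\<^sub>R (b *\<^sub>v X) $ i + ?q *\<^sub>R X $ i"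
      "(b *\<^sub>v (b *\<^sub>v Y)) $ i = ?p *\<^sub>R (b *\<^sub>v Y) $ i + ?q *\<^sub>R Y $ i"
      unfolding twice bb[OF i] bX[OF i] bY[OF i] by (simp_all add: algebra_simps)
  qed
  moreover have "X \<noteq> 0\<^sub>v r \<or> Y \<noteq> 0\<^sub>v r"
  proof (rule ccontr)
    assume "\<not> (X \<noteq> 0\<^sub>v r \<or> Y \<noteq> 0\<^sub>v r)"
    then have "\<psi> x $ i = 0" "\<psi> y $ i = 0" if "i < r" for i
      using that by (auto simp: X_def Y_def)
    then have zero: "x (i * d + s) = 0" "y (i * d + s) = 0" if "i < r" "s < d" for i s
      using that indep[of "\<lambda>s. x (i * d + s)"] indep[of "\<lambda>s. y (i * d + s)"]
      by (auto simp: \<psi>_def)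
    have "z $ a = 0" if "a < r * d" for a
    proof -
      have "a div d < r" "a mod d < d" using that \<open>d > 0\<close> by (auto simp: less_mult_imp_div_less)
      from zero[OF this] show ?thesis by (simp add: x_def y_def complex_eq_iff)
    qed
    then show False using z(1,2) by (auto simp: vec_eq_iff)
  qed
  ultimately show thesis using that XY by meson
qed

lemma real_basis_real: "real_basis 1 (\<lambda>_. 1 :: real)"
  by (auto simp: real_basis_def)

lemma real_basis_complex: "real_basis 2 (\<lambda>t. if t = 0 then 1 else \<i>)"
  unfolding real_basis_def
proof (intro conjI allI impI)
  fix q :: complex
  have "q = (\<Sum>t<(2::nat). (if t = 0 then Re q else Im q) *\<^sub>R (if t = 0 then 1 else \<i>))"
    by (simp add: numeral_2_eq_2 complex_eq_iff)
  then show "\<exists>c. q = (\<Sum>t<(2::nat). c t *\<^sub>R (if t = 0 then 1 else \<i>))" by (intro exI)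
next
  fix c :: "nat \<Rightarrow> real" and t :: nat
  assume "(\<Sum>t<(2::nat). c t *\<^sub>R (if t = 0 then 1 else \<i>)) = 0" "t < 2"
  then show "c t = 0" by (cases t) (auto simp: numeral_2_eq_2 complex_eq_iff)
qed

lemma real_basis_quat:
  "real_basis 4 ((!) [Quat 1 0 0 0, Quat 0 1 0 0, Quat 0 0 1 0, Quat 0 0 0 1])"
proof -
  have eq: "(\<Sum>t<(4::nat). c t *\<^sub>R [Quat 1 0 0 0, Quat 0 1 0 0, Quat 0 0 1 0, Quat 0 0 0 1] ! t) =
    Quat (c 0) (c 1) (c 2) (c 3)" for c :: "nat \<Rightarrow> real"
    by (simp add: eval_nat_numeral quat_arith_defs)
  show ?thesis
    unfolding real_basis_def eq
  proof (intro conjI allI impI)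
    fix q :: quat
    show "\<exists>c :: nat \<Rightarrow> real. q = Quat (c 0) (c 1) (c 2) (c 3)"
      by (intro exI[of _ "(!) [qRe q, qI q, qJ q, qK q]"]) (simp add: eval_nat_numeral)
  next
    fix c :: "nat \<Rightarrow> real" and t :: nat
    assume "Quat (c 0) (c 1) (c 2) (c 3) = 0" "t < 4"
    then show "c t = 0" by (auto simp: zero_quat_def eval_nat_numeral less_Suc_eq)
  qed
qed

section \<open>Irreducibility in terms of invariant spans\<close>

definition right_subspace :: "nat \<Rightarrow> 'a :: division_ring vec set \<Rightarrow> bool" where
  "right_subspace n V \<longleftrightarrow> V \<subseteq> carrier_vec n \<and> 0\<^sub>v n \<in> V \<and>
     (\<forall>u\<in>V. \<forall>v\<in>V. u + v \<in> V) \<and> (\<forall>v\<in>V. \<forall>c. map_vec (\<lambda>t. t * c) v \<in> V)"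

text \<open>Irreducibility as an induction principle: a property of vectors that is closed under right linear
  combinations holds for all of them once it holds on the orbit of one nonzero vector.\<close>

definition all_vectors_cyclic :: "nat \<Rightarrow> 'a :: division_ring mat set \<Rightarrow> bool" where
  "all_vectors_cyclic n \<A> \<longleftrightarrow>
     (\<forall>x \<in> carrier_vec n. x \<noteq> 0\<^sub>v n \<longrightarrow>
        (\<forall>V. right_subspace n V \<longrightarrow> (\<forall>a\<in>\<A>. a *\<^sub>v x \<in> V) \<longrightarrow> V = carrier_vec n))"

lemma right_subspace_lincomb:
  assumes V: "right_subspace n V" and "finite B" "B \<subseteq> V"
  shows "right_lincomb n c B \<in> V"
  using assms(2,3)
proof (induction B rule: finite_induct)
  case empty
  have "right_lincomb n c {} = 0\<^sub>v n" by (auto simp: right_lincomb_def)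
  then show ?case using V by (simp add: right_subspace_def)
next
  case (insert v B)
  have "v \<in> carrier_vec n" using insert V by (auto simp: right_subspace_def)
  then have "right_lincomb n c (insert v B) = map_vec (\<lambda>t. t * c v) v + right_lincomb n c B"
    using insert by (intro eq_vecI) (auto simp: right_lincomb_def)
  then show ?case using insert V by (auto simp: right_subspace_def)
qed

lemma irreducible_all_vectors_cyclic:
  fixes \<A> :: "'a :: real_div_algebra mat set"
  assumes alg: "real_matrix_algebra n \<A>" and irr: "irreducible_family n \<A>"
  shows "all_vectors_cyclic n \<A>"
  unfolding all_vectors_cyclic_def
proof (intro ballI impI allI)
  fix x V assume x: "x \<in> carrier_vec n" "x \<noteq> 0\<^sub>v n"
    and V: "right_subspace n V" "\<forall>a\<in>\<A>. a *\<^sub>v x \<in> V"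
  have sg: "S \<in> \<A>" if "S \<in> mult_semigroup \<A>" for S
    using that by induction (use alg in \<open>auto simp: real_matrix_algebra_def\<close>)
  have "right_span n {S *\<^sub>v x | S. S \<in> mult_semigroup \<A>} \<subseteq> V"
  proof
    fix y assume "y \<in> right_span n {S *\<^sub>v x | S. S \<in> mult_semigroup \<A>}"
    then obtain c B where "y = right_lincomb n c B" "finite B" "B \<subseteq> {S *\<^sub>v x | S. S \<in> mult_semigroup \<A>}"
      unfolding right_span_def by blast
    moreover from this have "B \<subseteq> V" using sg V(2) by blast
    ultimately show "y \<in> V" using right_subspace_lincomb[OF V(1)] by blast
  qed
  then show "V = carrier_vec n"
    using irr x V(1) unfolding irreducible_family_def right_subspace_def by blast
qed

lemma mult_mat_vec_right_scale:
  fixes M :: "'a :: division_ring mat"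
  assumes "M \<in> carrier_mat n m" "v \<in> carrier_vec m"
  shows "M *\<^sub>v map_vec (\<lambda>t. t * c) v = map_vec (\<lambda>t. t * c) (M *\<^sub>v v)"
  using assms by (intro eq_vecI) (auto simp: scalar_prod_def sum_distrib_right mult.assoc)

lemma right_subspace_range:
  fixes M :: "'a :: division_ring mat"
  assumes M: "M \<in> carrier_mat n m"
  shows "right_subspace n {M *\<^sub>v c | c. c \<in> carrier_vec m}"
  unfolding right_subspace_def
proof (intro conjI ballI allI)
  show "0\<^sub>v n \<in> {M *\<^sub>v c | c. c \<in> carrier_vec m}"
    using M by (intro CollectI exI[of _ "0\<^sub>v m"]) (auto simp: scalar_prod_def)
next
  fix u v assume "u \<in> {M *\<^sub>v c | c. c \<in> carrier_vec m}" "v \<in> {M *\<^sub>v c | c. c \<in> carrier_vec m}"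
  then obtain c d where "u = M *\<^sub>v c" "v = M *\<^sub>v d" "c \<in> carrier_vec m" "d \<in> carrier_vec m" by blast
  then have "u + v = M *\<^sub>v (c + d)" "c + d \<in> carrier_vec m"
    using M by (auto simp: mult_add_distrib_mat_vec)
  then show "u + v \<in> {M *\<^sub>v c | c. c \<in> carrier_vec m}" by blast
next
  fix v c assume "v \<in> {M *\<^sub>v c | c. c \<in> carrier_vec m}"
  then obtain d where "v = M *\<^sub>v d" "d \<in> carrier_vec m" by blast
  then have "map_vec (\<lambda>t. t * c) v = M *\<^sub>v map_vec (\<lambda>t. t * c) d"
      "map_vec (\<lambda>t. t * c) d \<in> carrier_vec m"
    using mult_mat_vec_right_scale[OF M] by auto
  then show "map_vec (\<lambda>t. t * c) v \<in> {M *\<^sub>v c | c. c \<in> carrier_vec m}" by blast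
qed (use M in auto)

lemma right_subspace_preimage:
  fixes M :: "'a :: division_ring mat"
  assumes M: "M \<in> carrier_mat m n" and V: "right_subspace m V"
  shows "right_subspace n {v \<in> carrier_vec n. M *\<^sub>v v \<in> V}"
proof -
  have "M *\<^sub>v 0\<^sub>v n = 0\<^sub>v m" using M by (auto simp: scalar_prod_def)
  moreover have "map_vec f v \<in> carrier_vec n" if "v \<in> carrier_vec n" for f and v :: "'a vec"
    using that by auto
  ultimately show ?thesis
    using V M mult_mat_vec_right_scale[OF M] unfolding right_subspace_def
    by (auto simp: mult_add_distrib_mat_vec[OF M])
qed

lemma right_subspace_zero: "right_subspace n {0\<^sub>v n :: 'a :: division_ring vec}"
  by (auto simp: right_subspace_def)

lemma annihilator_of_orbit:
  fixes L :: "'a :: division_ring mat"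
  assumes cyc: "all_vectors_cyclic n \<A>" and x: "x \<in> carrier_vec n" "x \<noteq> 0\<^sub>v n"
    and \<A>: "\<A> \<subseteq> carrier_mat n n"
    and L: "L \<in> carrier_mat m n" and zero: "\<And>a. a \<in> \<A> \<Longrightarrow> L *\<^sub>v (a *\<^sub>v x) = 0\<^sub>v m"
  shows "L = 0\<^sub>m m n"
proof -
  let ?V = "{v \<in> carrier_vec n. L *\<^sub>v v \<in> {0\<^sub>v m}}"
  have "right_subspace n ?V"
    using right_subspace_preimage[OF L right_subspace_zero] .
  moreover have "\<forall>a\<in>\<A>. a *\<^sub>v x \<in> ?V" using zero \<A> x by auto
  ultimately have V: "?V = carrier_vec n"
    using cyc x unfolding all_vectors_cyclic_def by blast
  show ?thesis
  proof (rule eq_matI)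
    fix i j assume "i < dim_row (0\<^sub>m m n :: 'a mat)" "j < dim_col (0\<^sub>m m n :: 'a mat)"
    then have ij: "i < m" "j < n" by auto
    have "unit_vec n j \<in> ?V" unfolding V by simp
    then have "(L *\<^sub>v unit_vec n j) $ i = 0" using ij by simp
    then show "L $$ (i, j) = 0\<^sub>m m n $$ (i, j)" using L ij by (simp add: scalar_prod_right_unit)
  qed (use L in auto)
qed

section \<open>Matrix algebras whose nonzero members are injective\<close>

abbreviation scaleR_mat :: "real \<Rightarrow> 'a :: scaleR mat \<Rightarrow> 'a mat" where
  "scaleR_mat t \<equiv> map_mat ((*\<^sub>R) t)"

abbreviation right_scale :: "'a :: times vec \<Rightarrow> 'a \<Rightarrow> 'a vec" where
  "right_scale v c \<equiv> map_vec (\<lambda>t. t * c) v"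

definition complex_comb :: "'a :: real_div_algebra mat \<Rightarrow> complex \<Rightarrow> 'a mat" where
  "complex_comb u z = scaleR_mat (Re z) (1\<^sub>m (dim_row u)) + scaleR_mat (Im z) u"

definition quat_comb :: "'a :: real_div_algebra mat \<Rightarrow> 'a mat \<Rightarrow> quat \<Rightarrow> 'a mat" where
  "quat_comb u v q = scaleR_mat (qRe q) (1\<^sub>m (dim_row u)) + scaleR_mat (qI q) u +
     scaleR_mat (qJ q) v + scaleR_mat (qK q) (u * v)"

lemma complex_comb_carrier [simp]: "u \<in> carrier_mat r r \<Longrightarrow> complex_comb u z \<in> carrier_mat r r"
  by (simp add: complex_comb_def)

lemma quat_comb_carrier [simp]:
  "u \<in> carrier_mat r r \<Longrightarrow> v \<in> carrier_mat r r \<Longrightarrow> quat_comb u v q \<in> carrier_mat r r"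
  by (simp add: quat_comb_def)

lemma scaleR_mat_mult_vec:
  fixes A :: "'a :: real_div_algebra mat"
  assumes "A \<in> carrier_mat n m" "x \<in> carrier_vec m" "i < n"
  shows "(scaleR_mat t A *\<^sub>v x) $ i = t *\<^sub>R (A *\<^sub>v x) $ i"
  using assms by (simp add: scalar_prod_def scaleR_sum_right)

lemma complex_comb_mult_vec:
  assumes "u \<in> carrier_mat r r" "x \<in> carrier_vec r" "i < r"
  shows "(complex_comb u z *\<^sub>v x) $ i = Re z *\<^sub>R x $ i + Im z *\<^sub>R (u *\<^sub>v x) $ i"
  using assms
  by (simp add: complex_comb_def add_mult_distrib_mat_vec[of _ r r] scaleR_mat_mult_vec[of _ r r]
      del: index_mult_mat_vec)

lemma quat_comb_mult_vec:
  assumes "u \<in> carrier_mat r r" "v \<in> carrier_mat r r" "x \<in> carrier_vec r" "i < r"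
  shows "(quat_comb u v q *\<^sub>v x) $ i = qRe q *\<^sub>R x $ i + qI q *\<^sub>R (u *\<^sub>v x) $ i +
    qJ q *\<^sub>R (v *\<^sub>v x) $ i + qK q *\<^sub>R (u *\<^sub>v (v *\<^sub>v x)) $ i"
  using assms
  by (simp add: quat_comb_def add_mult_distrib_mat_vec[of _ r r] scaleR_mat_mult_vec[of _ r r]
      del: index_mult_mat_vec)

lemmas mat_op_simps = mat_op_add mat_op_mult mat_op_scaleR mat_op_one mat_op_zero mat_op_uminus

lemma mat_op_complex_comb:
  assumes "r > 0" "u \<in> carrier_mat r r"
  shows "mat_op r (complex_comb u z) = Re z *\<^sub>R 1 + Im z *\<^sub>R mat_op r u"
  using assms by (simp add: complex_comb_def mat_op_simps)

lemma mat_op_quat_comb: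
  assumes "r > 0" "u \<in> carrier_mat r r" "v \<in> carrier_mat r r"
  shows "mat_op r (quat_comb u v q) = qRe q *\<^sub>R 1 + qI q *\<^sub>R mat_op r u + qJ q *\<^sub>R mat_op r v +
    qK q *\<^sub>R (mat_op r u * mat_op r v)"
  using assms by (simp add: quat_comb_def mat_op_simps)

lemma complex_comb_eq_0:
  assumes "r > 0" "u \<in> carrier_mat r r" "u * u = - 1\<^sub>m r" "complex_comb u z = 0\<^sub>m r r"
  shows "z = 0"
proof -
  define U where "U = mat_op r u"
  have UU: "U * U = - 1"
    using arg_cong[OF assms(3), of "mat_op r"] assms(1,2) by (simp add: mat_op_simps U_def)
  have "Re z *\<^sub>R 1 + Im z *\<^sub>R U = 0"
    using arg_cong[OF assms(4), of "mat_op r"] assms(1,2)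
    by (simp add: mat_op_complex_comb mat_op_zero U_def)
  then have "(Re z *\<^sub>R 1 - Im z *\<^sub>R U) * (Re z *\<^sub>R 1 + Im z *\<^sub>R U) = 0" by simp
  moreover have "(Re z *\<^sub>R 1 - Im z *\<^sub>R U) * (Re z *\<^sub>R 1 + Im z *\<^sub>R U) =
      (Re z * Re z + Im z * Im z) *\<^sub>R 1"
    by (simp add: algebra_simps UU)
  ultimately have "Re z * Re z + Im z * Im z = 0" by simp
  then show "z = 0" by (simp add: complex_eq_iff sum_squares_eq_zero_iff)
qed

lemma quat_comb_eq_0:
  assumes "r > 0" "u \<in> carrier_mat r r" "v \<in> carrier_mat r r"
    and "u * u = - 1\<^sub>m r" "v * v = - 1\<^sub>m r" "v * u = - (u * v)" and "quat_comb u v q = 0\<^sub>m r r"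
  shows "q = 0"
proof -
  define U V where "U = mat_op r u" and "V = mat_op r v"
  have UU: "U * U = - 1" and VV: "V * V = - 1" and VU: "V * U = - (U * V)"
    using arg_cong[OF assms(4), of "mat_op r"] arg_cong[OF assms(5), of "mat_op r"]
      arg_cong[OF assms(6), of "mat_op r"] assms(1-3)
    by (simp_all add: mat_op_simps U_def V_def)
  have assoc: "U * (U * x) = - x" "V * (V * x) = - x" "V * (U * x) = - (U * (V * x))" for x
    using UU VV VU by (simp_all flip: mult.assoc)
  let ?a = "qRe q" and ?b = "qI q" and ?c = "qJ q" and ?d = "qK q"
  have "?a *\<^sub>R 1 + ?b *\<^sub>R U + ?c *\<^sub>R V + ?d *\<^sub>R (U * V) = 0"
    using arg_cong[OF assms(7), of "mat_op r"] assms(1-3)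
    by (simp add: mat_op_quat_comb mat_op_zero U_def V_def)
  then have "(?a *\<^sub>R 1 - ?b *\<^sub>R U - ?c *\<^sub>R V - ?d *\<^sub>R (U * V)) *
      (?a *\<^sub>R 1 + ?b *\<^sub>R U + ?c *\<^sub>R V + ?d *\<^sub>R (U * V)) = 0" by simp
  moreover have "(?a *\<^sub>R 1 - ?b *\<^sub>R U - ?c *\<^sub>R V - ?d *\<^sub>R (U * V)) *
      (?a *\<^sub>R 1 + ?b *\<^sub>R U + ?c *\<^sub>R V + ?d *\<^sub>R (U * V)) =
      (?a * ?a + ?b * ?b + ?c * ?c + ?d * ?d) *\<^sub>R 1"
    by (simp add: algebra_simps UU VV VU assoc)
  ultimately have "(?a * ?a + ?b * ?b) + (?c * ?c + ?d * ?d) = 0" by simp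
  then have "?a * ?a + ?b * ?b = 0" "?c * ?c + ?d * ?d = 0"
    by (smt (verit) zero_le_square)+
  then show "q = 0" by (simp add: quat_eq_iff zero_quat_def sum_squares_eq_zero_iff)
qed

locale irreducible_algebra =
  fixes r :: nat and K :: "'a :: real_div_algebra mat set"
  assumes algebra: "real_matrix_algebra r K"
    and cyclic: "all_vectors_cyclic r K"
    and pos: "r > 0"
begin

lemma closed:
  shows "k \<in> K \<Longrightarrow> k \<in> carrier_mat r r"
    and "k \<in> K \<Longrightarrow> l \<in> K \<Longrightarrow> k + l \<in> K"
    and "k \<in> K \<Longrightarrow> l \<in> K \<Longrightarrow> k * l \<in> K"
    and "k \<in> K \<Longrightarrow> scaleR_mat t k \<in> K"
    and "0\<^sub>m r r \<in> K"
  using algebra by (auto simp: real_matrix_algebra_def)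

lemma nonzero_vector: "unit_vec r 0 \<in> carrier_vec r" "unit_vec r 0 \<noteq> (0\<^sub>v r :: 'a vec)"
  using pos by (auto simp: vec_eq_iff)

lemma nonzero_member: obtains k where "k \<in> K" "k \<noteq> 0\<^sub>m r r"
proof (rule ccontr)
  assume "\<not> thesis"
  then have zero: "k = 0\<^sub>m r r" if "k \<in> K" for k using that \<open>\<And>k. k \<in> K \<Longrightarrow> k \<noteq> 0\<^sub>m r r \<Longrightarrow> thesis\<close> by blast
  have "(1\<^sub>m r :: 'a mat) = 0\<^sub>m r r"
  proof (rule annihilator_of_orbit[OF cyclic nonzero_vector])
    fix k assume "k \<in> K"
    then show "1\<^sub>m r *\<^sub>v (k *\<^sub>v unit_vec r 0) = 0\<^sub>v r"
      unfolding zero[OF \<open>k \<in> K\<close>] by (intro eq_vecI) (auto simp: scalar_prod_def)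
  qed (use closed in auto)
  then have "(1\<^sub>m r :: 'a mat) $$ (0, 0) = 0\<^sub>m r r $$ (0, 0)" by simp
  then show False using pos by simp
qed

end

text \<open>Corners of irreducible algebras have this form.  The identity matrix turns out to be a member
  (\<open>one_mem\<close>), so these are division algebras.\<close>

locale division_matrix_algebra = irreducible_algebra r K
  for r :: nat and K :: "'a :: real_div_algebra mat set" +
  assumes inj: "\<And>k. k \<in> K \<Longrightarrow> k \<noteq> 0\<^sub>m r r \<Longrightarrow> inj_mat k"
begin

lemma annihilates_vector:
  assumes "k \<in> K" "x \<in> carrier_vec r" "x \<noteq> 0\<^sub>v r" "k *\<^sub>v x = 0\<^sub>v r"
  shows "k = 0\<^sub>m r r"
  using inj[OF assms(1)] inj_matD[of k r r x] assms closed(1) by blast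

lemma no_zero_divisors:
  assumes "k \<in> K" "k \<noteq> 0\<^sub>m r r" "M \<in> carrier_mat r r" "k * M = 0\<^sub>m r r"
  shows "M = 0\<^sub>m r r"
  using inj_mat_cancel_zero[OF inj[OF assms(1,2)]] assms closed(1) by blast

text \<open>A quadratic polynomial in \<open>b\<close> that kills a nonzero vector must vanish, as nonzero members of
  \<open>K\<close> are injective.\<close>

lemma quadratic:
  assumes basis: "real_basis d (\<epsilon> :: nat \<Rightarrow> 'a)" and b: "b \<in> K"
  obtains p q where "b * b + scaleR_mat p b + scaleR_mat q (1\<^sub>m r) = 0\<^sub>m r r"
proof (cases "b = 0\<^sub>m r r")
  case True
  then have "b * b + scaleR_mat 0 b + scaleR_mat 0 (1\<^sub>m r) = 0\<^sub>m r r" by (auto intro!: eq_matI)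
  then show ?thesis using that by blast
next
  case False
  have bC: "b \<in> carrier_mat r r" using closed b by blast
  obtain w p q where w: "w \<in> carrier_vec r" "w \<noteq> 0\<^sub>v r"
    "\<And>i. i < r \<Longrightarrow> (b *\<^sub>v (b *\<^sub>v w)) $ i = p *\<^sub>R (b *\<^sub>v w) $ i + q *\<^sub>R w $ i"
    using real_quadratic_vector[OF basis bC pos] by metis
  define D where "D = b * b + scaleR_mat (- p) b + scaleR_mat (- q) (1\<^sub>m r)"
  have D: "D \<in> carrier_mat r r" using bC by (simp add: D_def)
  have "D *\<^sub>v w = 0\<^sub>v r"
  proof (rule eq_vecI)
    fix i assume "i < dim_vec (0\<^sub>v r :: 'a vec)"
    then have i: "i < r" by simp
    have "(D *\<^sub>v w) $ i = (b *\<^sub>v (b *\<^sub>v w)) $ i + (- p) *\<^sub>R (b *\<^sub>v w) $ i + (- q) *\<^sub>R w $ i"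
      using bC w(1) i
      by (simp add: D_def add_mult_distrib_mat_vec[of _ r r] scaleR_mat_mult_vec[of _ r r]
          del: index_mult_mat_vec)
    then show "(D *\<^sub>v w) $ i = 0\<^sub>v r $ i" unfolding w(3)[OF i] using i by simp
  qed (use D in simp)
  \<comment> \<open>\<open>D\<close> need not lie in \<open>K\<close> before the identity does, but \<open>b * D\<close> does.\<close>
  have "b * D = b * b * b + scaleR_mat (- p) (b * b) + scaleR_mat (- q) b"
    using bC pos
    by (intro mat_op_inject[OF pos]) (auto simp: D_def mat_op_simps algebra_simps)
  then have "b * D \<in> K" using b by (auto intro!: closed)
  moreover have "(b * D) *\<^sub>v w = 0\<^sub>v r"
    using bC D w(1) \<open>D *\<^sub>v w = 0\<^sub>v r\<close> by (auto simp: scalar_prod_def)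
  ultimately have "b * D = 0\<^sub>m r r" using annihilates_vector w by blast
  then have "D = 0\<^sub>m r r" using no_zero_divisors[OF b False D] by blast
  then show ?thesis using that unfolding D_def by blast
qed

text \<open>In \<open>b * b + p b + q = 0\<close> the identity is a multiple of \<open>b * b + p b\<close>, unless \<open>q = 0\<close>; then
  \<open>b\<close> cancels and is itself a nonzero scalar.\<close>

lemma one_mem:
  assumes basis: "real_basis d (\<epsilon> :: nat \<Rightarrow> 'a)"
  shows "1\<^sub>m r \<in> K"
proof -
  obtain b where b: "b \<in> K" "b \<noteq> 0\<^sub>m r r" by (rule nonzero_member)
  have bC: "b \<in> carrier_mat r r" using closed b by blast
  obtain p q where eq: "b * b + scaleR_mat p b + scaleR_mat q (1\<^sub>m r) = 0\<^sub>m r r"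
    using quadratic[OF basis b(1)] by blast
  have opeq: "mat_op r b * mat_op r b + p *\<^sub>R mat_op r b + q *\<^sub>R 1 = 0"
    using arg_cong[OF eq, of "mat_op r"] bC pos by (simp add: mat_op_simps)
  show ?thesis
  proof (cases "q = 0")
    case False
    have q1: "q *\<^sub>R 1 = - (mat_op r b * mat_op r b + p *\<^sub>R mat_op r b)"
      using opeq by (metis add.commute eq_neg_iff_add_eq_0)
    then have "(- (1 / q)) *\<^sub>R (mat_op r b * mat_op r b + p *\<^sub>R mat_op r b) = (1 / q) *\<^sub>R (q *\<^sub>R 1)"
      by (simp only: q1 scaleR_minus_left scaleR_minus_right)
    then have "mat_op r (scaleR_mat (- (1 / q)) (b * b + scaleR_mat p b)) = mat_op r (1\<^sub>m r)"
      using False bC pos by (simp add: mat_op_simps)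
    then have "scaleR_mat (- (1 / q)) (b * b + scaleR_mat p b) = 1\<^sub>m r"
      using bC by (intro mat_op_inject[OF pos]) auto
    then show ?thesis using b(1) closed by metis
  next
    case True
    define D where "D = b + scaleR_mat p (1\<^sub>m r)"
    have D: "D \<in> carrier_mat r r" using bC by (simp add: D_def)
    have "b * D = 0\<^sub>m r r"
      using opeq True bC pos
      by (intro mat_op_inject[OF pos]) (auto simp: D_def mat_op_simps algebra_simps)
    then have D0: "D = 0\<^sub>m r r" using no_zero_divisors[OF b D] by blast
    have op0: "mat_op r b + p *\<^sub>R 1 = 0"
      using arg_cong[OF D0, of "mat_op r"] bC pos by (simp add: D_def mat_op_simps)
    have "p \<noteq> 0"
    proof
      assume "p = 0"
      then have "b = 0\<^sub>m r r" using op0 bC pos by (intro mat_op_inject[OF pos]) (auto simp: mat_op_simps)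
      then show False using b(2) by blast
    qed
    have "mat_op r b = - (p *\<^sub>R 1)" using op0 by (simp add: eq_neg_iff_add_eq_0)
    then have "mat_op r (scaleR_mat (- (1 / p)) b) = mat_op r (1\<^sub>m r)"
      using \<open>p \<noteq> 0\<close> bC pos by (simp add: mat_op_simps)
    then have "scaleR_mat (- (1 / p)) b = 1\<^sub>m r"
      using bC by (intro mat_op_inject[OF pos]) auto
    then show ?thesis using b(1) closed by metis
  qed
qed

lemma mat_op_image:
  assumes basis: "real_basis d (\<epsilon> :: nat \<Rightarrow> 'a)"
  defines "L \<equiv> mat_op r ` K"
  shows "a \<in> L \<Longrightarrow> b \<in> L \<Longrightarrow> a + b \<in> L"
    and "a \<in> L \<Longrightarrow> b \<in> L \<Longrightarrow> a * b \<in> L"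
    and "a \<in> L \<Longrightarrow> t *\<^sub>R a \<in> L"
    and "1 \<in> L"
    and "a \<in> L \<Longrightarrow> b \<in> L \<Longrightarrow> a * b = 0 \<Longrightarrow> a = 0 \<or> b = 0"
    and "a \<in> L \<Longrightarrow> \<exists>p q. a * a = p *\<^sub>R a + q *\<^sub>R 1"
proof -
  show "a \<in> L \<Longrightarrow> b \<in> L \<Longrightarrow> a + b \<in> L"
    unfolding L_def using closed pos by (auto simp flip: mat_op_add)
  show "a \<in> L \<Longrightarrow> b \<in> L \<Longrightarrow> a * b \<in> L"
    unfolding L_def using closed pos by (auto simp flip: mat_op_mult)
  show "a \<in> L \<Longrightarrow> t *\<^sub>R a \<in> L"
    unfolding L_def using closed pos by (auto simp flip: mat_op_scaleR)
  show "1 \<in> L" unfolding L_def using one_mem[OF basis] mat_op_one[OF pos] by (metis imageI)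
  show "a = 0 \<or> b = 0" if "a \<in> L" "b \<in> L" "a * b = 0"
  proof -
    obtain k l where kl: "k \<in> K" "l \<in> K" "a = mat_op r k" "b = mat_op r l"
      using \<open>a \<in> L\<close> \<open>b \<in> L\<close> unfolding L_def by blast
    then have "mat_op r (k * l) = mat_op r (0\<^sub>m r r)"
      using that closed pos by (simp add: mat_op_mult mat_op_zero)
    then have "k * l = 0\<^sub>m r r" using kl closed by (intro mat_op_inject[OF pos]) auto
    then have "k = 0\<^sub>m r r \<or> l = 0\<^sub>m r r" using no_zero_divisors kl closed by blast
    then show ?thesis using kl mat_op_zero[OF pos] by auto
  qed
  show "\<exists>p q. a * a = p *\<^sub>R a + q *\<^sub>R 1" if a: "a \<in> L"
  proof -
    obtain k where k: "k \<in> K" "a = mat_op r k" using a unfolding L_def by blast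
    obtain p q where eq: "k * k + scaleR_mat p k + scaleR_mat q (1\<^sub>m r) = 0\<^sub>m r r"
      using quadratic[OF basis k(1)] by blast
    have zero: "a * a + p *\<^sub>R a + q *\<^sub>R 1 = 0"
      using arg_cong[OF eq, of "mat_op r"] closed(1)[OF k(1)] pos by (simp add: mat_op_simps k(2))
    have "a * a = (a * a + p *\<^sub>R a + q *\<^sub>R 1) + ((- p) *\<^sub>R a + (- q) *\<^sub>R 1)" by simp
    then have "a * a = (- p) *\<^sub>R a + (- q) *\<^sub>R 1" unfolding zero by simp
    then show ?thesis by blast
  qed
qed

lemma left_inverse:
  assumes basis: "real_basis d (\<epsilon> :: nat \<Rightarrow> 'a)" and k: "k \<in> K" "k \<noteq> 0\<^sub>m r r"
  obtains l where "l \<in> K" "l * k = 1\<^sub>m r"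
proof -
  have "mat_op r k \<noteq> 0"
  proof
    assume "mat_op r k = 0"
    then have "k = 0\<^sub>m r r"
      using closed k pos by (intro mat_op_inject[OF pos]) (auto simp: mat_op_zero)
    then show False using k by blast
  qed
  then obtain b where "b \<in> mat_op r ` K" "b * mat_op r k = 1"
    using quadratic_domain_inverse[OF mat_op_image(1,3,4,5,6)[OF basis]] k by blast
  then obtain l where l: "l \<in> K" "mat_op r l * mat_op r k = 1" by blast
  then have "mat_op r (l * k) = mat_op r (1\<^sub>m r)" using closed k pos by (simp add: mat_op_simps)
  then have "l * k = 1\<^sub>m r" using l k closed by (intro mat_op_inject[OF pos]) auto
  then show ?thesis using that l by blast
qed

lemma member_cases:
  assumes basis: "real_basis d (\<epsilon> :: nat \<Rightarrow> 'a)"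
  obtains
    (real) "K = range (\<lambda>a. scaleR_mat a (1\<^sub>m r))"
  | (complex) u where "u \<in> K" "u * u = - 1\<^sub>m r" "K = range (complex_comb u)"
  | (quat) u v where "u \<in> K" "v \<in> K" "u * u = - 1\<^sub>m r" "v * v = - 1\<^sub>m r" "v * u = - (u * v)"
      "K = range (quat_comb u v)"
proof -
  note one = one_mem[OF basis]
  have inK: "k = l" if "k \<in> K" "l \<in> carrier_mat r r" "mat_op r k = mat_op r l" for k l
    using that closed by (intro mat_op_inject[OF pos]) auto
  show thesis
  proof (rule quadratic_domain_cases[OF mat_op_image[OF basis]])
    assume L: "mat_op r ` K = range (\<lambda>a. a *\<^sub>R 1)"
    show thesis
    proof (rule real, intro equalityI subsetI)
      fix k assume k: "k \<in> K"
      then obtain a where "mat_op r k = a *\<^sub>R 1" using L by blast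
      then have "k = scaleR_mat a (1\<^sub>m r)" using k pos by (intro inK) (auto simp: mat_op_simps)
      then show "k \<in> range (\<lambda>a. scaleR_mat a (1\<^sub>m r))" by blast
    qed (use one closed in auto)
  next
    fix u' assume u': "u' \<in> mat_op r ` K" "u' * u' = - 1"
      and L: "mat_op r ` K = {a *\<^sub>R 1 + b *\<^sub>R u' | a b. True}"
    obtain u where u: "u \<in> K" "u' = mat_op r u" using u' by blast
    have uC: "u \<in> carrier_mat r r" using u closed by blast
    have "u * u = - 1\<^sub>m r" using u u' uC pos by (intro inK) (auto simp: mat_op_simps intro: closed)
    moreover have "K = range (complex_comb u)"
    proof (intro equalityI subsetI)
      fix k assume k: "k \<in> K"
      then obtain a b where "mat_op r k = a *\<^sub>R 1 + b *\<^sub>R u'" using L by blast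
      then have "k = complex_comb u (Complex a b)"
        using k pos u uC by (intro inK) (auto simp: mat_op_complex_comb)
      then show "k \<in> range (complex_comb u)" by blast
    next
      fix k assume "k \<in> range (complex_comb u)"
      then show "k \<in> K" using one u uC by (auto simp: complex_comb_def intro!: closed)
    qed
    ultimately show thesis using complex u(1) by blast
  next
    fix u' v' assume u': "u' \<in> mat_op r ` K" "v' \<in> mat_op r ` K" "u' * u' = - 1" "v' * v' = - 1"
        "v' * u' = - (u' * v')"
      and L: "mat_op r ` K = {a *\<^sub>R 1 + b *\<^sub>R u' + c *\<^sub>R v' + d *\<^sub>R (u' * v') | a b c d. True}"
    obtain u v where u: "u \<in> K" "u' = mat_op r u" and v: "v \<in> K" "v' = mat_op r v" using u' by blast
    have uC: "u \<in> carrier_mat r r" "v \<in> carrier_mat r r" using u v closed by blast+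
    have "u * u = - 1\<^sub>m r" "v * v = - 1\<^sub>m r" "v * u = - (u * v)"
      using u v u' uC pos by (auto intro!: inK simp: mat_op_simps intro: closed)
    moreover have "K = range (quat_comb u v)"
    proof (intro equalityI subsetI)
      fix k assume k: "k \<in> K"
      then obtain a b c d where "mat_op r k = a *\<^sub>R 1 + b *\<^sub>R u' + c *\<^sub>R v' + d *\<^sub>R (u' * v')"
        using L by blast
      then have "k = quat_comb u v (Quat a b c d)"
        using k pos u v uC by (intro inK) (auto simp: mat_op_quat_comb)
      then show "k \<in> range (quat_comb u v)" by blast
    next
      fix k assume "k \<in> range (quat_comb u v)"
      then show "k \<in> K" using one u v uC by (auto simp: quat_comb_def intro!: closed)
    qed
    ultimately show thesis using quat u(1) v(1) by blast
  qed
qed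

text \<open>Let \<open>X\<close> have the columns \<open>xs\<close>.  The action says that \<open>\<phi> q * X = X * \<beta> q\<close>, so the range of \<open>X\<close>
  contains the orbit of the first column and is everything.  An injective and surjective \<open>X\<close> is
  invertible, hence square; the size \<open>r\<close> is a by-product.\<close>

lemma similar_range:
  fixes \<phi> :: "'q \<Rightarrow> 'a mat" and \<beta> :: "'q \<Rightarrow> 'a mat"
  assumes K: "K = range \<phi>" and xs: "set xs \<subseteq> carrier_vec r" "length xs = m" and "m > 0"
    and \<beta>: "\<And>q. \<beta> q \<in> carrier_mat m m"
    and indep: "\<And>c s. (\<And>i. i < r \<Longrightarrow> (\<Sum>s<m. xs ! s $ i * c s) = 0) \<Longrightarrow> s < m \<Longrightarrow> c s = 0"
    and act: "\<And>q t i. t < m \<Longrightarrow> i < r \<Longrightarrow>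
      (\<phi> q *\<^sub>v xs ! t) $ i = (\<Sum>s<m. xs ! s $ i * \<beta> q $$ (s, t))"
  shows "r = m \<and> similar_families r K (range \<beta>)"
proof -
  define X where "X = mat_of_cols r xs"
  have X: "X \<in> carrier_mat r m" using mat_of_cols_carrier(1)[of r xs] xs(2) by (simp add: X_def)
  have Xcol: "col X t = xs ! t" if "t < m" for t
    unfolding X_def using xs that by (intro col_mat_of_cols) auto
  have Xind: "X $$ (i, s) = xs ! s $ i" if "i < r" "s < m" for i s
    using that xs by (simp add: X_def mat_of_cols_index)
  have \<phi>C: "\<phi> q \<in> carrier_mat r r" for q using K closed(1) by blast
  have XinjI: "inj_mat X"
    unfolding inj_mat_def
  proof (intro ballI impI)
    fix c assume "c \<in> carrier_vec (dim_col X)" and z: "X *\<^sub>v c = 0\<^sub>v (dim_row X)"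
    then have c: "c \<in> carrier_vec m" using X by simp
    have "(\<Sum>s<m. xs ! s $ i * c $ s) = 0" if "i < r" for i
    proof -
      have "(X *\<^sub>v c) $ i = 0" using z X that by simp
      then show ?thesis using that X c Xind by (simp add: scalar_prod_def lessThan_atLeast0)
    qed
    then have "c $ s = 0" if "s < m" for s using indep that by blast
    then show "c = 0\<^sub>v (dim_col X)" using c X by (intro eq_vecI) auto
  qed
  have act': "\<phi> q * X = X * \<beta> q" for q
  proof (rule eq_matI)
    fix i t assume "i < dim_row (X * \<beta> q)" "t < dim_col (X * \<beta> q)"
    then have it: "i < r" "t < m" using X \<beta>[of q] by auto
    have "(\<phi> q * X) $$ (i, t) = (\<phi> q *\<^sub>v xs ! t) $ i"
      using it X \<phi>C[of q] Xcol by simp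
    also have "\<dots> = (X * \<beta> q) $$ (i, t)"
      unfolding act[OF it(2,1)] using it X \<beta>[of q] Xind
      by (simp add: scalar_prod_def lessThan_atLeast0)
    finally show "(\<phi> q * X) $$ (i, t) = (X * \<beta> q) $$ (i, t)" .
  qed (use X carrier_matD[OF \<beta>[of q]] carrier_matD[OF \<phi>C[of q]] in simp_all)
  have x0: "xs ! 0 \<in> carrier_vec r" using xs \<open>m > 0\<close> by auto
  have "xs ! 0 \<noteq> 0\<^sub>v r"
  proof
    assume x0z: "xs ! 0 = 0\<^sub>v r"
    have "X *\<^sub>v unit_vec m 0 = col X 0" using X \<open>m > 0\<close>
      by (intro eq_vecI) (auto simp: scalar_prod_right_unit)
    then have "X *\<^sub>v unit_vec m 0 = xs ! 0" using Xcol \<open>m > 0\<close> by simp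
    then have "unit_vec m 0 = (0\<^sub>v m :: 'a vec)" using inj_matD[OF XinjI X] x0z by simp
    then have "(unit_vec m 0 :: 'a vec) $ 0 = 0\<^sub>v m $ 0" by simp
    then show False using \<open>m > 0\<close> by simp
  qed
  have "k *\<^sub>v xs ! 0 \<in> {X *\<^sub>v c | c. c \<in> carrier_vec m}" if k: "k \<in> K" for k
  proof -
    obtain q where "k = \<phi> q" using k unfolding K by blast
    then have "k *\<^sub>v xs ! 0 = col (\<phi> q * X) 0"
      using X \<phi>C[of q] Xcol[of 0] \<open>m > 0\<close> by (intro eq_vecI) auto
    also have "\<dots> = X *\<^sub>v col (\<beta> q) 0"
      unfolding act' using X \<beta>[of q] \<open>m > 0\<close> by (intro eq_vecI) auto
    finally have "k *\<^sub>v xs ! 0 = X *\<^sub>v col (\<beta> q) 0" .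
    moreover have "col (\<beta> q) 0 \<in> carrier_vec m"
      using col_dim[of "\<beta> q" 0] carrier_matD(1)[OF \<beta>[of q]] by simp
    ultimately show ?thesis by blast
  qed
  then have "{X *\<^sub>v c | c. c \<in> carrier_vec m} = carrier_vec r"
    using cyclic x0 \<open>xs ! 0 \<noteq> 0\<^sub>v r\<close> right_subspace_range[OF X] unfolding all_vectors_cyclic_def by blast
  then obtain R where R: "R \<in> carrier_mat m r" "X * R = 1\<^sub>m r"
    using mult_mat_right_inverse_surj[OF X] by blast
  have "X * (R * X) = X * 1\<^sub>m m" using X R by (simp flip: assoc_mult_mat[OF X R(1) X])
  then have RX: "R * X = 1\<^sub>m m" using inj_mat_cancel[OF XinjI X, of "R * X" m] R X by auto
  have "m \<le> r" using inj_mat_cols_le_rows[OF XinjI X] .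
  moreover have "r \<le> m"
    using inj_mat_cols_le_rows[OF inj_mat_left_inverse[OF R(2) X R(1)] R(1)] .
  ultimately have rm: "r = m" by simp
  have "\<phi> q = X * \<beta> q * R" for q
  proof -
    have "\<phi> q = \<phi> q * (X * R)" using \<phi>C[of q] R by simp
    also have "\<dots> = \<phi> q * X * R" using \<phi>C[of q] X R(1) by simp
    also have "\<dots> = X * \<beta> q * R" by (simp only: act')
    finally show ?thesis .
  qed
  then have "K = (\<lambda>B. X * B * R) ` range \<beta>" unfolding K by auto
  moreover have "inverts_mat R X" "inverts_mat X R"
    using R RX X by (auto simp: inverts_mat_def)
  ultimately show ?thesis
    using rm X R(1) \<beta> closed(1) unfolding similar_families_def by blast
qed

end

section \<open>Normal forms of the division algebras\<close>

lemma nonzero_vec_entry: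
  assumes "x \<in> carrier_vec r" "x \<noteq> 0\<^sub>v r"
  obtains i where "i < r" "x $ i \<noteq> 0"
  using assms by (auto simp: vec_eq_iff)

lemma sum_lessThan_1: "(\<Sum>s<1. f s) = f (0 :: nat)"
  and sum_lessThan_2: "(\<Sum>s<2. f s) = f 0 + f (1 :: nat)"
  and sum_lessThan_4: "(\<Sum>s<4. f s) = f 0 + f 1 + f 2 + f (3 :: nat)"
  by (simp_all add: eval_nat_numeral)

lemma less_2_cases: "(t :: nat) < 2 \<longleftrightarrow> t = 0 \<or> t = 1"
  and less_4_cases: "(t :: nat) < 4 \<longleftrightarrow> t = 0 \<or> t = 1 \<or> t = 2 \<or> t = 3"
  by auto

lemma complex_block_carrier: "complex_block z \<in> carrier_mat 2 2"
  by (intro carrier_matI) (simp_all add: complex_block_def mat_of_rows_list_def Let_def)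

lemma quat_real_block_carrier: "quat_real_block q \<in> carrier_mat 4 4"
  by (intro carrier_matI) (simp_all add: quat_real_block_def mat_of_rows_list_def Let_def)

lemma quat_complex_block_carrier: "quat_complex_block q \<in> carrier_mat 2 2"
  by (intro carrier_matI) (simp_all add: quat_complex_block_def mat_of_rows_list_def Let_def)

lemma complex_block_entries:
  "complex_block z $$ (0, 0) = Re z" "complex_block z $$ (0, 1) = - Im z"
  "complex_block z $$ (1, 0) = Im z" "complex_block z $$ (1, 1) = Re z"
  by (simp_all add: complex_block_def mat_of_rows_list_def Let_def)

lemma quat_complex_block_entries:
  "quat_complex_block q $$ (0, 0) = Complex (qRe q) (qI q)"
  "quat_complex_block q $$ (0, 1) = Complex (qJ q) (qK q)"
  "quat_complex_block q $$ (1, 0) = - cnj (Complex (qJ q) (qK q))"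
  "quat_complex_block q $$ (1, 1) = cnj (Complex (qRe q) (qI q))"
  by (simp_all add: quat_complex_block_def mat_of_rows_list_def Let_def)

lemma quat_real_block_entries:
  "quat_real_block q $$ (0, 0) = qRe q" "quat_real_block q $$ (0, 1) = - qI q"
  "quat_real_block q $$ (0, 2) = qJ q" "quat_real_block q $$ (0, 3) = - qK q"
  "quat_real_block q $$ (1, 0) = qI q" "quat_real_block q $$ (1, 1) = qRe q"
  "quat_real_block q $$ (1, 2) = qK q" "quat_real_block q $$ (1, 3) = qJ q"
  "quat_real_block q $$ (2, 0) = - qJ q" "quat_real_block q $$ (2, 1) = - qK q"
  "quat_real_block q $$ (2, 2) = qRe q" "quat_real_block q $$ (2, 3) = qI q"
  "quat_real_block q $$ (3, 0) = qK q" "quat_real_block q $$ (3, 1) = - qJ q"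
  "quat_real_block q $$ (3, 2) = - qI q" "quat_real_block q $$ (3, 3) = qRe q"
  by (simp_all add: quat_real_block_def mat_of_rows_list_def Let_def eval_nat_numeral)

lemma mult_mat_vec_twice:
  fixes u v w :: "'a :: real_div_algebra mat"
  assumes "u \<in> carrier_mat r r" "v \<in> carrier_mat r r" "x \<in> carrier_vec r" "u * v = w"
  shows "u *\<^sub>v (v *\<^sub>v x) = w *\<^sub>v x"
  using assms by (metis assoc_mult_mat_vec)

lemma uminus_one_mult_vec:
  assumes "x \<in> carrier_vec r"
  shows "(- 1\<^sub>m r :: 'a :: real_div_algebra mat) *\<^sub>v x = - x"
  using assms by (simp add: uminus_mult_mat_vec)

lemma mult_mat_uminus_vec:
  fixes u :: "'a :: real_div_algebra mat"
  assumes "u \<in> carrier_mat r r" "x \<in> carrier_vec r"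
  shows "u *\<^sub>v (- x) = - (u *\<^sub>v x)"
  using assms by (intro eq_vecI) (auto simp: scalar_prod_def sum_negf)

lemma quat_relations_vec:
  fixes u v :: "'a :: real_div_algebra mat"
  assumes uv: "u \<in> carrier_mat r r" "v \<in> carrier_mat r r"
    and "u * u = - 1\<^sub>m r" "v * v = - 1\<^sub>m r" "v * u = - (u * v)" and x: "x \<in> carrier_vec r"
  shows "u *\<^sub>v (u *\<^sub>v x) = - x" "v *\<^sub>v (v *\<^sub>v x) = - x" "v *\<^sub>v (u *\<^sub>v x) = - (u *\<^sub>v (v *\<^sub>v x))"
  using assms
  by (simp_all add: mult_mat_vec_twice[of u r u x "- 1\<^sub>m r"] mult_mat_vec_twice[of v r v x "- 1\<^sub>m r"]
      mult_mat_vec_twice[of v r u x "- (u * v)"] uminus_one_mult_vec uminus_mult_mat_vec)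

text \<open>The vector \<open>x = y s + u y\<close> satisfies \<open>u x = x s\<close>.  If it is zero, then \<open>u y = - y s\<close> instead.\<close>

lemma square_root_eigenvector:
  fixes u :: "'a :: real_div_algebra mat" and y :: "'a vec"
  assumes u: "u \<in> carrier_mat r r" "u * u = - 1\<^sub>m r" and y: "y \<in> carrier_vec r" "y \<noteq> 0\<^sub>v r"
    and s: "s * s = - 1"
  obtains x where "x \<in> carrier_vec r" "x \<noteq> 0\<^sub>v r" "u *\<^sub>v x = right_scale x s"
  | x where "x \<in> carrier_vec r" "x \<noteq> 0\<^sub>v r" "u *\<^sub>v x = right_scale x (- s)"
proof -
  have uy: "u *\<^sub>v y \<in> carrier_vec r" using u y by auto
  have uuy: "u *\<^sub>v (u *\<^sub>v y) = - y"
    using mult_mat_vec_twice[OF u(1,1) y(1) u(2)] uminus_one_mult_vec[OF y(1)] by simp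
  define x where "x = right_scale y s + u *\<^sub>v y"
  have x: "x \<in> carrier_vec r" using uy y by (simp add: x_def)
  have "u *\<^sub>v x = right_scale (u *\<^sub>v y) s + (- y)"
    using u(1) y(1) uy by (simp add: x_def mult_add_distrib_mat_vec[of _ r r]
        mult_mat_vec_right_scale[of _ r r] uuy)
  also have "\<dots> = right_scale x s"
    using y(1) uy u(1) s by (intro eq_vecI)
      (auto simp: x_def distrib_right mult.assoc simp del: index_mult_mat_vec)
  finally have ux: "u *\<^sub>v x = right_scale x s" .
  show thesis
  proof (cases "x = 0\<^sub>v r")
    case False
    then show ?thesis using that(1) x ux by blast
  next
    case True
    have "u *\<^sub>v y = right_scale y (- s)"
    proof (rule eq_vecI)
      fix i assume "i < dim_vec (right_scale y (- s))"
      then have i: "i < r" using y by simp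
      have "x $ i = 0" using True i by simp
      then have "y $ i * s + (u *\<^sub>v y) $ i = 0"
        using i y(1) u(1) by (simp add: x_def del: index_mult_mat_vec)
      then show "(u *\<^sub>v y) $ i = right_scale y (- s) $ i"
        using i y(1) by (simp add: eq_neg_iff_add_eq_0 add.commute del: index_mult_mat_vec)
    qed (use u y in auto)
    then show ?thesis using that(2) y by blast
  qed
qed

context division_matrix_algebra
begin

lemma similar_range_1:
  fixes \<phi> :: "'q \<Rightarrow> 'a mat" and f :: "'q \<Rightarrow> 'a"
  assumes K: "K = range \<phi>" and x: "x \<in> carrier_vec r" "x \<noteq> 0\<^sub>v r"
    and act: "\<And>q i. i < r \<Longrightarrow> (\<phi> q *\<^sub>v x) $ i = x $ i * f q"
  shows "r = 1 \<and> similar_families r K (range (\<lambda>q. mat 1 1 (\<lambda>_. f q)))"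
proof (rule similar_range[OF K, of "[x]" 1])
  fix c s assume "\<And>i. i < r \<Longrightarrow> (\<Sum>s<1. [x] ! s $ i * c s) = 0" "s < (1 :: nat)"
  moreover obtain i where "i < r" "x $ i \<noteq> 0" using nonzero_vec_entry[OF x] .
  ultimately show "c s = 0" by force
qed (use x act in \<open>auto simp: sum_lessThan_1\<close>)

lemma similar_scalars:
  assumes "K = range (\<lambda>a. scaleR_mat a (1\<^sub>m r))"
  shows "r = 1 \<and> similar_families r K (range (\<lambda>a. mat 1 1 (\<lambda>_. of_real a)))"
proof (rule similar_range_1[OF assms nonzero_vector])
  fix a i assume "i < r"
  then show "(scaleR_mat a (1\<^sub>m r) *\<^sub>v unit_vec r 0) $ i = unit_vec r 0 $ i * (of_real a :: 'a)"
    using scaleR_mat_mult_vec[of "1\<^sub>m r :: 'a mat" r r "unit_vec r 0" i a]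
    by (simp add: of_real_def)
qed

end

text \<open>Over the reals any nonzero \<open>x\<close> will do.  The basis \<open>x\<close>, \<open>u x\<close>, \<open>- v x\<close>, \<open>u v x\<close> owes its sign to
  the block that represents \<open>j\<close>, which sends the first basis vector to minus the third.\<close>

lemma real_division_matrix_algebra:
  fixes K :: "real mat set"
  assumes "division_matrix_algebra r K"
  shows "(r = 1 \<and> similar_families r K (range (\<lambda>a. mat 1 1 (\<lambda>_. a)))) \<or>
    (r = 2 \<and> similar_families r K (range complex_block)) \<or>
    (r = 4 \<and> similar_families r K (range quat_real_block))"
proof -
  interpret division_matrix_algebra r K by (rule assms)
  define x where "x = (unit_vec r 0 :: real vec)"
  have x: "x \<in> carrier_vec r" "x \<noteq> 0\<^sub>v r" unfolding x_def by (rule nonzero_vector)+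
  show ?thesis
  proof (rule member_cases[OF real_basis_real])
    assume "K = range (\<lambda>a. scaleR_mat a (1\<^sub>m r))"
    from similar_scalars[OF this] show ?thesis by auto
  next
    fix u assume u: "u \<in> K" "u * u = - 1\<^sub>m r" and K: "K = range (complex_comb u)"
    have uC: "u \<in> carrier_mat r r" using u closed by blast
    have ux: "u *\<^sub>v x \<in> carrier_vec r" using uC x by auto
    have uux: "u *\<^sub>v (u *\<^sub>v x) = - x"
      using mult_mat_vec_twice[OF uC uC x(1) u(2)] uminus_one_mult_vec[OF x(1)] by simp
    have "r = 2 \<and> similar_families r K (range complex_block)"
    proof (rule similar_range[OF K, of "[x, u *\<^sub>v x]" 2])
      fix c :: "nat \<Rightarrow> real" and s :: nat
      assume z: "\<And>i. i < r \<Longrightarrow> (\<Sum>s<2. [x, u *\<^sub>v x] ! s $ i * c s) = 0" and "s < 2"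
      have "complex_comb u (Complex (c 0) (c 1)) *\<^sub>v x = 0\<^sub>v r"
        using z uC x(1) carrier_matD[OF complex_comb_carrier[OF uC]] by (intro eq_vecI)
          (auto simp: complex_comb_mult_vec sum_lessThan_2 mult.commute simp del: index_mult_mat_vec)
      then have "complex_comb u (Complex (c 0) (c 1)) = 0\<^sub>m r r"
        using annihilates_vector x K by blast
      then have "Complex (c 0) (c 1) = 0" using complex_comb_eq_0[OF pos uC u(2)] by blast
      then show "c s = 0" using \<open>s < 2\<close> by (auto simp: less_2_cases complex_eq_iff)
    next
      fix q t i assume "t < (2 :: nat)" "i < r"
      then show "(complex_comb u q *\<^sub>v [x, u *\<^sub>v x] ! t) $ i =
          (\<Sum>s<2. [x, u *\<^sub>v x] ! s $ i * complex_block q $$ (s, t))"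
        using uC x ux
        by (auto simp: less_2_cases sum_lessThan_2 complex_comb_mult_vec complex_block_entries uux
            mult.commute simp del: index_mult_mat_vec One_nat_def)
    qed (use x ux complex_block_carrier in auto)
    then show ?thesis by blast
  next
    fix u v assume u: "u \<in> K" "v \<in> K" "u * u = - 1\<^sub>m r" "v * v = - 1\<^sub>m r" "v * u = - (u * v)"
      and K: "K = range (quat_comb u v)"
    have uC: "u \<in> carrier_mat r r" and vC: "v \<in> carrier_mat r r" using u closed by blast+
    note rel = quat_relations_vec[OF uC vC u(3,4,5)]
    have C: "u *\<^sub>v y \<in> carrier_vec r" "v *\<^sub>v y \<in> carrier_vec r" if "y \<in> carrier_vec r" for y
      using uC vC that by auto
    let ?xs = "[x, u *\<^sub>v x, - (v *\<^sub>v x), u *\<^sub>v (v *\<^sub>v x)]"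
    have "r = 4 \<and> similar_families r K (range quat_real_block)"
    proof (rule similar_range[OF K, of ?xs 4])
      fix c :: "nat \<Rightarrow> real" and s :: nat
      assume z: "\<And>i. i < r \<Longrightarrow> (\<Sum>s<4. ?xs ! s $ i * c s) = 0" and "s < 4"
      have "quat_comb u v (Quat (c 0) (c 1) (- c 2) (c 3)) *\<^sub>v x = 0\<^sub>v r"
      proof (rule eq_vecI)
        fix i assume "i < dim_vec (0\<^sub>v r :: real vec)"
        then have i: "i < r" by simp
        have "(quat_comb u v (Quat (c 0) (c 1) (- c 2) (c 3)) *\<^sub>v x) $ i = (\<Sum>s<4. ?xs ! s $ i * c s)"
          using uC vC x(1) C i
          by (simp add: quat_comb_mult_vec sum_lessThan_4 mult.commute del: index_mult_mat_vec)
        then show "(quat_comb u v (Quat (c 0) (c 1) (- c 2) (c 3)) *\<^sub>v x) $ i = 0\<^sub>v r $ i"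
          using z i by simp
      qed (use carrier_matD[OF quat_comb_carrier[OF uC vC]] in simp)
      then have "quat_comb u v (Quat (c 0) (c 1) (- c 2) (c 3)) = 0\<^sub>m r r"
        using annihilates_vector x K by blast
      then have "Quat (c 0) (c 1) (- c 2) (c 3) = 0" using quat_comb_eq_0[OF pos uC vC u(3,4,5)] by blast
      then show "c s = 0" using \<open>s < 4\<close> by (auto simp: less_4_cases zero_quat_def)
    next
      fix q t i assume "t < (4 :: nat)" "i < r"
      then show "(quat_comb u v q *\<^sub>v ?xs ! t) $ i = (\<Sum>s<4. ?xs ! s $ i * quat_real_block q $$ (s, t))"
        using uC vC x C carrier_matD[OF quat_comb_carrier[OF uC vC]]
        by (auto simp: less_4_cases sum_lessThan_4 quat_comb_mult_vec quat_real_block_entries rel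
            mult_mat_uminus_vec[of _ r] mult.commute simp del: index_mult_mat_vec One_nat_def)
    qed (use x C quat_real_block_carrier in auto)
    then show ?thesis by blast
  qed
qed

text \<open>Over the complex numbers \<open>x\<close> is an eigenvector of \<open>u\<close>.  When the corner is two-dimensional over \<open>\<real>\<close>, it
  acts on \<open>x\<close> through all complex scalars, whichever of \<open>\<i>\<close> and \<open>- \<i>\<close> is the eigenvalue.  In the
  quaternionic case \<open>v\<close> interchanges the two eigenspaces of \<open>u\<close>, so the eigenvalue \<open>\<i>\<close> can be
  achieved, and \<open>x\<close>, \<open>- v x\<close> is a basis.\<close>

lemma complex_division_matrix_algebra:
  fixes K :: "complex mat set"
  assumes "division_matrix_algebra r K"
  shows "(r = 1 \<and> similar_families r K (range (\<lambda>a. mat 1 1 (\<lambda>_. complex_of_real a)))) \<or>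
    (r = 1 \<and> similar_families r K (range (\<lambda>z. mat 1 1 (\<lambda>_. z)))) \<or>
    (r = 2 \<and> similar_families r K (range quat_complex_block))"
proof -
  interpret division_matrix_algebra r K by (rule assms)
  note y = nonzero_vector
  have ii: "\<i> * \<i> = - 1" by simp
  show ?thesis
  proof (rule member_cases[OF real_basis_complex])
    assume "K = range (\<lambda>a. scaleR_mat a (1\<^sub>m r))"
    from similar_scalars[OF this] show ?thesis by auto
  next
    fix u assume u: "u \<in> K" "u * u = - 1\<^sub>m r" and K: "K = range (complex_comb u)"
    have uC: "u \<in> carrier_mat r r" using u closed by blast
    obtain x s where x: "x \<in> carrier_vec r" "x \<noteq> 0\<^sub>v r" "u *\<^sub>v x = right_scale x s"
      and s: "s = \<i> \<or> s = - \<i>"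
      using square_root_eigenvector[OF uC u(2) y ii] by metis
    have act: "(complex_comb u q *\<^sub>v x) $ i = x $ i * (Re q + Im q * s)" if "i < r" for q i
    proof -
      have "(complex_comb u q *\<^sub>v x) $ i = Re q *\<^sub>R x $ i + Im q *\<^sub>R (x $ i * s)"
        using that uC x by (simp add: complex_comb_mult_vec del: index_mult_mat_vec)
      then show ?thesis by (simp add: scaleR_conv_of_real algebra_simps)
    qed
    have "z = Re z' + Im z' * s" if "z' = (if s = \<i> then z else cnj z)" for z z'
      using s that by (auto simp: complex_eq_iff)
    then have "range (\<lambda>q. mat 1 1 (\<lambda>_. Re q + Im q * s)) = range (\<lambda>z. mat 1 1 (\<lambda>_. z))"
      by (auto simp: image_iff) metis
    with similar_range_1[OF K x(1,2) act] show ?thesis by auto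
  next
    fix u v assume u: "u \<in> K" "v \<in> K" "u * u = - 1\<^sub>m r" "v * v = - 1\<^sub>m r" "v * u = - (u * v)"
      and K: "K = range (quat_comb u v)"
    have uC: "u \<in> carrier_mat r r" and vC: "v \<in> carrier_mat r r" using u closed by blast+
    note rel = quat_relations_vec[OF uC vC u(3,4,5)]
    have C: "u *\<^sub>v y \<in> carrier_vec r" "v *\<^sub>v y \<in> carrier_vec r" if "y \<in> carrier_vec r" for y
      using uC vC that by auto
    obtain x where x: "x \<in> carrier_vec r" "x \<noteq> 0\<^sub>v r" and ux: "u *\<^sub>v x = right_scale x \<i>"
    proof (rule square_root_eigenvector[OF uC u(3) y ii])
      fix x assume x: "x \<in> carrier_vec r" "x \<noteq> 0\<^sub>v r" "u *\<^sub>v x = right_scale x (- \<i>)"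
      have "u *\<^sub>v (v *\<^sub>v x) = - (v *\<^sub>v right_scale x (- \<i>))"
        using rel(3)[OF x(1)] x(3) by simp
      also have "\<dots> = right_scale (v *\<^sub>v x) \<i>"
        using vC x(1) by (subst mult_mat_vec_right_scale[OF vC x(1)]) (auto intro!: eq_vecI)
      finally have "u *\<^sub>v (v *\<^sub>v x) = right_scale (v *\<^sub>v x) \<i>" .
      moreover have "v *\<^sub>v x \<noteq> 0\<^sub>v r"
      proof
        assume "v *\<^sub>v x = 0\<^sub>v r"
        then have "- x = v *\<^sub>v 0\<^sub>v r" using rel(2)[OF x(1)] by simp
        also have "\<dots> = 0\<^sub>v r" using vC by (auto simp: scalar_prod_def)
        finally show False using x by (auto simp: vec_eq_iff)
      qed
      ultimately show thesis using that C x by blast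
    qed (use that in blast)
    define w where "w = v *\<^sub>v x"
    have w: "w \<in> carrier_vec r" using C x by (simp add: w_def)
    have vw: "v *\<^sub>v w = - x" using rel x by (simp add: w_def)
    have uw: "u *\<^sub>v w = right_scale w (- \<i>)"
    proof -
      have "v *\<^sub>v right_scale x \<i> = - (u *\<^sub>v w)" using rel(3)[OF x(1)] ux by (simp add: w_def)
      then have "u *\<^sub>v w = - (right_scale w \<i>)"
        using mult_mat_vec_right_scale[OF vC x(1)] uminus_uminus_vec by (metis w_def)
      then show ?thesis using w by (auto intro!: eq_vecI)
    qed
    have "r = 2 \<and> similar_families r K (range quat_complex_block)"
    proof (rule similar_range[OF K, of "[x, - w]" 2])
      fix c :: "nat \<Rightarrow> complex" and s :: nat
      assume z: "\<And>i. i < r \<Longrightarrow> (\<Sum>s<2. [x, - w] ! s $ i * c s) = 0" and "s < 2"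
      have eq: "x $ i * c 0 = w $ i * c 1" if "i < r" for i
        using z[OF that] w that by (simp add: sum_lessThan_2)
      \<comment> \<open>\<open>x\<close> and \<open>w\<close> are eigenvectors of \<open>u\<close> for different eigenvalues.\<close>
      have veq: "right_scale x (c 0) = right_scale w (c 1)"
        using eq x w by (intro eq_vecI) auto
      have "right_scale (right_scale x \<i>) (c 0) = right_scale (right_scale w (- \<i>)) (c 1)"
        using arg_cong[OF veq, of "\<lambda>y. u *\<^sub>v y"] mult_mat_vec_right_scale[OF uC x(1)]
          mult_mat_vec_right_scale[OF uC w] ux uw by metis
      then have eq': "x $ i * \<i> * c 0 = w $ i * (- \<i>) * c 1" if "i < r" for i
        using that x w by (metis (no_types, lifting) carrier_vecD index_map_vec)
      have "w $ i * c 1 = 0" "x $ i * c 0 = 0" if "i < r" for i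
      proof -
        have "\<i> * (w $ i * c 1) = - (\<i> * (w $ i * c 1))"
          using eq'[OF that] eq[OF that] by (metis minus_mult_commute minus_mult_left mult.assoc mult.commute)
        then show "w $ i * c 1 = 0" by simp
        then show "x $ i * c 0 = 0" using eq[OF that] by simp
      qed
      moreover obtain i where i: "i < r" "x $ i \<noteq> 0" using nonzero_vec_entry[OF x] .
      ultimately have "c 0 = 0" by auto
      have "w \<noteq> 0\<^sub>v r"
      proof
        assume "w = 0\<^sub>v r"
        then have "- x = v *\<^sub>v 0\<^sub>v r" using vw by simp
        also have "\<dots> = 0\<^sub>v r" using vC by (auto simp: scalar_prod_def)
        finally show False using x by (auto simp: vec_eq_iff)
      qed
      then obtain i where i: "i < r" "w $ i \<noteq> 0" using nonzero_vec_entry[OF w] by blast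
      then have "c 1 = 0" using \<open>\<And>i. i < r \<Longrightarrow> w $ i * c 1 = 0\<close> by auto
      with \<open>c 0 = 0\<close> \<open>s < 2\<close> show "c s = 0" by (auto simp: less_2_cases)
    next
      fix q t i assume t: "t < (2 :: nat)" and i: "i < r"
      have q0: "(quat_comb u v q *\<^sub>v x) $ i =
          x $ i * Complex (qRe q) (qI q) + - w $ i * (- cnj (Complex (qJ q) (qK q)))"
        using uC vC x w i
        by (simp add: quat_comb_mult_vec ux uw flip: w_def del: index_mult_mat_vec)
          (simp add: complex_eq_iff algebra_simps)
      have q1: "(quat_comb u v q *\<^sub>v (- w)) $ i =
          x $ i * Complex (qJ q) (qK q) + - w $ i * cnj (Complex (qRe q) (qI q))"
        using uC vC x w i carrier_matD[OF quat_comb_carrier[OF uC vC]]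
        by (simp add: quat_comb_mult_vec mult_mat_uminus_vec[of _ r] ux uw vw del: index_mult_mat_vec)
          (simp add: complex_eq_iff algebra_simps)
      show "(quat_comb u v q *\<^sub>v [x, - w] ! t) $ i =
          (\<Sum>s<2. [x, - w] ! s $ i * quat_complex_block q $$ (s, t))"
        using t i w q0 q1
        by (auto simp: less_2_cases sum_lessThan_2 quat_complex_block_entries
            simp del: index_mult_mat_vec One_nat_def)
    qed (use x w quat_complex_block_carrier in auto)
    then show ?thesis by blast
  qed
qed

text \<open>Over the quaternions, right multiplication can imitate \<open>u\<close> and \<open>v\<close> completely: there is an \<open>x\<close> with
  \<open>u x = x i\<close> and, if \<open>v\<close> is present, \<open>v x = x j\<close>.  Such an \<open>x\<close> spans the space.\<close>

lemma quat_division_matrix_algebra: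
  fixes K :: "quat mat set"
  assumes "division_matrix_algebra r K"
  shows "r = 1 \<and> (similar_families r K (range (\<lambda>a. mat 1 1 (\<lambda>_. of_real a))) \<or>
    similar_families r K (range (\<lambda>z. mat 1 1 (\<lambda>_. quat_of_complex z))) \<or>
    similar_families r K (range (\<lambda>q. mat 1 1 (\<lambda>_. q))))"
proof -
  interpret division_matrix_algebra r K by (rule assms)
  note y = nonzero_vector
  define i j k where "i = Quat 0 1 0 0" and "j = Quat 0 0 1 0" and "k = Quat 0 0 0 1"
  have ijk: "i * i = - 1" "j * j = - 1" "i * j = k" "j * i = - k"
    by (simp_all add: i_def j_def k_def quat_arith_defs)
  have comb: "Quat a b c d = a *\<^sub>R 1 + b *\<^sub>R i + c *\<^sub>R j + d *\<^sub>R k" for a b c d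
    by (simp add: i_def j_def k_def quat_arith_defs)
  have scale_scale: "right_scale (right_scale x c) d = right_scale x (c * d)" for x :: "quat vec" and c d
    by (auto intro!: eq_vecI simp: mult.assoc)
  have scale_nz: "right_scale x c \<noteq> 0\<^sub>v r" if x: "x \<in> carrier_vec r" "x \<noteq> 0\<^sub>v r" and "c \<noteq> 0" for x :: "quat vec" and c
  proof -
    obtain l where "l < r" "x $ l \<noteq> 0" using nonzero_vec_entry[OF x] .
    then show ?thesis using x(1) \<open>c \<noteq> 0\<close> by (auto simp: vec_eq_iff intro!: exI[of _ l])
  qed
  have nz: "i \<noteq> 0" "j \<noteq> 0" by (simp_all add: i_def j_def zero_quat_def)
  \<comment> \<open>An eigenvector for \<open>- i\<close>, multiplied by \<open>j\<close>, becomes one for \<open>i\<close>.\<close>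
  have eigen: "\<exists>x. x \<in> carrier_vec r \<and> x \<noteq> 0\<^sub>v r \<and> u *\<^sub>v x = right_scale x i"
    if u: "u \<in> carrier_mat r r" "u * u = - 1\<^sub>m r" for u
  proof (rule square_root_eigenvector[OF u y ijk(1)])
    fix x assume x: "x \<in> carrier_vec r" "x \<noteq> 0\<^sub>v r" "u *\<^sub>v x = right_scale x (- i)"
    have "u *\<^sub>v right_scale x j = right_scale (right_scale x j) i"
      unfolding mult_mat_vec_right_scale[OF u(1) x(1)] x(3) scale_scale
      by (simp add: ijk)
    then show ?thesis using scale_nz[OF x(1,2) nz(2)] x(1) by (intro exI[of _ "right_scale x j"]) simp
  qed blast
  show ?thesis
  proof (rule member_cases[OF real_basis_quat])
    assume "K = range (\<lambda>a. scaleR_mat a (1\<^sub>m r))"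
    from similar_scalars[OF this] show ?thesis by auto
  next
    fix u assume u: "u \<in> K" "u * u = - 1\<^sub>m r" and K: "K = range (complex_comb u)"
    have uC: "u \<in> carrier_mat r r" using u closed by blast
    obtain x where x: "x \<in> carrier_vec r" "x \<noteq> 0\<^sub>v r" "u *\<^sub>v x = right_scale x i"
      using eigen[OF uC u(2)] by blast
    have "(complex_comb u z *\<^sub>v x) $ l = x $ l * quat_of_complex z" if "l < r" for z l
      using that uC x
      by (simp add: complex_comb_mult_vec quat_of_complex_def comb distrib_left del: index_mult_mat_vec)
    from similar_range_1[OF K x(1,2) this] show ?thesis by auto
  next
    fix u v assume u: "u \<in> K" "v \<in> K" "u * u = - 1\<^sub>m r" "v * v = - 1\<^sub>m r" "v * u = - (u * v)"
      and K: "K = range (quat_comb u v)"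
    have uC: "u \<in> carrier_mat r r" and vC: "v \<in> carrier_mat r r" using u closed by blast+
    note rel = quat_relations_vec[OF uC vC u(3,4,5)]
    obtain y where y: "y \<in> carrier_vec r" "y \<noteq> 0\<^sub>v r" "u *\<^sub>v y = right_scale y i"
      using eigen[OF uC u(3)] by blast
    have vy: "v *\<^sub>v y \<in> carrier_vec r" using vC y by auto
    have uvy: "u *\<^sub>v (v *\<^sub>v y) = right_scale (v *\<^sub>v y) (- i)"
    proof -
      have "right_scale (v *\<^sub>v y) i = - (u *\<^sub>v (v *\<^sub>v y))"
        using rel(3)[OF y(1)] y(3) mult_mat_vec_right_scale[OF vC y(1)] by simp
      then have "u *\<^sub>v (v *\<^sub>v y) = - right_scale (v *\<^sub>v y) i" by (metis uminus_uminus_vec)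
      then show ?thesis using vy by (auto intro!: eq_vecI)
    qed
    obtain x where x: "x \<in> carrier_vec r" "x \<noteq> 0\<^sub>v r" "u *\<^sub>v x = right_scale x i" "v *\<^sub>v x = right_scale x j"
    proof -
      \<comment> \<open>The map \<open>y \<mapsto> - v y j\<close> is an involution of the eigenspace of \<open>u\<close> for \<open>i\<close>;
        \<open>x\<close> is the projection of \<open>y\<close> to its fixed space.\<close>
      define x where "x = y + right_scale (v *\<^sub>v y) (- j)"
      have xC: "x \<in> carrier_vec r" using y vy by (simp add: x_def)
      have "u *\<^sub>v x = u *\<^sub>v y + u *\<^sub>v right_scale (v *\<^sub>v y) (- j)"
        unfolding x_def using vy by (intro mult_add_distrib_mat_vec[OF uC y(1)]) simp
      also have "\<dots> = right_scale y i + right_scale (v *\<^sub>v y) (- i * - j)"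
        by (simp only: mult_mat_vec_right_scale[OF uC vy] uvy y(3) scale_scale)
      also have "\<dots> = right_scale x i"
        using y(1) vy carrier_matD[OF vC]
        by (intro eq_vecI) (auto simp: x_def left_diff_distrib mult.assoc ijk simp del: index_mult_mat_vec)
      finally have ux: "u *\<^sub>v x = right_scale x i" .
      have "v *\<^sub>v x = v *\<^sub>v y + v *\<^sub>v right_scale (v *\<^sub>v y) (- j)"
        unfolding x_def using vy by (intro mult_add_distrib_mat_vec[OF vC y(1)]) simp
      also have "\<dots> = v *\<^sub>v y + right_scale (- y) (- j)"
        by (simp only: mult_mat_vec_right_scale[OF vC vy] rel(2)[OF y(1)])
      also have "\<dots> = right_scale x j"
        using y(1) vy carrier_matD[OF vC]
        by (intro eq_vecI) (auto simp: x_def left_diff_distrib mult.assoc ijk simp del: index_mult_mat_vec)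
      finally have vx: "v *\<^sub>v x = right_scale x j" .
      show thesis
      proof (cases "x = 0\<^sub>v r")
        case False
        then show ?thesis using that xC ux vx by blast
      next
        case True
        have "v *\<^sub>v y = right_scale y (- j)"
        proof (rule eq_vecI)
          fix l assume "l < dim_vec (right_scale y (- j))"
          then have l: "l < r" using y by simp
          have "x $ l = 0" using True l by simp
          then have "y $ l = (v *\<^sub>v y) $ l * j"
            using l y(1) vy vC by (simp add: x_def del: index_mult_mat_vec)
          then have "y $ l * - j = (v *\<^sub>v y) $ l * (j * - j)" by (simp add: mult.assoc)
          then show "(v *\<^sub>v y) $ l = right_scale y (- j) $ l"
            using l y(1) by (simp add: ijk del: index_mult_mat_vec)
        qed (use vC y in auto)
        moreover have "- j * i = i * j" by (simp add: ijk)
        ultimately have "v *\<^sub>v right_scale y i = right_scale (right_scale y i) j"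
          by (simp only: mult_mat_vec_right_scale[OF vC y(1)] scale_scale)
        moreover have "u *\<^sub>v right_scale y i = right_scale (right_scale y i) i"
          unfolding mult_mat_vec_right_scale[OF uC y(1)] y(3) ..
        ultimately show ?thesis using that[of "right_scale y i"] scale_nz[OF y(1,2) nz(1)] y(1) by simp
      qed
    qed
    have uvx: "u *\<^sub>v right_scale x j = right_scale x k"
      unfolding mult_mat_vec_right_scale[OF uC x(1)] x(3) by (simp add: scale_scale ijk)
    have "(quat_comb u v q *\<^sub>v x) $ l = x $ l * q" if "l < r" for q l
    proof -
      have "(quat_comb u v q *\<^sub>v x) $ l =
          x $ l * (qRe q *\<^sub>R 1 + qI q *\<^sub>R i + qJ q *\<^sub>R j + qK q *\<^sub>R k)"
        using that uC vC x
        by (simp add: quat_comb_mult_vec uvx distrib_left del: index_mult_mat_vec)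
      then show ?thesis unfolding comb[symmetric] by simp
    qed
    from similar_range_1[OF K x(1,2) this] show ?thesis by auto
  qed
qed

section \<open>Sums and blocks of matrices\<close>

lemma mat_assoc:
  fixes A B C :: "'a :: semiring_0 mat"
  assumes "dim_col A = dim_row B" "dim_col B = dim_row C"
  shows "A * B * C = A * (B * C)"
  using assms by (intro assoc_mult_mat[of A "dim_row A" "dim_col A" B "dim_col B" C "dim_col C"]) auto

text \<open>Matrices of arbitrary sizes do not form a monoid, so the size of the result is a parameter.\<close>

definition mat_sum :: "nat \<Rightarrow> nat \<Rightarrow> nat \<Rightarrow> (nat \<Rightarrow> 'a :: comm_monoid_add mat) \<Rightarrow> 'a mat" where
  "mat_sum n m k f = mat n m (\<lambda>ij. \<Sum>l<k. f l $$ ij)"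

lemma mat_sum_carrier [simp]: "mat_sum n m k f \<in> carrier_mat n m"
  by (simp add: mat_sum_def)

lemma mat_sum_closed:
  assumes "0\<^sub>m n m \<in> S" "\<And>a b. a \<in> S \<Longrightarrow> b \<in> S \<Longrightarrow> a + b \<in> S" "S \<subseteq> carrier_mat n m"
    and "\<And>l. l < k \<Longrightarrow> f l \<in> S"
  shows "mat_sum n m k f \<in> S"
  using assms(4)
proof (induction k)
  case 0
  have "mat_sum n m 0 f = 0\<^sub>m n m" by (auto simp: mat_sum_def)
  then show ?case using assms(1) by simp
next
  case (Suc k)
  have "mat_sum n m (Suc k) f = mat_sum n m k f + f k"
    using Suc.prems[of k] assms(3) by (intro eq_matI) (auto simp: mat_sum_def)
  then show ?case using Suc assms(2) by simp
qed

lemma mat_sum_cong: "(\<And>l. l < k \<Longrightarrow> f l = g l) \<Longrightarrow> mat_sum n m k f = mat_sum n m k g"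
  by (auto simp: mat_sum_def)

lemma mat_sum_mult_right:
  fixes M :: "'a :: ring mat"
  assumes "M \<in> carrier_mat m p" "\<And>l. l < k \<Longrightarrow> f l \<in> carrier_mat n m"
  shows "mat_sum n m k f * M = mat_sum n p k (\<lambda>l. f l * M)"
proof (rule eq_matI)
  fix i j assume "i < dim_row (mat_sum n p k (\<lambda>l. f l * M))" "j < dim_col (mat_sum n p k (\<lambda>l. f l * M))"
  then have ij: "i < n" "j < p" by (auto simp: mat_sum_def)
  have f: "(f l * M) $$ (i, j) = (\<Sum>s<m. f l $$ (i, s) * M $$ (s, j))" if "l < k" for l
    using carrier_matD[OF assms(2)[OF that]] assms(1) ij by (simp add: scalar_prod_def lessThan_atLeast0)
  have "(mat_sum n m k f * M) $$ (i, j) = (\<Sum>s<m. (\<Sum>l<k. f l $$ (i, s)) * M $$ (s, j))"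
    using ij assms(1) by (simp add: mat_sum_def scalar_prod_def lessThan_atLeast0)
  also have "\<dots> = (\<Sum>l<k. \<Sum>s<m. f l $$ (i, s) * M $$ (s, j))"
    unfolding sum_distrib_right by (rule sum.swap)
  finally show "(mat_sum n m k f * M) $$ (i, j) = mat_sum n p k (\<lambda>l. f l * M) $$ (i, j)"
    using ij f by (simp add: mat_sum_def)
qed (use assms in \<open>auto simp: mat_sum_def\<close>)

lemma mat_sum_mult_left:
  fixes M :: "'a :: ring mat"
  assumes "M \<in> carrier_mat p n" "\<And>l. l < k \<Longrightarrow> f l \<in> carrier_mat n m"
  shows "M * mat_sum n m k f = mat_sum p m k (\<lambda>l. M * f l)"
proof (rule eq_matI)
  fix i j assume "i < dim_row (mat_sum p m k (\<lambda>l. M * f l))" "j < dim_col (mat_sum p m k (\<lambda>l. M * f l))"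
  then have ij: "i < p" "j < m" by (auto simp: mat_sum_def)
  have f: "(M * f l) $$ (i, j) = (\<Sum>s<n. M $$ (i, s) * f l $$ (s, j))" if "l < k" for l
    using carrier_matD[OF assms(2)[OF that]] assms(1) ij by (simp add: scalar_prod_def lessThan_atLeast0)
  have "(M * mat_sum n m k f) $$ (i, j) = (\<Sum>s<n. M $$ (i, s) * (\<Sum>l<k. f l $$ (s, j)))"
    using ij assms(1) by (simp add: mat_sum_def scalar_prod_def lessThan_atLeast0)
  also have "\<dots> = (\<Sum>l<k. \<Sum>s<n. M $$ (i, s) * f l $$ (s, j))"
    unfolding sum_distrib_left by (rule sum.swap)
  finally show "(M * mat_sum n m k f) $$ (i, j) = mat_sum p m k (\<lambda>l. M * f l) $$ (i, j)"
    using ij f by (simp add: mat_sum_def)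
qed (use assms in \<open>auto simp: mat_sum_def\<close>)

lemma mat_sum_delta:
  assumes "j < k" "f j \<in> carrier_mat n m" "\<And>l. l < k \<Longrightarrow> l \<noteq> j \<Longrightarrow> f l = 0\<^sub>m n m"
  shows "mat_sum n m k f = f j"
proof (rule eq_matI)
  fix i l assume il: "i < dim_row (f j)" "l < dim_col (f j)"
  have "(\<Sum>a<k. f a $$ (i, l)) = (\<Sum>a<k. if a = j then f j $$ (i, l) else 0)"
    using il assms(2) by (intro sum.cong) (auto simp: assms(3))
  then show "mat_sum n m k f $$ (i, l) = f j $$ (i, l)"
    using il assms(1,2) by (simp add: mat_sum_def)
qed (use assms(2) in \<open>auto simp: mat_sum_def\<close>)

definition block_row :: "nat \<Rightarrow> nat \<Rightarrow> nat \<Rightarrow> (nat \<Rightarrow> 'a mat) \<Rightarrow> 'a mat" where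
  "block_row n r k f = mat n (r * k) (\<lambda>(i, j). f (j div r) $$ (i, j mod r))"

definition block_col :: "nat \<Rightarrow> nat \<Rightarrow> nat \<Rightarrow> (nat \<Rightarrow> 'a mat) \<Rightarrow> 'a mat" where
  "block_col n r k f = mat (r * k) n (\<lambda>(i, j). f (i div r) $$ (i mod r, j))"

definition block_square :: "nat \<Rightarrow> nat \<Rightarrow> (nat \<Rightarrow> nat \<Rightarrow> 'a mat) \<Rightarrow> 'a mat" where
  "block_square r k f = mat (r * k) (r * k) (\<lambda>(i, j). f (i div r) (j div r) $$ (i mod r, j mod r))"

lemma block_carriers [simp]:
  "block_row n r k f \<in> carrier_mat n (r * k)" "block_col n r k f \<in> carrier_mat (r * k) n"
  "block_square r k g \<in> carrier_mat (r * k) (r * k)"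
  by (simp_all add: block_row_def block_col_def block_square_def)

lemma block_index: "(i :: nat) < r * k \<Longrightarrow> i div r < k \<and> i mod r < r"
proof
  assume i: "i < r * k"
  then show "i div r < k" by (simp add: less_mult_imp_div_less mult.commute)
  have "r > 0" using i by (cases r) auto
  then show "i mod r < r" by simp
qed

lemma block_square_cong:
  "(\<And>i j. i < k \<Longrightarrow> j < k \<Longrightarrow> f i j = g i j) \<Longrightarrow> block_square r k f = block_square r k g"
  by (auto simp: block_square_def block_index)

lemma block_subst_block_square:
  assumes "M \<in> carrier_mat k k"
  shows "block_subst r \<beta> M = block_square r k (\<lambda>i j. \<beta> (M $$ (i, j)))"
  using assms by (auto simp: block_subst_def block_square_def)

lemma block_square_one:
  "block_square r k (\<lambda>i j. if i = j then 1\<^sub>m r else 0\<^sub>m r r) = 1\<^sub>m (r * k)"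
proof (rule eq_matI)
  fix i j assume "i < dim_row (1\<^sub>m (r * k) :: 'a mat)" "j < dim_col (1\<^sub>m (r * k) :: 'a mat)"
  then have ij: "i < r * k" "j < r * k" by auto
  have "i = j" if "i div r = j div r" "i mod r = j mod r" using that by (metis div_mult_mod_eq)
  then show "block_square r k (\<lambda>i j. if i = j then 1\<^sub>m r else 0\<^sub>m r r) $$ (i, j) =
      (1\<^sub>m (r * k) :: 'a mat) $$ (i, j)"
    using ij block_index[OF ij(1)] block_index[OF ij(2)] by (auto simp: block_square_def)
qed (auto simp: block_square_def)

lemma mult_block_row:
  fixes M :: "'a :: ring mat"
  assumes "M \<in> carrier_mat p n" "\<And>j. j < k \<Longrightarrow> f j \<in> carrier_mat n r"
  shows "M * block_row n r k f = block_row p r k (\<lambda>j. M * f j)"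
proof (rule eq_matI)
  fix i j assume "i < dim_row (block_row p r k (\<lambda>j. M * f j))"
    "j < dim_col (block_row p r k (\<lambda>j. M * f j))"
  then have ij: "i < p" "j < r * k" by (auto simp: block_row_def)
  show "(M * block_row n r k f) $$ (i, j) = block_row p r k (\<lambda>j. M * f j) $$ (i, j)"
    using ij block_index[OF ij(2)] assms(1) carrier_matD[OF assms(2), of "j div r"]
    by (simp add: block_row_def scalar_prod_def)
qed (use assms in \<open>auto simp: block_row_def\<close>)

lemma block_col_mult_block_row:
  fixes f g :: "nat \<Rightarrow> 'a :: ring mat"
  assumes "\<And>i. i < k \<Longrightarrow> f i \<in> carrier_mat r n" "\<And>j. j < k \<Longrightarrow> g j \<in> carrier_mat n r"
  shows "block_col n r k f * block_row n r k g = block_square r k (\<lambda>i j. f i * g j)"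
proof (rule eq_matI)
  fix i j assume "i < dim_row (block_square r k (\<lambda>i j. f i * g j))"
    "j < dim_col (block_square r k (\<lambda>i j. f i * g j))"
  then have ij: "i < r * k" "j < r * k" by (auto simp: block_square_def)
  show "(block_col n r k f * block_row n r k g) $$ (i, j) = block_square r k (\<lambda>i j. f i * g j) $$ (i, j)"
    using ij block_index[OF ij(1)] block_index[OF ij(2)]
      carrier_matD[OF assms(1), of "i div r"] carrier_matD[OF assms(2), of "j div r"]
    by (simp add: block_row_def block_col_def block_square_def scalar_prod_def)
qed (auto simp: block_row_def block_col_def block_square_def)

lemma block_row_mult_block_col:
  fixes f g :: "nat \<Rightarrow> 'a :: ring mat"
  assumes "\<And>i. i < k \<Longrightarrow> f i \<in> carrier_mat n r" "\<And>j. j < k \<Longrightarrow> g j \<in> carrier_mat r m"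
  shows "block_row n r k f * block_col m r k g = mat_sum n m k (\<lambda>i. f i * g i)"
proof (rule eq_matI)
  fix i j assume "i < dim_row (mat_sum n m k (\<lambda>i. f i * g i))" "j < dim_col (mat_sum n m k (\<lambda>i. f i * g i))"
  then have ij: "i < n" "j < m" by (auto simp: mat_sum_def)
  have "(block_row n r k f * block_col m r k g) $$ (i, j) =
      (\<Sum>c<k * r. f (c div r) $$ (i, c mod r) * g (c div r) $$ (c mod r, j))"
    using ij by (simp add: block_row_def block_col_def scalar_prod_def lessThan_atLeast0 mult.commute)
  also have "\<dots> = (\<Sum>l<k. \<Sum>s<r. f l $$ (i, s) * g l $$ (s, j))"
    unfolding sum_blocks by (intro sum.cong refl) auto
  also have "\<dots> = (\<Sum>l<k. (f l * g l) $$ (i, j))"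
  proof (rule sum.cong)
    fix l assume "l \<in> {..<k}"
    then show "(\<Sum>s<r. f l $$ (i, s) * g l $$ (s, j)) = (f l * g l) $$ (i, j)"
      using carrier_matD[OF assms(1), of l] carrier_matD[OF assms(2), of l] ij
      by (simp add: scalar_prod_def lessThan_atLeast0)
  qed simp
  finally show "(block_row n r k f * block_col m r k g) $$ (i, j) =
      mat_sum n m k (\<lambda>i. f i * g i) $$ (i, j)"
    using ij by (simp add: mat_sum_def)
qed (auto simp: block_row_def block_col_def mat_sum_def)

lemma block_row_mult_block_square:
  fixes f :: "nat \<Rightarrow> 'a :: ring mat"
  assumes "\<And>i. i < k \<Longrightarrow> f i \<in> carrier_mat n r" "\<And>i j. i < k \<Longrightarrow> j < k \<Longrightarrow> g i j \<in> carrier_mat r r"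
  shows "block_row n r k f * block_square r k g = block_row n r k (\<lambda>j. mat_sum n r k (\<lambda>i. f i * g i j))"
proof (rule eq_matI)
  fix i j assume "i < dim_row (block_row n r k (\<lambda>j. mat_sum n r k (\<lambda>i. f i * g i j)))"
    "j < dim_col (block_row n r k (\<lambda>j. mat_sum n r k (\<lambda>i. f i * g i j)))"
  then have ij: "i < n" "j < r * k" by (auto simp: block_row_def)
  note jb = block_index[OF ij(2)]
  have "(block_row n r k f * block_square r k g) $$ (i, j) =
      (\<Sum>c<k * r. f (c div r) $$ (i, c mod r) * g (c div r) (j div r) $$ (c mod r, j mod r))"
    using ij by (simp add: block_row_def block_square_def scalar_prod_def lessThan_atLeast0 mult.commute)
  also have "\<dots> = (\<Sum>l<k. \<Sum>s<r. f l $$ (i, s) * g l (j div r) $$ (s, j mod r))"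
    unfolding sum_blocks by (intro sum.cong refl) auto
  also have "\<dots> = (\<Sum>l<k. (f l * g l (j div r)) $$ (i, j mod r))"
  proof (rule sum.cong)
    fix l assume "l \<in> {..<k}"
    then show "(\<Sum>s<r. f l $$ (i, s) * g l (j div r) $$ (s, j mod r)) = (f l * g l (j div r)) $$ (i, j mod r)"
      using carrier_matD[OF assms(1), of l] carrier_matD[OF assms(2), of l "j div r"] ij jb
      by (simp add: scalar_prod_def lessThan_atLeast0)
  qed simp
  finally show "(block_row n r k f * block_square r k g) $$ (i, j) =
      block_row n r k (\<lambda>j. mat_sum n r k (\<lambda>i. f i * g i j)) $$ (i, j)"
    using ij jb by (simp add: block_row_def mat_sum_def)
qed (auto simp: block_row_def block_square_def)

lemma scaleR_mat_mult:
  fixes A B :: "'a :: real_div_algebra mat"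
  assumes "A \<in> carrier_mat n m" "B \<in> carrier_mat m p"
  shows "scaleR_mat t A * B = scaleR_mat t (A * B)" "A * scaleR_mat t B = scaleR_mat t (A * B)"
  using assms by (auto intro!: eq_matI simp: scalar_prod_def scaleR_sum_right)

section \<open>The corner of a member of minimal rank\<close>

text \<open>A member of smallest nonzero rank, with a full-rank factorization: the data from which \<open>A\<close> will
  be reconstructed.\<close>

locale rank_minimal_member = irreducible_algebra n A
  for n :: nat and A :: "'a :: real_div_algebra mat set" +
  fixes r :: nat and T B C R :: "'a mat"
  assumes T: "T \<in> A" "T = B * C"
    and carriers: "B \<in> carrier_mat n r" "C \<in> carrier_mat r n" "R \<in> carrier_mat n r"
    and B_inj: "inj_mat B" and CR: "C * R = 1\<^sub>m r" and r_pos: "r > 0"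
    and minimal: "\<And>a. a \<in> A \<Longrightarrow> mat_rank a < r \<Longrightarrow> a = 0\<^sub>m n n"
begin

text \<open>Multiplication by \<open>B\<close> on the left and by \<open>C\<close> on the right identifies the corner with \<open>T A T\<close>,
  but here it acts faithfully on a space of dimension \<open>r\<close>.\<close>

definition corner :: "'a mat set" where
  "corner = (\<lambda>a. C * a * B) ` A"

lemma through_T:
  assumes "a \<in> A" "b \<in> A" "M \<in> carrier_mat p n" "N \<in> carrier_mat n q"
  shows "(M * a * B) * (C * b * N) = M * (a * T * b) * N"
  using assms carriers closed(1)[OF assms(1)] closed(1)[OF assms(2)]
  by (simp add: T(2) mat_assoc)

lemma corner_real_matrix_algebra: "real_matrix_algebra r corner"
  unfolding real_matrix_algebra_def
proof (intro conjI ballI allI)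
  note cC = closed(1)
  show "corner \<subseteq> carrier_mat r r" using carriers cC by (auto simp: corner_def)
  have scale: "scaleR_mat t x \<in> corner" if x: "x \<in> corner" for t x
  proof -
    obtain a where a: "a \<in> A" "x = C * a * B" using x unfolding corner_def by blast
    have "scaleR_mat t x = C * scaleR_mat t a * B"
      using carriers cC[OF a(1)] by (simp add: a(2) scaleR_mat_mult[of _ r n _ n] scaleR_mat_mult[of _ r n _ r])
    then show ?thesis using closed(4)[OF a(1)] unfolding corner_def by blast
  qed
  then show "scaleR_mat t x \<in> corner" if "x \<in> corner" for t x using that .
  show "- x \<in> corner" if "x \<in> corner" for x
  proof -
    have "- x = scaleR_mat (- 1) x" by auto
    then show ?thesis using scale[OF that] by simp
  qed
  have "C * 0\<^sub>m n n * B = 0\<^sub>m r r" using carriers by simp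
  then show "0\<^sub>m r r \<in> corner" using closed(5) unfolding corner_def by (metis imageI)
next
  fix x y assume "x \<in> corner" "y \<in> corner"
  then obtain a b where ab: "a \<in> A" "b \<in> A" "x = C * a * B" "y = C * b * B" unfolding corner_def by blast
  note c = carriers closed(1)[OF ab(1)] closed(1)[OF ab(2)]
  have "x + y = C * (a + b) * B"
    using c by (simp add: ab mult_add_distrib_mat[of _ r n] add_mult_distrib_mat[of _ r n])
  then show "x + y \<in> corner" using closed(2)[OF ab(1,2)] unfolding corner_def by blast
  have "x * y = C * (a * T * b) * B"
    unfolding ab(3,4) by (rule through_T[OF ab(1,2) carriers(2,1)])
  then show "x * y \<in> corner" using closed(3) ab T(1) unfolding corner_def by blast
qed

lemma B_nonzero: "x \<in> carrier_vec r \<Longrightarrow> x \<noteq> 0\<^sub>v r \<Longrightarrow> B *\<^sub>v x \<noteq> 0\<^sub>v n"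
  using inj_matD[OF B_inj carriers(1)] by blast

lemma corner_mult_vec:
  "a \<in> A \<Longrightarrow> x \<in> carrier_vec r \<Longrightarrow> (C * a * B) *\<^sub>v x = C *\<^sub>v (a *\<^sub>v (B *\<^sub>v x))"
  using carriers closed(1)[of a]
  by (simp add: assoc_mult_mat_vec[of _ r n _ r] assoc_mult_mat_vec[of _ r n _ n])

text \<open>Orbits in the corner are images under \<open>C\<close>, which is surjective, of orbits of \<open>A\<close>.\<close>

lemma corner_cyclic: "all_vectors_cyclic r corner"
  unfolding all_vectors_cyclic_def
proof (intro ballI impI allI)
  fix x V assume x: "x \<in> carrier_vec r" "x \<noteq> 0\<^sub>v r" and V: "right_subspace r V" "\<forall>k\<in>corner. k *\<^sub>v x \<in> V"
  let ?W = "{v \<in> carrier_vec n. C *\<^sub>v v \<in> V}"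
  have "right_subspace n ?W" using right_subspace_preimage[OF carriers(2) V(1)] .
  moreover have "a *\<^sub>v (B *\<^sub>v x) \<in> ?W" if "a \<in> A" for a
  proof -
    have "(C * a * B) *\<^sub>v x \<in> V" using V(2) that unfolding corner_def by blast
    then show ?thesis using corner_mult_vec[OF that x(1)] closed(1)[OF that] carriers x(1) by auto
  qed
  moreover have "B *\<^sub>v x \<in> carrier_vec n" using carriers x(1) by auto
  ultimately have W: "?W = carrier_vec n"
    using cyclic B_nonzero[OF x] unfolding all_vectors_cyclic_def by blast
  have "y \<in> V" if y: "y \<in> carrier_vec r" for y
  proof -
    have "R *\<^sub>v y \<in> ?W" unfolding W using carriers y by auto
    then have "C *\<^sub>v (R *\<^sub>v y) \<in> V" by blast
    moreover have "C *\<^sub>v (R *\<^sub>v y) = (C * R) *\<^sub>v y"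
      using carriers y by (intro assoc_mult_mat_vec[symmetric]) auto
    ultimately show ?thesis using y by (simp add: CR)
  qed
  then show "V = carrier_vec r" using V(1) unfolding right_subspace_def by blast
qed

lemma corner_division: "division_matrix_algebra r corner"
proof unfold_locales
  fix k assume "k \<in> corner" and nz: "k \<noteq> 0\<^sub>m r r"
  then obtain a where a: "a \<in> A" "k = C * a * B" unfolding corner_def by blast
  have aC: "a \<in> carrier_mat n n" using closed a by blast
  have kC: "k \<in> carrier_mat r r" using a carriers aC by auto
  show "inj_mat k"
  proof (rule ccontr)
    assume "\<not> inj_mat k"
    then obtain y where y: "y \<in> carrier_vec r" "k *\<^sub>v y = 0\<^sub>v r" "y \<noteq> 0\<^sub>v r"
      using kC by (auto simp: inj_mat_def)
    have "(B * k) *\<^sub>v y = B *\<^sub>v (k *\<^sub>v y)" using carriers kC y by (intro assoc_mult_mat_vec) auto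
    also have "\<dots> = 0\<^sub>v n" unfolding y(2) using carriers by (auto simp: scalar_prod_def)
    finally have "\<not> inj_mat (B * k)"
      using inj_matD[of "B * k" n r y] y carriers kC by auto
    then have "mat_rank (B * k * C) < r"
      using mat_rank_product_less[of "B * k" n r C n] carriers kC by auto
    moreover have eq: "T * a * T = B * k * C"
      using carriers aC by (simp add: T(2) a(2) mat_assoc)
    moreover have "T * a * T \<in> A" using closed(3) T(1) a(1) by blast
    ultimately have "B * k * C = 0\<^sub>m n n" using minimal by metis
    then have "B * (k * C) = 0\<^sub>m n n" using carriers kC by (simp add: mat_assoc)
    then have "k * C = 0\<^sub>m r n"
      using inj_mat_cancel_zero[OF B_inj carriers(1), of "k * C" n] carriers kC by auto
    then have "k * (C * R) = 0\<^sub>m r r"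
      unfolding assoc_mult_mat[OF kC carriers(2,3), symmetric] using carriers by simp
    then show False using nz kC by (simp add: CR)
  qed
qed (use corner_real_matrix_algebra corner_cyclic r_pos in auto)

end

section \<open>Dual bases\<close>

context rank_minimal_member
begin

text \<open>For an idempotent \<open>T\<close> these are dual systems in the left ideal \<open>A T\<close> and the right ideal \<open>T A\<close>,
  viewed as vector spaces over the division algebra \<open>T A T\<close>.\<close>

definition dual_system :: "nat \<Rightarrow> (nat \<Rightarrow> 'a mat) \<Rightarrow> (nat \<Rightarrow> 'a mat) \<Rightarrow> bool" where
  "dual_system k f g \<longleftrightarrow>
     (\<forall>i<k. f i \<in> (\<lambda>a. a * B) ` A) \<and> (\<forall>i<k. g i \<in> (\<lambda>a. C * a) ` A) \<and>
     (\<forall>i<k. \<forall>j<k. g i * f j = (if i = j then 1\<^sub>m r else 0\<^sub>m r r))"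

lemma dual_system_carrier:
  assumes "dual_system k f g" "i < k"
  shows "f i \<in> carrier_mat n r" "g i \<in> carrier_mat r n"
proof -
  obtain a b where ab: "a \<in> A" "b \<in> A" "f i = a * B" "g i = C * b"
    using assms unfolding dual_system_def by blast
  show "f i \<in> carrier_mat n r" "g i \<in> carrier_mat r n"
    using carriers closed(1)[OF ab(1)] closed(1)[OF ab(2)] by (auto simp: ab(3,4))
qed

lemma dual_system_products:
  assumes "dual_system k f g" "i < k" "j < k"
  shows "f i * g j \<in> A" and "a \<in> A \<Longrightarrow> g i * a * f j \<in> corner"
proof -
  obtain a b where ab: "a \<in> A" "b \<in> A" "f i = a * B" "g j = C * b"
    using assms unfolding dual_system_def by blast
  have "f i * g j = a * T * b"
    using carriers closed(1)[OF ab(1)] closed(1)[OF ab(2)]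
    by (simp add: ab T(2) mat_assoc)
  then show "f i * g j \<in> A" using closed(3) ab T(1) by simp
next
  assume a: "a \<in> A"
  obtain b c where bc: "b \<in> A" "c \<in> A" "f j = b * B" "g i = C * c"
    using assms unfolding dual_system_def by blast
  have "g i * a * f j = C * (c * a * b) * B"
    using carriers closed(1)[OF bc(1)] closed(1)[OF bc(2)] closed(1)[OF a]
    by (simp add: bc mat_assoc)
  then show "g i * a * f j \<in> corner" using closed(3) bc a unfolding corner_def by blast
qed

lemma dual_system_sum_mem:
  assumes "dual_system k f g"
  shows "mat_sum n n k (\<lambda>i. f i * g i) \<in> A"
  using closed dual_system_products(1)[OF assms] by (intro mat_sum_closed) auto

lemma dual_system_block_inverse:
  assumes "dual_system k f g"
  shows "block_col n r k g * block_row n r k f = 1\<^sub>m (r * k)"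
proof -
  have "block_col n r k g * block_row n r k f = block_square r k (\<lambda>i j. g i * f j)"
    using dual_system_carrier[OF assms] by (intro block_col_mult_block_row) auto
  also have "\<dots> = block_square r k (\<lambda>i j. if i = j then 1\<^sub>m r else 0\<^sub>m r r)"
    using assms by (intro block_square_cong) (auto simp: dual_system_def)
  finally show ?thesis unfolding block_square_one .
qed

lemma dual_system_size_le:
  assumes "dual_system k f g"
  shows "k \<le> n"
proof -
  have "r * k \<le> n"
    using inj_mat_cols_le_rows[OF inj_mat_left_inverse[OF dual_system_block_inverse[OF assms]]]
    by (meson block_carriers)
  moreover have "1 * k \<le> r * k" using r_pos by (intro mult_le_mono1) simp
  ultimately show ?thesis by linarith
qed

lemma dual_system_absorb:
  assumes "dual_system k f g" "j < k"
  shows "mat_sum n n k (\<lambda>i. f i * g i) * f j = f j" "g j * mat_sum n n k (\<lambda>i. f i * g i) = g j"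
proof -
  note c = dual_system_carrier[OF assms(1)]
  have d: "g i * f l = (if i = l then 1\<^sub>m r else 0\<^sub>m r r)" if "i < k" "l < k" for i l
    using assms(1) that by (simp add: dual_system_def)
  have "mat_sum n n k (\<lambda>i. f i * g i) * f j = mat_sum n r k (\<lambda>i. f i * g i * f j)"
    using c assms(2) by (intro mat_sum_mult_right) (auto intro: mult_carrier_mat)
  also have "\<dots> = mat_sum n r k (\<lambda>i. if i = j then f j else 0\<^sub>m n r)"
  proof (rule mat_sum_cong)
    fix i assume i: "i < k"
    have "f i * g i * f j = f i * (g i * f j)"
      using c[OF i] c[OF assms(2)] by (intro assoc_mult_mat) auto
    then show "f i * g i * f j = (if i = j then f j else 0\<^sub>m n r)"
      unfolding d[OF i assms(2)] using c(1)[OF i] by auto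
  qed
  also have "\<dots> = (if j = j then f j else 0\<^sub>m n r)"
    using c[OF assms(2)] assms(2) by (intro mat_sum_delta) auto
  finally show "mat_sum n n k (\<lambda>i. f i * g i) * f j = f j" by simp
  have "g j * mat_sum n n k (\<lambda>i. f i * g i) = mat_sum r n k (\<lambda>i. g j * (f i * g i))"
    using c assms(2) by (intro mat_sum_mult_left) (auto intro: mult_carrier_mat)
  also have "\<dots> = mat_sum r n k (\<lambda>i. if i = j then g j else 0\<^sub>m r n)"
  proof (rule mat_sum_cong)
    fix i assume i: "i < k"
    have "g j * (f i * g i) = g j * f i * g i"
      using c[OF i] c[OF assms(2)] by (intro assoc_mult_mat[symmetric]) auto
    then show "g j * (f i * g i) = (if i = j then g j else 0\<^sub>m r n)"
      unfolding d[OF assms(2) i] using c(2)[OF i] by auto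
  qed
  also have "\<dots> = (if j = j then g j else 0\<^sub>m r n)"
    using c[OF assms(2)] assms(2) by (intro mat_sum_delta) auto
  finally show "g j * mat_sum n n k (\<lambda>i. f i * g i) = g j" by simp
qed

text \<open>One step of a Gram-Schmidt process.  The sum \<open>p\<close> of the \<open>f i * g i\<close> is an idempotent, and its
  complement \<open>e\<close> annihilates the system from both sides.  If \<open>e\<close> is not zero, irreducibility yields a
  nonzero \<open>f1 = e * c1 * B\<close> in \<open>e A B\<close>, and then a \<open>g1\<close> in \<open>C A e\<close> with \<open>g1 * f1\<close> nonzero.  This product
  is invertible in the corner, so \<open>g1\<close> can be normalised.\<close>

lemma dual_system_extend:
  assumes basis: "real_basis d (\<epsilon> :: nat \<Rightarrow> 'a)" and sys: "dual_system k f g"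
    and incomplete: "mat_sum n n k (\<lambda>i. f i * g i) \<noteq> 1\<^sub>m n"
  shows "\<exists>f' g'. dual_system (Suc k) f' g'"
proof -
  interpret K: division_matrix_algebra r corner by (rule corner_division)
  define p where "p = mat_sum n n k (\<lambda>i. f i * g i)"
  have pA: "p \<in> A" unfolding p_def by (rule dual_system_sum_mem[OF sys])
  have p: "p \<in> carrier_mat n n" by (simp add: p_def)
  note c = dual_system_carrier[OF sys]
  have pf: "p * f j = f j" and gp: "g j * p = g j" if "j < k" for j
    unfolding p_def using dual_system_absorb[OF sys that] by blast+
  have pp: "p * p = p"
  proof -
    have "p * p = mat_sum n n k (\<lambda>i. p * (f i * g i))"
      unfolding p_def using c by (intro mat_sum_mult_left) (auto intro: mult_carrier_mat)
    also have "\<dots> = mat_sum n n k (\<lambda>i. f i * g i)"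
    proof (rule mat_sum_cong)
      fix i assume i: "i < k"
      have "p * (f i * g i) = (p * f i) * g i" using p c[OF i] by (simp add: assoc_mult_mat[OF p])
      then show "p * (f i * g i) = f i * g i" using pf[OF i] by simp
    qed
    finally show ?thesis by (simp add: p_def)
  qed
  define e where "e = 1\<^sub>m n - p"
  have e: "e \<in> carrier_mat n n" unfolding e_def using p by (rule minus_carrier_mat)
  have ef: "e * f j = 0\<^sub>m n r" and ge: "g j * e = 0\<^sub>m r n" if "j < k" for j
  proof -
    show "e * f j = 0\<^sub>m n r"
      using c[OF that] p by (simp add: e_def minus_mult_distrib_mat[of _ n n] pf[OF that] minus_r_inv_mat)
    have "g j * e = g j * 1\<^sub>m n - g j * p"
      unfolding e_def using c[OF that] p by (intro mult_minus_distrib_mat) auto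
    then show "g j * e = 0\<^sub>m r n" using c[OF that] by (simp add: gp[OF that] minus_r_inv_mat)
  qed
  have ee: "e * e = e"
  proof -
    have "e * e = e * 1\<^sub>m n - e * p" unfolding e_def using p by (intro mult_minus_distrib_mat) auto
    also have "e * p = p - p" using p by (simp add: e_def minus_mult_distrib_mat[of _ n n] pp)
    finally show ?thesis using e p by (auto intro!: eq_matI)
  qed
  have diff: "a - b \<in> A" if "a \<in> A" "b \<in> A" for a b
  proof -
    have "a - b = a + scaleR_mat (- 1) b"
      using closed(1)[OF that(1)] closed(1)[OF that(2)] by (intro eq_matI) auto
    then show ?thesis using closed(2)[OF that(1) closed(4)[OF that(2)]] by simp
  qed
  have eA: "e * a \<in> A" "a * e \<in> A" if a: "a \<in> A" for a
  proof -
    have aC: "a \<in> carrier_mat n n" using closed(1)[OF a] .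
    have "e * a = 1\<^sub>m n * a - p * a" "a * e = a * 1\<^sub>m n - a * p"
      unfolding e_def using aC p
      by (intro minus_mult_distrib_mat mult_minus_distrib_mat; auto)+
    then have "e * a = a - p * a" "a * e = a - a * p" using aC by simp_all
    then show "e * a \<in> A" "a * e \<in> A" using diff closed(3) a pA by auto
  qed
  have "e \<noteq> 0\<^sub>m n n"
  proof
    assume z: "e = 0\<^sub>m n n"
    have "p = 1\<^sub>m n"
    proof (rule eq_matI)
      fix i j assume "i < dim_row (1\<^sub>m n :: 'a mat)" "j < dim_col (1\<^sub>m n :: 'a mat)"
      then have ij: "i < n" "j < n" by auto
      have "e $$ (i, j) = 0" using z ij by simp
      then show "p $$ (i, j) = 1\<^sub>m n $$ (i, j)" using ij p by (simp add: e_def)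
    qed (use p in auto)
    then show False using incomplete by (simp add: p_def)
  qed
  define w where "w = (unit_vec r 0 :: 'a vec)"
  have w: "w \<in> carrier_vec r" "w \<noteq> 0\<^sub>v r" unfolding w_def by (rule K.nonzero_vector)+
  have Bw: "B *\<^sub>v w \<in> carrier_vec n" using carriers w by auto
  obtain c1 where c1: "c1 \<in> A" "e *\<^sub>v (c1 *\<^sub>v (B *\<^sub>v w)) \<noteq> 0\<^sub>v n"
    using annihilator_of_orbit[OF cyclic Bw B_nonzero[OF w] _ e] closed(1) \<open>e \<noteq> 0\<^sub>m n n\<close> by blast
  have c1C: "c1 \<in> carrier_mat n n" using closed c1 by blast
  define z where "z = e *\<^sub>v (c1 *\<^sub>v (B *\<^sub>v w))"
  have z: "z \<in> carrier_vec n" "z \<noteq> 0\<^sub>v n" using e c1C Bw c1 by (auto simp: z_def)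
  have "C \<noteq> 0\<^sub>m r n"
  proof
    assume "C = 0\<^sub>m r n"
    then have "(1\<^sub>m r :: 'a mat) = 0\<^sub>m r r" using CR carriers by simp
    then have "(1\<^sub>m r :: 'a mat) $$ (0, 0) = 0\<^sub>m r r $$ (0, 0)" by simp
    then show False using r_pos by simp
  qed
  then obtain d1 where d1: "d1 \<in> A" "C *\<^sub>v (d1 *\<^sub>v z) \<noteq> 0\<^sub>v r"
    using annihilator_of_orbit[OF cyclic z _ carriers(2)] closed(1) by blast
  have d1C: "d1 \<in> carrier_mat n n" using closed d1 by blast
  define f1 where "f1 = (e * c1) * B"
  define g1 where "g1 = C * (d1 * e)"
  have f1: "f1 \<in> (\<lambda>a. a * B) ` A" unfolding f1_def using eA c1 by blast
  have f1C: "f1 \<in> carrier_mat n r" and g1C: "g1 \<in> carrier_mat r n"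
    using e c1C d1C carriers by (auto simp: f1_def g1_def)
  have ef1: "e * f1 = f1"
  proof -
    have "e * f1 = (e * e) * (c1 * B)" using e c1C carriers by (simp add: f1_def mat_assoc)
    then show ?thesis unfolding ee using e c1C carriers by (simp add: f1_def mat_assoc)
  qed
  have prod: "g1 * f1 = C * (d1 * (e * c1)) * B"
  proof -
    have "g1 * f1 = C * (d1 * (e * f1))"
      using e d1C f1C carriers by (simp add: g1_def mat_assoc)
    also have "\<dots> = C * (d1 * (e * c1)) * B"
      unfolding ef1 unfolding f1_def using e d1C c1C carriers
      by (simp add: mat_assoc)
    finally show ?thesis .
  qed
  then have prodK: "g1 * f1 \<in> corner"
    unfolding corner_def using closed(3)[OF d1(1) eA(1)[OF c1(1)]] by blast
  have "(g1 * f1) *\<^sub>v w = C *\<^sub>v (d1 *\<^sub>v z)"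
    unfolding prod corner_mult_vec[OF closed(3)[OF d1(1) eA(1)[OF c1(1)]] w(1)] z_def
    using d1C e c1C Bw by (simp add: assoc_mult_mat_vec[of _ n n _ n])
  moreover have "0\<^sub>m r r *\<^sub>v w = 0\<^sub>v r" using w(1) by (intro eq_vecI) auto
  ultimately have nz: "g1 * f1 \<noteq> 0\<^sub>m r r" using d1(2) by force
  obtain \<kappa> where \<kappa>: "\<kappa> \<in> corner" "\<kappa> * (g1 * f1) = 1\<^sub>m r"
    using K.left_inverse[OF basis prodK nz] by blast
  have \<kappa>C: "\<kappa> \<in> carrier_mat r r" using K.closed(1)[OF \<kappa>(1)] .
  define g2 where "g2 = \<kappa> * g1"
  have g2C: "g2 \<in> carrier_mat r n" using \<kappa>C g1C by (simp add: g2_def)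
  have g2: "g2 \<in> (\<lambda>a. C * a) ` A"
  proof -
    obtain a where a: "a \<in> A" "\<kappa> = C * a * B" using \<kappa>(1) unfolding corner_def by blast
    have aC: "a \<in> carrier_mat n n" using closed a by blast
    have "g2 = C * (a * T * (d1 * e))"
      using carriers aC d1C e
      by (simp add: g2_def g1_def a(2) T(2) mat_assoc)
    moreover have "a * T * (d1 * e) \<in> A" using closed(3) a(1) T(1) eA(2)[OF d1(1)] by blast
    ultimately show ?thesis by blast
  qed
  have g2f1: "g2 * f1 = 1\<^sub>m r" using \<kappa>(2) \<kappa>C g1C f1C by (simp add: g2_def mat_assoc)
  have g2f: "g2 * f j = 0\<^sub>m r r" if "j < k" for j
  proof -
    have "g2 * f j = \<kappa> * (C * (d1 * (e * f j)))"
      using \<kappa>C carriers d1C e c[OF that]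
      by (simp add: g2_def g1_def mat_assoc)
    then show ?thesis using \<kappa>C carriers d1C by (simp add: ef[OF that])
  qed
  have gf1: "g j * f1 = 0\<^sub>m r r" if "j < k" for j
  proof -
    have "g j * f1 = (g j * e) * f1" using c[OF that] e f1C ef1 by (simp add: mat_assoc)
    then show ?thesis using f1C by (simp add: ge[OF that])
  qed
  have "dual_system (Suc k) (f(k := f1)) (g(k := g2))"
    using sys f1 g2 g2f1 g2f gf1 unfolding dual_system_def by (auto simp: less_Suc_eq)
  then show ?thesis by blast
qed

lemma complete_dual_system:
  assumes basis: "real_basis d (\<epsilon> :: nat \<Rightarrow> 'a)"
  obtains k f g where "dual_system k f g" "mat_sum n n k (\<lambda>i. f i * g i) = 1\<^sub>m n"
proof -
  define good where "good k \<longleftrightarrow> (\<exists>f g. dual_system k f g)" for k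
  have "good 0" by (simp add: good_def dual_system_def)
  have bd: "\<forall>k. good k \<longrightarrow> k \<le> n" using dual_system_size_le by (auto simp: good_def)
  define k where "k = (GREATEST k. good k)"
  have k: "good k" "\<not> good (Suc k)"
    using GreatestI_nat[of good 0 n] Greatest_le_nat[of good "Suc k" n] \<open>good 0\<close> bd
    by (auto simp: k_def)
  then obtain f g where sys: "dual_system k f g" by (auto simp: good_def)
  have "mat_sum n n k (\<lambda>i. f i * g i) = 1\<^sub>m n"
  proof (rule ccontr)
    assume "mat_sum n n k (\<lambda>i. f i * g i) \<noteq> 1\<^sub>m n"
    from dual_system_extend[OF basis sys this] show False using k(2) by (auto simp: good_def)
  qed
  with sys show ?thesis using that by blast
qed

text \<open>The change of basis \<open>X\<close>, \<open>Y\<close> that normalises the corner is absorbed into the dual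
  system.  Then \<open>Q * a * P\<close> has normalised corner elements as blocks, and conversely every
  matrix of such blocks comes from a member of \<open>A\<close>, because \<open>(A B) K (C A)\<close> is contained in \<open>A\<close>.\<close>

lemma similar_block_subst:
  fixes \<beta> :: "'q \<Rightarrow> 'a mat"
  assumes basis: "real_basis d (\<epsilon> :: nat \<Rightarrow> 'a)"
    and sim: "similar_families r corner (range \<beta>)"
  shows "r dvd n" and "similar_families n A (block_subst r \<beta> ` carrier_mat (n div r) (n div r))"
proof -
  obtain Y X where YX: "Y \<in> carrier_mat r r" "X \<in> carrier_mat r r" "inverts_mat Y X" "inverts_mat X Y"
    and K: "corner = (\<lambda>M. X * M * Y) ` range \<beta>"
    using sim unfolding similar_families_def by blast
  have \<beta>: "\<beta> q \<in> carrier_mat r r" for q using sim unfolding similar_families_def by blast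
  have XY: "Y * X = 1\<^sub>m r" "X * Y = 1\<^sub>m r" using YX by (auto simp: inverts_mat_def)
  obtain k f g where sys: "dual_system k f g" and one: "mat_sum n n k (\<lambda>i. f i * g i) = 1\<^sub>m n"
    using complete_dual_system[OF basis] by blast
  note c = dual_system_carrier[OF sys]
  define F G where "F i = f i * X" and "G i = Y * g i" for i
  have FG: "F i \<in> carrier_mat n r" "G i \<in> carrier_mat r n" if "i < k" for i
    using c[OF that] YX by (auto simp: F_def G_def)
  define P Q where "P = block_row n r k F" and "Q = block_col n r k G"
  have PQc: "P \<in> carrier_mat n (r * k)" "Q \<in> carrier_mat (r * k) n" by (simp_all add: P_def Q_def)
  have PQ: "P * Q = 1\<^sub>m n"
  proof -
    have "P * Q = mat_sum n n k (\<lambda>i. F i * G i)"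
      unfolding P_def Q_def using FG by (intro block_row_mult_block_col) auto
    also have "\<dots> = mat_sum n n k (\<lambda>i. f i * g i)"
    proof (rule mat_sum_cong)
      fix i assume i: "i < k"
      have "F i * G i = f i * ((X * Y) * g i)"
        using c[OF i] YX(1,2)
        by (simp add: F_def G_def mat_assoc)
      then show "F i * G i = f i * g i" using c[OF i] by (simp add: XY)
    qed
    finally show ?thesis using one by simp
  qed
  have coords: "\<exists>M \<in> carrier_mat k k. Q * a * P = block_subst r \<beta> M" if a: "a \<in> A" for a
  proof -
    have aC: "a \<in> carrier_mat n n" using closed a by blast
    have "\<exists>q. Y * (g i * a * f j) * X = \<beta> q" if ij: "i < k" "j < k" for i j
    proof -
      obtain q where q: "g i * a * f j = X * \<beta> q * Y"
        using dual_system_products(2)[OF sys ij a] unfolding K by blast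
      have "Y * (X * \<beta> q * Y) * X = (Y * X) * \<beta> q * (Y * X)"
        using YX(1,2) \<beta>[of q] by (simp add: mat_assoc)
      then have "Y * (g i * a * f j) * X = \<beta> q" unfolding q using \<beta>[of q] by (simp add: XY)
      then show ?thesis by blast
    qed
    then obtain q where q: "\<And>i j. i < k \<Longrightarrow> j < k \<Longrightarrow> Y * (g i * a * f j) * X = \<beta> (q i j)" by metis
    define M where "M = mat k k (\<lambda>(i, j). q i j)"
    have "Q * a * P = Q * (a * P)" using PQc aC by (simp add: mat_assoc)
    also have "a * P = block_row n r k (\<lambda>j. a * F j)"
      unfolding P_def using aC FG by (intro mult_block_row) auto
    also have "Q * \<dots> = block_square r k (\<lambda>i j. G i * (a * F j))"
      unfolding Q_def using FG aC by (intro block_col_mult_block_row) auto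
    also have "\<dots> = block_square r k (\<lambda>i j. \<beta> (M $$ (i, j)))"
    proof (rule block_square_cong)
      fix i j assume ij: "i < k" "j < k"
      have "G i * (a * F j) = Y * (g i * a * f j) * X"
        using YX(1,2) aC c(2)[OF ij(1)] c(1)[OF ij(2)]
        by (simp add: F_def G_def mat_assoc)
      then show "G i * (a * F j) = \<beta> (M $$ (i, j))" using q[OF ij] ij by (simp add: M_def)
    qed
    also have "\<dots> = block_subst r \<beta> M" by (rule block_subst_block_square[symmetric]) (simp add: M_def)
    finally show ?thesis by (intro bexI[of _ M]) (simp_all add: M_def)
  qed
  have QP: "Q * P = 1\<^sub>m (r * k)"
  proof -
    have "Q * P = block_square r k (\<lambda>i j. G i * F j)"
      unfolding P_def Q_def using FG by (intro block_col_mult_block_row) auto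
    also have "\<dots> = block_square r k (\<lambda>i j. if i = j then 1\<^sub>m r else 0\<^sub>m r r)"
    proof (rule block_square_cong)
      fix i j assume ij: "i < k" "j < k"
      have "G i * F j = Y * (g i * f j) * X"
        using YX(1,2) c(2)[OF ij(1)] c(1)[OF ij(2)]
        by (simp add: F_def G_def mat_assoc)
      also have "g i * f j = (if i = j then 1\<^sub>m r else 0\<^sub>m r r)"
        using sys ij by (simp add: dual_system_def)
      finally show "G i * F j = (if i = j then 1\<^sub>m r else 0\<^sub>m r r)"
        using YX(1,2) by (auto simp: XY)
    qed
    finally show ?thesis unfolding block_square_one .
  qed
  have "r * k \<le> n" using inj_mat_cols_le_rows[OF inj_mat_left_inverse[OF QP PQc(2,1)] PQc(1)] .
  moreover have "n \<le> r * k" using inj_mat_cols_le_rows[OF inj_mat_left_inverse[OF PQ PQc] PQc(2)] .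
  ultimately have n: "n = r * k" by simp
  then show "r dvd n" by simp
  have nk: "n div r = k" using n r_pos by simp
  have sub: "block_subst r \<beta> M \<in> carrier_mat n n" if "M \<in> carrier_mat k k" for M
    using that by (simp add: block_subst_block_square n)
  have fwd: "a \<in> (\<lambda>M. P * M * Q) ` block_subst r \<beta> ` carrier_mat k k" if a: "a \<in> A" for a
  proof -
    have aC: "a \<in> carrier_mat n n" using closed a by blast
    obtain M where M: "M \<in> carrier_mat k k" "Q * a * P = block_subst r \<beta> M" using coords[OF a] by blast
    have "P * (Q * a * P) * Q = (P * Q) * a * (P * Q)"
      using PQc aC by (simp add: mat_assoc)
    then have "a = P * block_subst r \<beta> M * Q" using aC M(2) by (simp add: PQ)
    then show ?thesis using M(1) by blast
  qed
  have bwd: "P * block_subst r \<beta> M * Q \<in> A" if M: "M \<in> carrier_mat k k" for M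
  proof -
    define h where "h j = mat_sum n r k (\<lambda>i. F i * \<beta> (M $$ (i, j)))" for j
    have "P * block_subst r \<beta> M = block_row n r k h"
      unfolding P_def block_subst_block_square[OF M] h_def
      using FG \<beta> by (intro block_row_mult_block_square) auto
    then have "P * block_subst r \<beta> M * Q = mat_sum n n k (\<lambda>j. h j * G j)"
      unfolding Q_def using FG by (simp add: block_row_mult_block_col h_def)
    also have "\<dots> = mat_sum n n k (\<lambda>j. mat_sum n n k (\<lambda>i. F i * \<beta> (M $$ (i, j)) * G j))"
      unfolding h_def using FG \<beta> by (intro mat_sum_cong mat_sum_mult_right) (auto intro: mult_carrier_mat)
    also have "\<dots> \<in> A"
    proof (intro mat_sum_closed)
      fix j i assume ij: "j < k" "i < k"
      obtain a b where ab: "a \<in> A" "b \<in> A" "f i = a * B" "g j = C * b"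
        using sys ij unfolding dual_system_def by blast
      have "X * \<beta> (M $$ (i, j)) * Y \<in> corner" unfolding K by blast
      then obtain l where l: "l \<in> A" "X * \<beta> (M $$ (i, j)) * Y = C * l * B" unfolding corner_def by blast
      note cc = carriers closed(1)[OF ab(1)] closed(1)[OF ab(2)] closed(1)[OF l(1)]
      have "F i * \<beta> (M $$ (i, j)) * G j = f i * (X * \<beta> (M $$ (i, j)) * Y) * g j"
        using YX(1,2) \<beta>[of "M $$ (i, j)"] c(1)[OF ij(2)] c(2)[OF ij(1)]
        by (simp add: F_def G_def mat_assoc)
      also have "\<dots> = a * T * l * T * b"
        unfolding ab l(2) T(2) using cc
        by (simp add: mat_assoc)
      finally show "F i * \<beta> (M $$ (i, j)) * G j \<in> A" using closed(3) ab l(1) T(1) by simp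
    qed (use closed in auto)
    finally show ?thesis .
  qed
  have "A = (\<lambda>M. P * M * Q) ` (block_subst r \<beta> ` carrier_mat k k)" using fwd bwd by blast
  moreover have "inverts_mat Q P" "inverts_mat P Q"
    using PQ QP PQc by (auto simp: inverts_mat_def)
  moreover have "P \<in> carrier_mat n n" "Q \<in> carrier_mat n n" using PQc n by auto
  moreover have "A \<subseteq> carrier_mat n n" "block_subst r \<beta> ` carrier_mat k k \<subseteq> carrier_mat n n"
    using closed(1) sub by auto
  ultimately show "similar_families n A (block_subst r \<beta> ` carrier_mat (n div r) (n div r))"
    unfolding similar_families_def nk by blast
qed

end

section \<open>Irreducible real matrix algebras\<close>

lemma (in irreducible_algebra) min_nonzero_rank_attained:
  obtains T where "T \<in> K" "mat_rank T = min_nonzero_rank K" "min_nonzero_rank K > 0"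
proof -
  obtain k where k: "k \<in> K" "k \<noteq> 0\<^sub>m r r" by (rule nonzero_member)
  then have "\<exists>m. m \<noteq> 0 \<and> (\<exists>A\<in>K. mat_rank A = m)"
    using mat_rank_eq_0_iff[OF closed(1)] by blast
  from LeastI_ex[OF this] show ?thesis using that unfolding min_nonzero_rank_def by blast
qed

lemma (in irreducible_algebra) min_nonzero_rank_le:
  assumes "a \<in> K" "a \<noteq> 0\<^sub>m r r"
  shows "min_nonzero_rank K \<le> mat_rank a"
  unfolding min_nonzero_rank_def
  using assms mat_rank_eq_0_iff[OF closed(1)[OF assms(1)]] by (intro Least_le) blast

lemma rank_minimal_member_exists:
  fixes A :: "'a :: real_div_algebra mat set"
  assumes "n \<ge> 1" "real_matrix_algebra n A" "irreducible_family n A"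
  obtains T B C R where "rank_minimal_member n A (min_nonzero_rank A) T B C R"
proof -
  interpret irreducible_algebra n A
    using assms(1,2) irreducible_all_vectors_cyclic[OF assms(2,3)] by unfold_locales auto
  define r where "r = min_nonzero_rank A"
  obtain T where T: "T \<in> A" "mat_rank T = r" "r > 0"
    using min_nonzero_rank_attained unfolding r_def by blast
  obtain B C R where BCR: "B \<in> carrier_mat n r" "C \<in> carrier_mat r n" "R \<in> carrier_mat n r"
    "T = B * C" "inj_mat B" "C * R = 1\<^sub>m r"
    using rank_factorization[OF closed(1)[OF T(1)]] unfolding T(2) by metis
  have "rank_minimal_member n A r T B C R"
  proof unfold_locales
    fix a assume "a \<in> A" "mat_rank a < r"
    then show "a = 0\<^sub>m n n" using min_nonzero_rank_le[of a] by (auto simp: r_def)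
  qed (use T BCR in auto)
  then show ?thesis using that unfolding r_def by blast
qed

lemma block_subst_1:
  fixes f :: "'b \<Rightarrow> 'a"
  shows "block_subst 1 (\<lambda>q. mat 1 1 (\<lambda>_. f q)) ` carrier_mat n n = map_mat f ` carrier_mat n n"
proof (rule image_cong)
  fix M :: "'b mat" assume "M \<in> carrier_mat n n"
  then show "block_subst 1 (\<lambda>q. mat 1 1 (\<lambda>_. f q)) M = map_mat f M"
    by (auto simp: block_subst_def intro!: eq_matI)
qed simp

lemma map_mat_ident_image: "map_mat (\<lambda>q. q) ` carrier_mat n n = carrier_mat n n"
proof -
  have "map_mat (\<lambda>q. q) M = M" for M :: "'a mat" by (auto intro!: eq_matI)
  then show ?thesis by simp
qed

lemma similar_families_full:
  fixes A :: "'a :: real_div_algebra mat set"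
  assumes "similar_families n A (carrier_mat n n)"
  shows "A = carrier_mat n n"
proof
  show "A \<subseteq> carrier_mat n n" using assms by (auto simp: similar_families_def)
  obtain P Q where PQ: "P \<in> carrier_mat n n" "Q \<in> carrier_mat n n" "inverts_mat P Q" "inverts_mat Q P"
    and A: "A = (\<lambda>B. Q * B * P) ` carrier_mat n n"
    using assms unfolding similar_families_def by blast
  show "carrier_mat n n \<subseteq> A"
  proof
    fix M :: "'a mat" assume M: "M \<in> carrier_mat n n"
    have "Q * (P * M * Q) * P = (Q * P) * M * (Q * P)"
      using PQ(1,2) M by (simp add: mat_assoc)
    also have "\<dots> = M" using PQ M by (simp add: inverts_mat_def)
    finally have "M = Q * (P * M * Q) * P" by simp
    moreover have "P * M * Q \<in> carrier_mat n n" using PQ M by simp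
    ultimately show "M \<in> A" unfolding A by blast
  qed
qed

lemma min_nonzero_rank_full:
  assumes "n \<ge> 1"
  shows "min_nonzero_rank (carrier_mat n n :: 'a :: division_ring mat set) = 1"
proof -
  define E where "E = (mat n 1 (\<lambda>(i, j). if i = 0 then 1 else 0) * mat 1 n (\<lambda>(i, j). if j = 0 then 1 else 0) :: 'a mat)"
  have E: "E \<in> carrier_mat n n" unfolding E_def by (rule mult_carrier_mat[of _ n 1]) simp_all
  have "E $$ (0, 0) = 1" using assms by (simp add: E_def scalar_prod_def)
  then have "E \<noteq> 0\<^sub>m n n" using assms by auto
  then have "mat_rank E \<noteq> 0" using mat_rank_eq_0_iff[OF E] by simp
  moreover have "mat_rank E \<le> 1" unfolding E_def by (rule mat_rank_product_le[of _ n _ _ n]) simp_all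
  ultimately have "mat_rank E = 1" by simp
  then show ?thesis
    unfolding min_nonzero_rank_def using E by (intro Least_equality) (auto intro!: bexI[of _ E])
qed

lemma irreducible_real_algebra:
  fixes A :: "real mat set"
  assumes A: "n \<ge> 1" "real_matrix_algebra n A" "irreducible_family n A"
  defines "r \<equiv> min_nonzero_rank A"
  shows "r dvd n \<and>
    ((r = 1 \<and> A = carrier_mat n n) \<or>
     (r = 2 \<and> similar_families n A (block_subst 2 complex_block ` carrier_mat (n div 2) (n div 2))) \<or>
     (r = 4 \<and> similar_families n A (block_subst 4 quat_real_block ` carrier_mat (n div 4) (n div 4))))"
proof -
  obtain T B C R where "rank_minimal_member n A r T B C R"
    using rank_minimal_member_exists[OF A] unfolding r_def by blast
  then interpret rank_minimal_member n A r T B C R .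
  note reduce = similar_block_subst[OF real_basis_real]
  from real_division_matrix_algebra[OF corner_division] show ?thesis
  proof (elim disjE conjE)
    assume r: "r = 1" and sim: "similar_families r corner (range (\<lambda>a. mat 1 1 (\<lambda>_. a)))"
    have "similar_families n A (carrier_mat n n)"
      using reduce(2)[OF sim] unfolding r block_subst_1 div_by_1 map_mat_ident_image .
    with r show ?thesis by (simp add: similar_families_full)
  next
    assume r: "r = 2" and sim: "similar_families r corner (range complex_block)"
    from reduce[OF sim] show ?thesis by (simp add: r)
  next
    assume r: "r = 4" and sim: "similar_families r corner (range quat_real_block)"
    from reduce[OF sim] show ?thesis by (simp add: r)
  qed
qed

lemma irreducible_complex_algebra:
  fixes A :: "complex mat set"
  assumes A: "n \<ge> 1" "real_matrix_algebra n A" "irreducible_family n A"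
  defines "r \<equiv> min_nonzero_rank A"
  shows "r dvd n \<and>
    ((r = 1 \<and> (A = carrier_mat n n \<or> similar_families n A (map_mat complex_of_real ` carrier_mat n n))) \<or>
     (r = 2 \<and> similar_families n A (block_subst 2 quat_complex_block ` carrier_mat (n div 2) (n div 2))))"
proof -
  obtain T B C R where "rank_minimal_member n A r T B C R"
    using rank_minimal_member_exists[OF A] unfolding r_def by blast
  then interpret rank_minimal_member n A r T B C R .
  note reduce = similar_block_subst[OF real_basis_complex]
  from complex_division_matrix_algebra[OF corner_division] show ?thesis
  proof (elim disjE conjE)
    assume r: "r = 1" and sim: "similar_families r corner (range (\<lambda>a. mat 1 1 (\<lambda>_. complex_of_real a)))"
    have "similar_families n A (map_mat complex_of_real ` carrier_mat n n)"
      using reduce(2)[OF sim] unfolding r block_subst_1 div_by_1 .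
    with r show ?thesis by simp
  next
    assume r: "r = 1" and sim: "similar_families r corner (range (\<lambda>z. mat 1 1 (\<lambda>_. z)))"
    have "similar_families n A (carrier_mat n n)"
      using reduce(2)[OF sim] unfolding r block_subst_1 div_by_1 map_mat_ident_image .
    with r show ?thesis by (simp add: similar_families_full)
  next
    assume r: "r = 2" and sim: "similar_families r corner (range quat_complex_block)"
    from reduce[OF sim] show ?thesis by (simp add: r)
  qed
qed

lemma irreducible_quat_algebra:
  fixes A :: "quat mat set"
  assumes A: "n \<ge> 1" "real_matrix_algebra n A" "irreducible_family n A"
  defines "r \<equiv> min_nonzero_rank A"
  shows "r = 1 \<and>
    (A = carrier_mat n n \<or>
     similar_families n A (map_mat quat_of_complex ` carrier_mat n n) \<or>
     similar_families n A (map_mat (of_real :: real \<Rightarrow> quat) ` carrier_mat n n))"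
proof -
  obtain T B C R where "rank_minimal_member n A r T B C R"
    using rank_minimal_member_exists[OF A] unfolding r_def by blast
  then interpret rank_minimal_member n A r T B C R .
  note reduce = similar_block_subst(2)[OF real_basis_quat]
  from quat_division_matrix_algebra[OF corner_division] show ?thesis
  proof (elim disjE conjE)
    assume r: "r = 1" and sim: "similar_families r corner (range (\<lambda>a. mat 1 1 (\<lambda>_. of_real a)))"
    have "similar_families n A (map_mat (of_real :: real \<Rightarrow> quat) ` carrier_mat n n)"
      using reduce[OF sim] unfolding r block_subst_1 div_by_1 .
    with r show ?thesis by simp
  next
    assume r: "r = 1" and sim: "similar_families r corner (range (\<lambda>z. mat 1 1 (\<lambda>_. quat_of_complex z)))"
    have "similar_families n A (map_mat quat_of_complex ` carrier_mat n n)"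
      using reduce[OF sim] unfolding r block_subst_1 div_by_1 .
    with r show ?thesis by simp
  next
    assume r: "r = 1" and sim: "similar_families r corner (range (\<lambda>q. mat 1 1 (\<lambda>_. q)))"
    have "similar_families n A (carrier_mat n n)"
      using reduce[OF sim] unfolding r block_subst_1 div_by_1 map_mat_ident_image .
    with r show ?thesis by (simp add: similar_families_full)
  qed
qed

theorem theorem1p2:
  shows
    "(\<forall>(n::nat) (\<A> :: real mat set) (r::nat).
        n \<ge> 1 \<and> real_matrix_algebra n \<A> \<and> irreducible_family n \<A> \<and> r = min_nonzero_rank \<A> \<longrightarrow>
          r dvd n \<and> (r = 1 \<or> r = 2 \<or> r = 4) \<and>
          (r = 1 \<longrightarrow> \<A> = carrier_mat n n) \<and>
          (r = 2 \<longrightarrow> similar_families n \<A>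
             (block_subst 2 complex_block ` carrier_mat (n div 2) (n div 2))) \<and>
          (r = 4 \<longrightarrow> similar_families n \<A>
             (block_subst 4 quat_real_block ` carrier_mat (n div 4) (n div 4))) \<and>
          (\<A> = carrier_mat n n \<longleftrightarrow> r = 1)) \<and>
     (\<forall>(n::nat) (\<A> :: complex mat set) (r::nat).
        n \<ge> 1 \<and> real_matrix_algebra n \<A> \<and> irreducible_family n \<A> \<and> r = min_nonzero_rank \<A> \<longrightarrow>
          r dvd n \<and> (r = 1 \<or> r = 2) \<and>
          (r = 1 \<longrightarrow> \<A> = carrier_mat n n \<or>
             similar_families n \<A> (map_mat complex_of_real ` carrier_mat n n)) \<and>
          (r = 2 \<longrightarrow> similar_families n \<A>
             (block_subst 2 quat_complex_block ` carrier_mat (n div 2) (n div 2)))) \<and>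
     (\<forall>(n::nat) (\<A> :: quat mat set) (r::nat).
        n \<ge> 1 \<and> real_matrix_algebra n \<A> \<and> irreducible_family n \<A> \<and> r = min_nonzero_rank \<A> \<longrightarrow>
          r = 1 \<and>
          (\<A> = carrier_mat n n \<or>
           similar_families n \<A> (map_mat quat_of_complex ` carrier_mat n n) \<or>
           similar_families n \<A> (map_mat (of_real :: real \<Rightarrow> quat) ` carrier_mat n n)))"
proof (intro conjI)
  show "\<forall>(n::nat) (\<A> :: real mat set) (r::nat).
        n \<ge> 1 \<and> real_matrix_algebra n \<A> \<and> irreducible_family n \<A> \<and> r = min_nonzero_rank \<A> \<longrightarrow>
          r dvd n \<and> (r = 1 \<or> r = 2 \<or> r = 4) \<and>
          (r = 1 \<longrightarrow> \<A> = carrier_mat n n) \<and>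
          (r = 2 \<longrightarrow> similar_families n \<A>
             (block_subst 2 complex_block ` carrier_mat (n div 2) (n div 2))) \<and>
          (r = 4 \<longrightarrow> similar_families n \<A>
             (block_subst 4 quat_real_block ` carrier_mat (n div 4) (n div 4))) \<and>
          (\<A> = carrier_mat n n \<longleftrightarrow> r = 1)"
  proof (intro allI impI, elim conjE)
    fix n r :: nat and \<A> :: "real mat set"
    assume A: "n \<ge> 1" "real_matrix_algebra n \<A>" "irreducible_family n \<A>" and r: "r = min_nonzero_rank \<A>"
    have "\<A> = carrier_mat n n \<longrightarrow> r = 1" using min_nonzero_rank_full[OF A(1), where 'a = real] r by simp
    with irreducible_real_algebra[OF A] show "r dvd n \<and> (r = 1 \<or> r = 2 \<or> r = 4) \<and>
          (r = 1 \<longrightarrow> \<A> = carrier_mat n n) \<and>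
          (r = 2 \<longrightarrow> similar_families n \<A>
             (block_subst 2 complex_block ` carrier_mat (n div 2) (n div 2))) \<and>
          (r = 4 \<longrightarrow> similar_families n \<A>
             (block_subst 4 quat_real_block ` carrier_mat (n div 4) (n div 4))) \<and>
          (\<A> = carrier_mat n n \<longleftrightarrow> r = 1)"
      unfolding r[symmetric] by (elim conjE disjE) simp_all
  qed
next
  show "\<forall>(n::nat) (\<A> :: complex mat set) (r::nat).
        n \<ge> 1 \<and> real_matrix_algebra n \<A> \<and> irreducible_family n \<A> \<and> r = min_nonzero_rank \<A> \<longrightarrow>
          r dvd n \<and> (r = 1 \<or> r = 2) \<and>
          (r = 1 \<longrightarrow> \<A> = carrier_mat n n \<or>
             similar_families n \<A> (map_mat complex_of_real ` carrier_mat n n)) \<and>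
          (r = 2 \<longrightarrow> similar_families n \<A>
             (block_subst 2 quat_complex_block ` carrier_mat (n div 2) (n div 2)))"
  proof (intro allI impI, elim conjE)
    fix n r :: nat and \<A> :: "complex mat set"
    assume A: "n \<ge> 1" "real_matrix_algebra n \<A>" "irreducible_family n \<A>" and r: "r = min_nonzero_rank \<A>"
    from irreducible_complex_algebra[OF A] show "r dvd n \<and> (r = 1 \<or> r = 2) \<and>
          (r = 1 \<longrightarrow> \<A> = carrier_mat n n \<or>
             similar_families n \<A> (map_mat complex_of_real ` carrier_mat n n)) \<and>
          (r = 2 \<longrightarrow> similar_families n \<A>
             (block_subst 2 quat_complex_block ` carrier_mat (n div 2) (n div 2)))"
      unfolding r[symmetric] by (elim conjE disjE) simp_all
  qed
next
  show "\<forall>(n::nat) (\<A> :: quat mat set) (r::nat).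
        n \<ge> 1 \<and> real_matrix_algebra n \<A> \<and> irreducible_family n \<A> \<and> r = min_nonzero_rank \<A> \<longrightarrow>
          r = 1 \<and>
          (\<A> = carrier_mat n n \<or>
           similar_families n \<A> (map_mat quat_of_complex ` carrier_mat n n) \<or>
           similar_families n \<A> (map_mat (of_real :: real \<Rightarrow> quat) ` carrier_mat n n))"
    using irreducible_quat_algebra by blast
qed

end
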